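(* Let $\mathcal{U}2\mathcal{S}eg$ be the category of unital 2-Segal sets, $\mathcal{DC}at^{st}_{aug}$ the category of augmented stable double categories, $\pi\colon\mathcal{U}2\mathcal{S}eg\to \mathcal{DC}at^{st}_{aug}$ the discrete path construction, $\sigma\colon\mathcal{DC}at^{st}_{aug}\to\mathcal{U}2\mathcal{S}eg$ the discrete Waldhausen construction, $N^a\colon\mathcal{DC}at^{st}_{aug}\to \mathrm{Set}^{\Sigma^{op}}$ the augmented double nerve, and $J\colon\mathcal{U}2\mathcal{S}eg\hookrightarrow \mathrm{Set}^{\Delta^{op}}$ the inclusion. Then there are natural isomorphisms of functors $$N^a\circ\pi\cong p^*\circ J\colon\ \mathcal{U}2\mathcal{S}eg\to\mathrm{Set}^{\Sigma^{op}}\qquad\text{and}\qquad J\circ\sigma\cong p_*\circ N^a\colon\ \mathcal{DC}at^{st}_{aug}\to\mathrm{Set}^{\Delta^{op}}.$$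
   Context: **Unital 2-Segal sets.** A simplicial set $X$ is 2-Segal if for every $n\ge3$ and every triangulation $T$ (with vertices among those of the polygon) of the $(n+1)$-gon with vertices cyclically labelled $0,\dots,n$, restriction $X_n=\mathrm{Hom}(\Delta[n],X)\to\mathrm{Hom}(\Delta[T],X)$ is a bijection, where $\Delta[T]\subset\Delta[n]$ is the union of the 2-simplices in $T$. It is unital if for all $n\ge2$, $0\le i\le n-1$ the square with $s_i\colon X_{n-1}\to X_n$, $\alpha_i\colon X_{n-1}\to X_0$ (the $i$-th vertex), $s_0\colon X_0\to X_1$ and $\beta_i\colon X_n\to X_1$ (the edge $i<i+1$) is a pullback. Morphisms are simplicial maps. **Double categories.** A double category $\mathcal D$ (category internal to categories) has sets $Ob$, $Hor$, $Ver$, $Sq$, source/target maps $s_h,t_h\colon Hor\to Ob$, $s_v,t_v\colon Ver\to Ob$, $s_h,t_h\colon Sq\to Ver$, $s_v,t_v\colon Sq\to Hor$. It is stable if the maps $(s_v,s_h)\colon Sq\to\{(f,g)\in Hor\times Ver: s_hf=s_vg\}$ and $(t_h,t_v)\colon Sq\to\{(g,f)\in Ver\times Hor: t_vg=t_hf\}$ are bijections. It is augmented by a subset $A\subset Ob$ if $\{f\in Hor: s_hf\in A\}\to Ob$, $f\mapsto t_hf$, and $\{g\in Ver:t_vg\in A\}\to Ob$, $g\mapsto s_vg$, are bijections. Morphisms in $\mathcal{DC}at^{st}_{aug}$ are double functors preserving the augmentation sets. **$\mathcal W[n]$.** The augmented stable double category with objects $(i,j)$, $0\le i\le j\le n$;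 horizontal morphisms $(i,j,\ell)\colon(i,j)\to(i,\ell)$, $i\le j\le\ell$; vertical morphisms $(i,k,j)\colon(i,j)\to(k,j)$, $i\le k\le j$; squares $(i,k,j,\ell)$, $i\le k\le j\le\ell$, with $s_v=(i,j,\ell)$, $t_v=(k,j,\ell)$, $s_h=(i,k,j)$, $t_h=(i,k,\ell)$; augmentation $\{(i,i)\}$. It is cosimplicial in $[n]$ by applying monotone maps entrywise. **Discrete path construction $\pi$.** $Ob(\pi X)=X_1$, $Hor(\pi X)=Ver(\pi X)=X_2$, $Sq(\pi X)=X_3$, augmentation $X_0$ (embedded by $s_0$). On $Hor$: $s_h=d_2$, $t_h=d_1$; on $Ver$: $s_v=d_1$, $t_v=d_0$; on $Sq$: $s_v=d_1$, $t_v=d_0$, $s_h=d_3$, $t_h=d_2$. Identities are degeneracies ($s_1$ for horizontal, $s_0$ for vertical identities of objects); compositions are induced by the inverses of 2-Segal maps, e.g. horizontal composition is $X_2\times_{X_1}X_2\xleftarrow{(d_3,d_1),\ \cong}X_3\xrightarrow{d_2}X_2$ and vertical composition is $X_2\times_{X_1}X_2\xleftarrow{(d_2,d_0),\ \cong}X_3\xrightarrow{d_1}X_2$, and similarly for squares using $X_4$. **Discrete Waldhausen construction $\sigma$.** $\sigma(\mathcal D)_n=\mathrm{Hom}_{\mathcal{DC}at^{st}_{aug}}(\mathcal W[n],\mathcal D)$. It is known that $\pi$ and $\sigma$ are well defined and are inverse equivalences of categories. **$\Sigma$, $p$, $N^a$.** $\Sigma$ is obtained from $\Delta\times\Delta$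 by adding a new terminal object $[-1]$ (with no maps from $[-1]$ to objects of $\Delta\times\Delta$). $p\colon\Sigma\to\Delta$ is ordinal sum on $\Delta\times\Delta$, $p([q],[r])=[q+1+r]$, and $p([-1])=[0]$; $p^*\colon \mathrm{Set}^{\Delta^{op}}\to\mathrm{Set}^{\Sigma^{op}}$ is precomposition and $p_*$ its right adjoint. The augmented double nerve is $N^a\mathcal D=\mathrm{Hom}_{\mathcal{DC}at^{st}_{aug}}(\mathcal W[p(-)],\mathcal D)\colon\Sigma^{op}\to\mathrm{Set}$. *)

theory Defs
  imports "HOL-Library.FuncSet"
begin

section \<open>Categories, functors and presheaves\<close>

text \<open>\<open>Comp C g f\<close> is \<open>g\<close> after \<open>f\<close>.\<close>

record ('o, 'm) cat =
  Obj :: "'o set"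
  Arr :: "'m set"
  Dom :: "'m \<Rightarrow> 'o"
  Cod :: "'m \<Rightarrow> 'o"
  Ide :: "'o \<Rightarrow> 'm"
  Comp :: "'m \<Rightarrow> 'm \<Rightarrow> 'm"

definition category :: "('o, 'm) cat \<Rightarrow> bool" where
  "category C \<longleftrightarrow>
     (\<forall>f\<in>Arr C. Dom C f \<in> Obj C \<and> Cod C f \<in> Obj C) \<and>
     (\<forall>a\<in>Obj C. Ide C a \<in> Arr C \<and> Dom C (Ide C a) = a \<and> Cod C (Ide C a) = a) \<and>
     (\<forall>g\<in>Arr C. \<forall>f\<in>Arr C. Dom C g = Cod C f \<longrightarrow>
        Comp C g f \<in> Arr C \<and> Dom C (Comp C g f) = Dom C f \<and> Cod C (Comp C g f) = Cod C g) \<and>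
     (\<forall>f\<in>Arr C. Comp C f (Ide C (Dom C f)) = f \<and> Comp C (Ide C (Cod C f)) f = f) \<and>
     (\<forall>h\<in>Arr C. \<forall>g\<in>Arr C. \<forall>f\<in>Arr C. Dom C h = Cod C g \<longrightarrow> Dom C g = Cod C f \<longrightarrow>
        Comp C (Comp C h g) f = Comp C h (Comp C g f))"

definition full_subcat :: "('o, 'm) cat \<Rightarrow> 'o set \<Rightarrow> ('o, 'm) cat" where
  "full_subcat C S =
     C\<lparr>Obj := Obj C \<inter> S, Arr := {f \<in> Arr C. Dom C f \<in> S \<and> Cod C f \<in> S}\<rparr>"

record ('o, 'm, 'p, 'n) fctr =
  FOb :: "'o \<Rightarrow> 'p"
  FAr :: "'m \<Rightarrow> 'n"

definition is_functor :: "('o, 'm) cat \<Rightarrow> ('p, 'n) cat \<Rightarrow> ('o, 'm, 'p, 'n) fctr \<Rightarrow> bool" where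
  "is_functor C D F \<longleftrightarrow>
     (\<forall>a\<in>Obj C. FOb F a \<in> Obj D) \<and>
     (\<forall>f\<in>Arr C. FAr F f \<in> Arr D \<and>
        Dom D (FAr F f) = FOb F (Dom C f) \<and> Cod D (FAr F f) = FOb F (Cod C f)) \<and>
     (\<forall>a\<in>Obj C. FAr F (Ide C a) = Ide D (FOb F a)) \<and>
     (\<forall>g\<in>Arr C. \<forall>f\<in>Arr C. Dom C g = Cod C f \<longrightarrow>
        FAr F (Comp C g f) = Comp D (FAr F g) (FAr F f))"

definition fcomp :: "('p, 'n, 'q, 'k) fctr \<Rightarrow> ('o, 'm, 'p, 'n) fctr \<Rightarrow> ('o, 'm, 'q, 'k) fctr"
    (infixl "\<circ>\<^sub>F" 55) where
  "G \<circ>\<^sub>F F = \<lparr>FOb = FOb G \<circ> FOb F, FAr = FAr G \<circ> FAr F\<rparr>"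

text \<open>Set-valued presheaves. Values of \<open>Act\<close> off the carriers are irrelevant; natural
  transformations are extensional, so that a set of natural transformations has the right
  elements.\<close>

record ('c, 'm, 'x) psh =
  At :: "'c \<Rightarrow> 'x set"
  Act :: "'m \<Rightarrow> 'x \<Rightarrow> 'x"

definition presheaf :: "('c, 'm) cat \<Rightarrow> ('c, 'm, 'x) psh \<Rightarrow> bool" where
  "presheaf C X \<longleftrightarrow>
     (\<forall>f\<in>Arr C. Act X f \<in> At X (Cod C f) \<rightarrow> At X (Dom C f)) \<and>
     (\<forall>c\<in>Obj C. \<forall>x\<in>At X c. Act X (Ide C c) x = x) \<and>
     (\<forall>g\<in>Arr C. \<forall>f\<in>Arr C. Dom C g = Cod C f \<longrightarrow>
        (\<forall>x\<in>At X (Cod C g). Act X (Comp C g f) x = Act X f (Act X g x)))"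

definition NatTrans :: "('c, 'm) cat \<Rightarrow> ('c, 'm, 'x) psh \<Rightarrow> ('c, 'm, 'y) psh \<Rightarrow> ('c \<Rightarrow> 'x \<Rightarrow> 'y) set" where
  "NatTrans C X Y = {\<theta> \<in> (\<Pi>\<^sub>E c\<in>Obj C. At X c \<rightarrow>\<^sub>E At Y c).
     \<forall>f\<in>Arr C. \<forall>x\<in>At X (Cod C f). \<theta> (Dom C f) (Act X f x) = Act Y f (\<theta> (Cod C f) x)}"

definition nid :: "('c, 'm) cat \<Rightarrow> ('c, 'm, 'x) psh \<Rightarrow> 'c \<Rightarrow> 'x \<Rightarrow> 'x" where
  "nid C X = (\<lambda>c\<in>Obj C. \<lambda>x\<in>At X c. x)"

definition ncomp :: "('c, 'm) cat \<Rightarrow> ('c, 'm, 'x) psh \<Rightarrow> ('c \<Rightarrow> 'y \<Rightarrow> 'z) \<Rightarrow> ('c \<Rightarrow> 'x \<Rightarrow> 'y)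
    \<Rightarrow> 'c \<Rightarrow> 'x \<Rightarrow> 'z" where
  "ncomp C X \<psi> \<theta> = (\<lambda>c\<in>Obj C. \<lambda>x\<in>At X c. \<psi> c (\<theta> c x))"

definition PSh :: "('c, 'm) cat \<Rightarrow>
    (('c, 'm, 'x) psh, ('c, 'm, 'x) psh \<times> ('c \<Rightarrow> 'x \<Rightarrow> 'x) \<times> ('c, 'm, 'x) psh) cat" where
  "PSh C = \<lparr>Obj = {X. presheaf C X},
     Arr = {(X, \<theta>, Y). presheaf C X \<and> presheaf C Y \<and> \<theta> \<in> NatTrans C X Y},
     Dom = (\<lambda>(X, \<theta>, Y). X),
     Cod = (\<lambda>(X, \<theta>, Y). Y),
     Ide = (\<lambda>X. (X, nid C X, X)),
     Comp = (\<lambda>(_, \<psi>, Z) (X, \<theta>, _). (X, ncomp C X \<psi> \<theta>, Z))\<rparr>"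

definition under :: "'a \<times> 'b \<times> 'c \<Rightarrow> 'b" where
  "under f = fst (snd f)"

text \<open>Sets of different types occur in the two functors to be compared, so that isomorphisms of
  presheaves, and natural isomorphisms of presheaf-valued functors, are defined between presheaves
  with elements in possibly different types.\<close>

definition psh_iso :: "('c, 'm) cat \<Rightarrow> ('c, 'm, 'x) psh \<Rightarrow> ('c, 'm, 'y) psh
    \<Rightarrow> ('c \<Rightarrow> 'x \<Rightarrow> 'y) \<Rightarrow> bool" where
  "psh_iso C X Y \<theta> \<longleftrightarrow> \<theta> \<in> NatTrans C X Y \<and>
     (\<exists>\<psi>\<in>NatTrans C Y X. ncomp C X \<psi> \<theta> = nid C X \<and> ncomp C Y \<theta> \<psi> = nid C Y)"

definition naturally_isomorphic :: "('b, 'n) cat \<Rightarrow> ('c, 'm) cat \<Rightarrow>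
    ('b, 'n, ('c, 'm, 'x) psh, ('c, 'm, 'x) psh \<times> ('c \<Rightarrow> 'x \<Rightarrow> 'x) \<times> ('c, 'm, 'x) psh) fctr \<Rightarrow>
    ('b, 'n, ('c, 'm, 'y) psh, ('c, 'm, 'y) psh \<times> ('c \<Rightarrow> 'y \<Rightarrow> 'y) \<times> ('c, 'm, 'y) psh) fctr \<Rightarrow>
    bool" where
  "naturally_isomorphic B C F G \<longleftrightarrow>
     is_functor B (PSh C) F \<and> is_functor B (PSh C) G \<and>
     (\<exists>\<eta>. (\<forall>b\<in>Obj B. psh_iso C (FOb F b) (FOb G b) (\<eta> b)) \<and>
        (\<forall>f\<in>Arr B.
           ncomp C (FOb F (Dom B f)) (\<eta> (Cod B f)) (under (FAr F f)) =
           ncomp C (FOb F (Dom B f)) (under (FAr G f)) (\<eta> (Dom B f))))"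

definition yoneda :: "('c, 'm) cat \<Rightarrow> 'c \<Rightarrow> ('c, 'm, 'm) psh" where
  "yoneda C c = \<lparr>At = (\<lambda>b. {f \<in> Arr C. Dom C f = b \<and> Cod C f = c}), Act = (\<lambda>g f. Comp C f g)\<rparr>"

definition precomp_ob :: "('c, 'm, 'd, 'n) fctr \<Rightarrow> ('d, 'n, 'x) psh \<Rightarrow> ('c, 'm, 'x) psh" where
  "precomp_ob P Y = \<lparr>At = At Y \<circ> FOb P, Act = Act Y \<circ> FAr P\<rparr>"

definition precomp_nat :: "('c, 'm) cat \<Rightarrow> ('c, 'm, 'd, 'n) fctr \<Rightarrow> ('d \<Rightarrow> 'x \<Rightarrow> 'y) \<Rightarrow> 'c \<Rightarrow> 'x \<Rightarrow> 'y" where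
  "precomp_nat C P \<theta> = (\<lambda>c\<in>Obj C. \<theta> (FOb P c))"

text \<open>The right adjoint of precomposition with \<open>P : C \<rightarrow> D\<close>, in its pointwise form
  \<open>(P\<^sub>* F)(d) = Hom(P\<^sup>* D(-, d), F)\<close>. The adjunction is theorem \<open>precomp_ran_adjunction\<close> below.\<close>

definition ran_ob :: "('c, 'm) cat \<Rightarrow> ('d, 'n) cat \<Rightarrow> ('c, 'm, 'd, 'n) fctr \<Rightarrow> ('c, 'm, 'x) psh
    \<Rightarrow> ('d, 'n, 'c \<Rightarrow> 'n \<Rightarrow> 'x) psh" where
  "ran_ob C D P F =
     \<lparr>At = (\<lambda>d. NatTrans C (precomp_ob P (yoneda D d)) F),
      Act = (\<lambda>g \<psi>. \<lambda>c\<in>Obj C. \<lambda>h\<in>At (yoneda D (Dom D g)) (FOb P c). \<psi> c (Comp D g h))\<rparr>"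

definition ran_nat :: "('c, 'm) cat \<Rightarrow> ('d, 'n) cat \<Rightarrow> ('c, 'm, 'd, 'n) fctr \<Rightarrow> ('c, 'm, 'x) psh
    \<Rightarrow> ('c \<Rightarrow> 'x \<Rightarrow> 'y) \<Rightarrow> 'd \<Rightarrow> ('c \<Rightarrow> 'n \<Rightarrow> 'x) \<Rightarrow> 'c \<Rightarrow> 'n \<Rightarrow> 'y" where
  "ran_nat C D P F \<phi> = (\<lambda>d\<in>Obj D. \<lambda>\<psi>\<in>At (ran_ob C D P F) d.
     ncomp C (precomp_ob P (yoneda D d)) \<phi> \<psi>)"


lemma NatTransI:
  assumes "\<And>c. c \<notin> Obj C \<Longrightarrow> \<theta> c = undefined"
    and "\<And>c. c \<in> Obj C \<Longrightarrow> \<theta> c \<in> At X c \<rightarrow>\<^sub>E At Y c"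
    and "\<And>f x. f \<in> Arr C \<Longrightarrow> x \<in> At X (Cod C f) \<Longrightarrow>
           \<theta> (Dom C f) (Act X f x) = Act Y f (\<theta> (Cod C f) x)"
  shows "\<theta> \<in> NatTrans C X Y"
  unfolding NatTrans_def using assms by auto

lemma NatTrans_mem: "\<theta> \<in> NatTrans C X Y \<Longrightarrow> c \<in> Obj C \<Longrightarrow> x \<in> At X c \<Longrightarrow> \<theta> c x \<in> At Y c"
  unfolding NatTrans_def by (auto simp: PiE_iff)

lemma NatTrans_natural: "\<theta> \<in> NatTrans C X Y \<Longrightarrow> f \<in> Arr C \<Longrightarrow> x \<in> At X (Cod C f) \<Longrightarrow>
    \<theta> (Dom C f) (Act X f x) = Act Y f (\<theta> (Cod C f) x)"
  unfolding NatTrans_def by auto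

lemma NatTrans_undef1: "\<theta> \<in> NatTrans C X Y \<Longrightarrow> c \<notin> Obj C \<Longrightarrow> \<theta> c = undefined"
  unfolding NatTrans_def by (auto simp: PiE_iff extensional_def)

lemma NatTrans_undef2: "\<theta> \<in> NatTrans C X Y \<Longrightarrow> c \<in> Obj C \<Longrightarrow> x \<notin> At X c \<Longrightarrow> \<theta> c x = undefined"
  unfolding NatTrans_def by (auto simp: PiE_iff extensional_def)

lemma NatTrans_eqI:
  assumes "\<theta> \<in> NatTrans C X Y" "\<theta>' \<in> NatTrans C X Y'"
    and "\<And>c x. c \<in> Obj C \<Longrightarrow> x \<in> At X c \<Longrightarrow> \<theta> c x = \<theta>' c x"
  shows "\<theta> = \<theta>'"
  by (intro ext) (metis assms NatTrans_undef1 NatTrans_undef2)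

lemma category_simps:
  assumes "category C"
  shows "f \<in> Arr C \<Longrightarrow> Dom C f \<in> Obj C" "f \<in> Arr C \<Longrightarrow> Cod C f \<in> Obj C"
    "a \<in> Obj C \<Longrightarrow> Ide C a \<in> Arr C" "a \<in> Obj C \<Longrightarrow> Dom C (Ide C a) = a" "a \<in> Obj C \<Longrightarrow> Cod C (Ide C a) = a"
    "g \<in> Arr C \<Longrightarrow> f \<in> Arr C \<Longrightarrow> Dom C g = Cod C f \<Longrightarrow> Comp C g f \<in> Arr C"
    "g \<in> Arr C \<Longrightarrow> f \<in> Arr C \<Longrightarrow> Dom C g = Cod C f \<Longrightarrow> Dom C (Comp C g f) = Dom C f"
    "g \<in> Arr C \<Longrightarrow> f \<in> Arr C \<Longrightarrow> Dom C g = Cod C f \<Longrightarrow> Cod C (Comp C g f) = Cod C g"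
    "f \<in> Arr C \<Longrightarrow> Comp C f (Ide C (Dom C f)) = f" "f \<in> Arr C \<Longrightarrow> Comp C (Ide C (Cod C f)) f = f"
    "h \<in> Arr C \<Longrightarrow> g \<in> Arr C \<Longrightarrow> f \<in> Arr C \<Longrightarrow> Dom C h = Cod C g \<Longrightarrow> Dom C g = Cod C f \<Longrightarrow>
        Comp C (Comp C h g) f = Comp C h (Comp C g f)"
  using assms unfolding category_def by blast+

lemma functor_simps:
  assumes "is_functor C D F"
  shows "a \<in> Obj C \<Longrightarrow> FOb F a \<in> Obj D" "f \<in> Arr C \<Longrightarrow> FAr F f \<in> Arr D"
    "f \<in> Arr C \<Longrightarrow> Dom D (FAr F f) = FOb F (Dom C f)" "f \<in> Arr C \<Longrightarrow> Cod D (FAr F f) = FOb F (Cod C f)"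
    "a \<in> Obj C \<Longrightarrow> FAr F (Ide C a) = Ide D (FOb F a)"
    "g \<in> Arr C \<Longrightarrow> f \<in> Arr C \<Longrightarrow> Dom C g = Cod C f \<Longrightarrow>
        FAr F (Comp C g f) = Comp D (FAr F g) (FAr F f)"
  using assms unfolding is_functor_def by blast+

lemma presheaf_simps:
  assumes "presheaf C X"
  shows "f \<in> Arr C \<Longrightarrow> x \<in> At X (Cod C f) \<Longrightarrow> Act X f x \<in> At X (Dom C f)"
    "c \<in> Obj C \<Longrightarrow> x \<in> At X c \<Longrightarrow> Act X (Ide C c) x = x"
    "g \<in> Arr C \<Longrightarrow> f \<in> Arr C \<Longrightarrow> Dom C g = Cod C f \<Longrightarrow> x \<in> At X (Cod C g) \<Longrightarrow>
        Act X (Comp C g f) x = Act X f (Act X g x)"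
  using assms unfolding presheaf_def by blast+

lemma nid_NatTrans: "category C \<Longrightarrow> presheaf C X \<Longrightarrow> nid C X \<in> NatTrans C X X"
  by (rule NatTransI) (auto simp: nid_def category_simps presheaf_simps)

lemma ncomp_NatTrans:
  assumes "category C" "presheaf C X" "\<theta> \<in> NatTrans C X Y" "\<psi> \<in> NatTrans C Y Z"
  shows "ncomp C X \<psi> \<theta> \<in> NatTrans C X Z"
  using assms
  by (intro NatTransI) (auto simp: ncomp_def category_simps presheaf_simps NatTrans_mem NatTrans_natural)

lemma category_PSh:
  assumes C: "category C"
  shows "category (PSh C)"
proof -
  have 1: "ncomp C X \<theta> (nid C X) = \<theta>" if "presheaf C X" "presheaf C Y" "\<theta> \<in> NatTrans C X Y" for X Y \<theta>
    by (rule NatTrans_eqI[OF ncomp_NatTrans that(3)]) (use that C nid_NatTrans in \<open>auto simp: ncomp_def nid_def\<close>)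
  have 2: "ncomp C X (nid C Y) \<theta> = \<theta>" if "presheaf C X" "presheaf C Y" "\<theta> \<in> NatTrans C X Y" for X Y \<theta>
    by (rule NatTrans_eqI[OF ncomp_NatTrans that(3)])
       (use that C nid_NatTrans in \<open>auto simp: ncomp_def nid_def NatTrans_mem\<close>)
  have 3: "ncomp C X (ncomp C Y \<psi> \<phi>) \<theta> = ncomp C X \<psi> (ncomp C X \<phi> \<theta>)"
    if "presheaf C X" "presheaf C Y" "\<theta> \<in> NatTrans C X Y" for X Y \<theta> \<phi> \<psi>
    using that by (auto simp: ncomp_def NatTrans_mem fun_eq_iff)
  show ?thesis
    unfolding category_def PSh_def
    by (auto simp: 1 2 3 C nid_NatTrans ncomp_NatTrans)
qed

lemma category_full_subcat: "category C \<Longrightarrow> category (full_subcat C S)"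
  unfolding category_def full_subcat_def by auto

lemma yoneda_presheaf: "category C \<Longrightarrow> presheaf C (yoneda C c)"
  unfolding presheaf_def yoneda_def by (auto simp: category_simps)

lemma precomp_presheaf:
  assumes C: "category C" and P: "is_functor C D P" and Y: "presheaf D Y"
  shows "presheaf C (precomp_ob P Y)"
proof -
  have "Act Y (FAr P f) y \<in> At Y (FOb P (Dom C f))" if "f \<in> Arr C" "y \<in> At Y (FOb P (Cod C f))" for f y
    using presheaf_simps(1)[OF Y, of "FAr P f" y] functor_simps[OF P] that by simp
  then show ?thesis
    unfolding presheaf_def[of C] precomp_ob_def
    by (simp add: Pi_iff functor_simps[OF P] presheaf_simps[OF Y] category_simps[OF C])
qed

lemma precomp_nat_NatTrans:
  assumes "category C" "is_functor C D P" "\<theta> \<in> NatTrans D X Y"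
  shows "precomp_nat C P \<theta> \<in> NatTrans C (precomp_ob P X) (precomp_ob P Y)"
proof (rule NatTransI)
  fix c assume "c \<in> Obj C"
  then show "precomp_nat C P \<theta> c \<in> At (precomp_ob P X) c \<rightarrow>\<^sub>E At (precomp_ob P Y) c"
    using functor_simps(1)[OF assms(2)] NatTrans_mem[OF assms(3)] NatTrans_undef2[OF assms(3)]
    unfolding precomp_nat_def precomp_ob_def
    by (simp add: PiE_iff extensional_def)
next
  fix f x assume "f \<in> Arr C" "x \<in> At (precomp_ob P X) (Cod C f)"
  then show "precomp_nat C P \<theta> (Dom C f) (Act (precomp_ob P X) f x) =
           Act (precomp_ob P Y) f (precomp_nat C P \<theta> (Cod C f) x)"
    using assms NatTrans_natural[OF assms(3), of "FAr P f" x]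
    by (simp add: precomp_nat_def precomp_ob_def functor_simps category_simps)
qed (simp add: precomp_nat_def)

lemma At_yoneda [simp]: "h \<in> At (yoneda C c) b \<longleftrightarrow> h \<in> Arr C \<and> Dom C h = b \<and> Cod C h = c"
  and Act_yoneda [simp]: "Act (yoneda C c) g h = Comp C h g"
  by (auto simp: yoneda_def)

lemma At_precomp [simp]: "At (precomp_ob P Y) c = At Y (FOb P c)"
  and Act_precomp [simp]: "Act (precomp_ob P Y) f = Act Y (FAr P f)"
  by (auto simp: precomp_ob_def)

lemma At_ran: "At (ran_ob C D P F) d = NatTrans C (precomp_ob P (yoneda D d)) F"
  by (auto simp: ran_ob_def)

lemma Act_ran: "c \<in> Obj C \<Longrightarrow> h \<in> At (yoneda D (Dom D g)) (FOb P c) \<Longrightarrow>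
    Act (ran_ob C D P F) g \<psi> c h = \<psi> c (Comp D g h)"
  by (auto simp: ran_ob_def)

lemma Act_ran_NatTrans:
  assumes C: "category C" and D: "category D" and P: "is_functor C D P"
    and g: "g \<in> Arr D" and \<psi>: "\<psi> \<in> At (ran_ob C D P F) (Cod D g)"
  shows "Act (ran_ob C D P F) g \<psi> \<in> At (ran_ob C D P F) (Dom D g)"
  unfolding At_ran
proof (rule NatTransI)
  fix c assume "c \<in> Obj C"
  then show "Act (ran_ob C D P F) g \<psi> c \<in> At (precomp_ob P (yoneda D (Dom D g))) c \<rightarrow>\<^sub>E At F c"
    using assms NatTrans_mem[OF \<psi>[unfolded At_ran], of c]
    by (auto simp: ran_ob_def category_simps functor_simps)
next
  fix f x assume "f \<in> Arr C" "x \<in> At (precomp_ob P (yoneda D (Dom D g))) (Cod C f)"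
  then show "Act (ran_ob C D P F) g \<psi> (Dom C f) (Act (precomp_ob P (yoneda D (Dom D g))) f x) =
    Act F f (Act (ran_ob C D P F) g \<psi> (Cod C f) x)"
    using C D P g NatTrans_natural[OF \<psi>[unfolded At_ran], of f "Comp D g x"]
    by (simp add: Act_ran category_simps functor_simps)
qed (simp add: ran_ob_def)

lemma ran_presheaf:
  assumes C: "category C" and D: "category D" and P: "is_functor C D P"
  shows "presheaf D (ran_ob C D P F)"
  unfolding presheaf_def
proof (intro conjI ballI impI)
  fix d \<psi> assume d: "d \<in> Obj D" and \<psi>: "\<psi> \<in> At (ran_ob C D P F) d"
  have "Act (ran_ob C D P F) (Ide D d) \<psi> \<in> At (ran_ob C D P F) d"
    using Act_ran_NatTrans[OF assms, of "Ide D d" \<psi> F] d \<psi> by (simp add: D category_simps)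
  from this[unfolded At_ran] \<psi>[unfolded At_ran] show "Act (ran_ob C D P F) (Ide D d) \<psi> = \<psi>"
    by (rule NatTrans_eqI)
       (use assms d in \<open>auto simp: Act_ran category_simps\<close>)
next
  fix g f \<psi> assume g: "g \<in> Arr D" and f: "f \<in> Arr D" and gf: "Dom D g = Cod D f"
    and \<psi>: "\<psi> \<in> At (ran_ob C D P F) (Cod D g)"
  have 1: "Act (ran_ob C D P F) (Comp D g f) \<psi> \<in> At (ran_ob C D P F) (Dom D f)"
    using Act_ran_NatTrans[OF assms, of "Comp D g f" \<psi> F] g f gf \<psi> by (simp add: D category_simps)
  have 2: "Act (ran_ob C D P F) f (Act (ran_ob C D P F) g \<psi>) \<in> At (ran_ob C D P F) (Dom D f)"
    using Act_ran_NatTrans[OF assms, of g \<psi> F] Act_ran_NatTrans[OF assms, of f _ F] g f gf \<psi>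
    by (simp add: D category_simps)
  show "Act (ran_ob C D P F) (Comp D g f) \<psi> = Act (ran_ob C D P F) f (Act (ran_ob C D P F) g \<psi>)"
    by (rule NatTrans_eqI[OF 1[unfolded At_ran] 2[unfolded At_ran]])
       (use assms g f gf in \<open>auto simp: Act_ran category_simps\<close>)
qed (rule funcsetI, rule Act_ran_NatTrans[OF assms])

lemma ran_nat_NatTrans:
  assumes C: "category C" and D: "category D" and P: "is_functor C D P"
    and F: "presheaf C F" and \<phi>: "\<phi> \<in> NatTrans C F G"
  shows "ran_nat C D P F \<phi> \<in> NatTrans D (ran_ob C D P F) (ran_ob C D P G)"
proof -
  have pre: "presheaf C (precomp_ob P (yoneda D d))" for d
    by (intro precomp_presheaf[OF C P] yoneda_presheaf D)
  have mem: "ncomp C (precomp_ob P (yoneda D d)) \<phi> \<psi> \<in> At (ran_ob C D P G) d"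
    if "\<psi> \<in> At (ran_ob C D P F) d" for d \<psi>
    using that unfolding At_ran by (rule ncomp_NatTrans[OF C pre _ \<phi>])
  show ?thesis
  proof (rule NatTransI)
    fix g \<psi> assume g: "g \<in> Arr D" and \<psi>: "\<psi> \<in> At (ran_ob C D P F) (Cod D g)"
    let ?l = "ncomp C (precomp_ob P (yoneda D (Dom D g))) \<phi> (Act (ran_ob C D P F) g \<psi>)"
    let ?r = "Act (ran_ob C D P G) g (ncomp C (precomp_ob P (yoneda D (Cod D g))) \<phi> \<psi>)"
    have "?l = ?r"
      by (rule NatTrans_eqI[OF mem[OF Act_ran_NatTrans[OF C D P g \<psi>], unfolded At_ran]
             Act_ran_NatTrans[OF C D P g mem[OF \<psi>], unfolded At_ran]])
         (use C D P g in \<open>auto simp: ncomp_def Act_ran category_simps\<close>)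
    then show "ran_nat C D P F \<phi> (Dom D g) (Act (ran_ob C D P F) g \<psi>) =
       Act (ran_ob C D P G) g (ran_nat C D P F \<phi> (Cod D g) \<psi>)"
      using g \<psi> Act_ran_NatTrans[OF C D P g \<psi>] by (simp add: ran_nat_def D category_simps)
  qed (auto simp: ran_nat_def mem)
qed

definition ran_transpose :: "('c, 'm) cat \<Rightarrow> ('d, 'n) cat \<Rightarrow> ('c, 'm, 'd, 'n) fctr \<Rightarrow> ('d, 'n, 'y) psh
    \<Rightarrow> ('c \<Rightarrow> 'y \<Rightarrow> 'x) \<Rightarrow> 'd \<Rightarrow> 'y \<Rightarrow> 'c \<Rightarrow> 'n \<Rightarrow> 'x" where
  "ran_transpose C D P Y \<theta> = (\<lambda>d\<in>Obj D. \<lambda>y\<in>At Y d. \<lambda>c\<in>Obj C. \<lambda>h\<in>At (yoneda D d) (FOb P c).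
     \<theta> c (Act Y h y))"

lemma ran_transpose_apply: "d \<in> Obj D \<Longrightarrow> y \<in> At Y d \<Longrightarrow> c \<in> Obj C \<Longrightarrow> h \<in> At (yoneda D d) (FOb P c) \<Longrightarrow>
   ran_transpose C D P Y \<theta> d y c h = \<theta> c (Act Y h y)"
  by (simp add: ran_transpose_def)

lemma ran_transpose_mem:
  assumes C: "category C" and D: "category D" and P: "is_functor C D P"
    and Y: "presheaf D Y" and \<theta>: "\<theta> \<in> NatTrans C (precomp_ob P Y) F"
    and d: "d \<in> Obj D" and y: "y \<in> At Y d"
  shows "ran_transpose C D P Y \<theta> d y \<in> At (ran_ob C D P F) d"
  unfolding At_ran
proof (rule NatTransI)
  fix c assume "c \<in> Obj C"
  then show "ran_transpose C D P Y \<theta> d y c \<in> At (precomp_ob P (yoneda D d)) c \<rightarrow>\<^sub>E At F c"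
    using d y Y P NatTrans_mem[OF \<theta>, of c] presheaf_simps(1)[OF Y, of _ y]
    by (fastforce simp: ran_transpose_def functor_simps)
next
  fix f h assume "f \<in> Arr C" "h \<in> At (precomp_ob P (yoneda D d)) (Cod C f)"
  then show "ran_transpose C D P Y \<theta> d y (Dom C f) (Act (precomp_ob P (yoneda D d)) f h) =
        Act F f (ran_transpose C D P Y \<theta> d y (Cod C f) h)"
    using C D P d y Y NatTrans_natural[OF \<theta>, of f "Act Y h y"] presheaf_simps(1)[OF Y, of h y]
    by (simp add: ran_transpose_apply functor_simps category_simps presheaf_simps)
qed (use d y in \<open>simp add: ran_transpose_def\<close>)

lemma ran_transpose_NatTrans:
  assumes C: "category C" and D: "category D" and P: "is_functor C D P"
    and Y: "presheaf D Y" and \<theta>: "\<theta> \<in> NatTrans C (precomp_ob P Y) F"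
  shows "ran_transpose C D P Y \<theta> \<in> NatTrans D Y (ran_ob C D P F)"
proof (rule NatTransI)
  fix d assume "d \<in> Obj D"
  then show "ran_transpose C D P Y \<theta> d \<in> At Y d \<rightarrow>\<^sub>E At (ran_ob C D P F) d"
    using ran_transpose_mem[OF assms] by (auto simp: ran_transpose_def)
next
  fix g y assume g: "g \<in> Arr D" and y: "y \<in> At Y (Cod D g)"
  then have *: "Cod D g \<in> Obj D" "Dom D g \<in> Obj D" "Act Y g y \<in> At Y (Dom D g)"
    using D Y by (simp_all add: category_simps presheaf_simps)
  show "ran_transpose C D P Y \<theta> (Dom D g) (Act Y g y) =
        Act (ran_ob C D P F) g (ran_transpose C D P Y \<theta> (Cod D g) y)"
    by (rule NatTrans_eqI[OF ran_transpose_mem[OF assms *(2,3), unfolded At_ran]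
          Act_ran_NatTrans[OF C D P g ran_transpose_mem[OF assms *(1) y], unfolded At_ran]])
       (use g y * D P Y in \<open>simp add: ran_transpose_apply Act_ran category_simps functor_simps presheaf_simps\<close>)
qed (simp add: ran_transpose_def)

text \<open>Right adjointness of \<open>ran_ob C D P\<close>: a bijection between the sets of natural transformations,
  natural in \<open>Y\<close> and \<open>F\<close>. The element types of \<open>Y\<close> and \<open>F\<close> are arbitrary.\<close>

theorem precomp_ran_adjunction:
  assumes C: "category C" and D: "category D" and P: "is_functor C D P"
  shows "presheaf D Y \<Longrightarrow> presheaf C F \<Longrightarrow>
      bij_betw (ran_transpose C D P Y) (NatTrans C (precomp_ob P Y) F) (NatTrans D Y (ran_ob C D P F))"
    and "presheaf D Y \<Longrightarrow> presheaf D Y' \<Longrightarrow> presheaf C F \<Longrightarrow> presheaf C F' \<Longrightarrow>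
      \<kappa> \<in> NatTrans D Y' Y \<Longrightarrow> \<phi> \<in> NatTrans C F F' \<Longrightarrow> \<theta> \<in> NatTrans C (precomp_ob P Y) F \<Longrightarrow>
      ran_transpose C D P Y' (ncomp C (precomp_ob P Y') \<phi> (ncomp C (precomp_ob P Y') \<theta> (precomp_nat C P \<kappa>))) =
      ncomp D Y' (ran_nat C D P F \<phi>) (ncomp D Y' (ran_transpose C D P Y \<theta>) \<kappa>)"
proof -
  assume Y: "presheaf D Y" and F: "presheaf C F"
  let ?inv = "\<lambda>\<psi>. \<lambda>c\<in>Obj C. \<lambda>y\<in>At Y (FOb P c). \<psi> (FOb P c) y c (Ide D (FOb P c))"
  have inv: "?inv \<psi> \<in> NatTrans C (precomp_ob P Y) F" if \<psi>: "\<psi> \<in> NatTrans D Y (ran_ob C D P F)" for \<psi>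
  proof (rule NatTransI)
    fix c assume c: "c \<in> Obj C"
    have "\<psi> (FOb P c) y c (Ide D (FOb P c)) \<in> At F c" if "y \<in> At Y (FOb P c)" for y
      by (rule NatTrans_mem[OF NatTrans_mem[OF \<psi> _ that, unfolded At_ran] c])
         (use D P c in \<open>simp_all add: functor_simps category_simps\<close>)
    then show "?inv \<psi> c \<in> At (precomp_ob P Y) c \<rightarrow>\<^sub>E At F c"
      using c by auto
  next
    fix f y assume f: "f \<in> Arr C" and "y \<in> At (precomp_ob P Y) (Cod C f)"
    then have y: "y \<in> At Y (FOb P (Cod C f))" by simp
    have obs: "FOb P (Cod C f) \<in> Obj D" "FOb P (Dom C f) \<in> Obj D"
      using C P f by (simp_all add: functor_simps category_simps)
    have "\<psi> (FOb P (Dom C f)) (Act Y (FAr P f) y) (Dom C f) (Ide D (FOb P (Dom C f))) =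
          Act (ran_ob C D P F) (FAr P f) (\<psi> (FOb P (Cod C f)) y) (Dom C f) (Ide D (FOb P (Dom C f)))"
      using NatTrans_natural[OF \<psi>, of "FAr P f" y] f y P by (simp add: functor_simps)
    also have "\<dots> = \<psi> (FOb P (Cod C f)) y (Dom C f) (FAr P f)"
      using C D P f obs category_simps(9)[OF D, of "FAr P f"]
      by (subst Act_ran) (simp_all add: category_simps functor_simps)
    also have "\<dots> = Act F f (\<psi> (FOb P (Cod C f)) y (Cod C f) (Ide D (FOb P (Cod C f))))"
      using NatTrans_natural[OF NatTrans_mem[OF \<psi> obs(1) y, unfolded At_ran] f, of "Ide D (FOb P (Cod C f))"]
        C D P f obs category_simps(10)[OF D, of "FAr P f"]
      by (simp add: category_simps functor_simps)
    finally show "?inv \<psi> (Dom C f) (Act (precomp_ob P Y) f y) = Act F f (?inv \<psi> (Cod C f) y)"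
      using C P f y presheaf_simps(1)[OF Y, of "FAr P f" y] by (simp add: category_simps functor_simps)
  qed simp
  show "bij_betw (ran_transpose C D P Y) (NatTrans C (precomp_ob P Y) F) (NatTrans D Y (ran_ob C D P F))"
  proof (rule bij_betw_byWitness[where f' = ?inv])
    show "\<forall>\<theta>\<in>NatTrans C (precomp_ob P Y) F. ?inv (ran_transpose C D P Y \<theta>) = \<theta>"
    proof
      fix \<theta> assume \<theta>: "\<theta> \<in> NatTrans C (precomp_ob P Y) F"
      show "?inv (ran_transpose C D P Y \<theta>) = \<theta>"
        by (rule NatTrans_eqI[OF inv[OF ran_transpose_NatTrans[OF assms Y \<theta>]] \<theta>])
           (use D P Y in \<open>simp add: ran_transpose_apply functor_simps category_simps presheaf_simps\<close>)
    qed
    show "\<forall>\<psi>\<in>NatTrans D Y (ran_ob C D P F). ran_transpose C D P Y (?inv \<psi>) = \<psi>"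
    proof
      fix \<psi> assume \<psi>: "\<psi> \<in> NatTrans D Y (ran_ob C D P F)"
      show "ran_transpose C D P Y (?inv \<psi>) = \<psi>"
      proof (rule NatTrans_eqI[OF ran_transpose_NatTrans[OF assms Y inv[OF \<psi>]] \<psi>])
        fix d y assume d: "d \<in> Obj D" and y: "y \<in> At Y d"
        show "ran_transpose C D P Y (?inv \<psi>) d y = \<psi> d y"
        proof (rule NatTrans_eqI[OF ran_transpose_mem[OF assms Y inv[OF \<psi>] d y, unfolded At_ran]
                NatTrans_mem[OF \<psi> d y, unfolded At_ran]])
          fix c h assume c: "c \<in> Obj C" and "h \<in> At (precomp_ob P (yoneda D d)) c"
          then have h: "h \<in> Arr D" "Dom D h = FOb P c" "Cod D h = d" by simp_all
          then show "ran_transpose C D P Y (?inv \<psi>) d y c h = \<psi> d y c h"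
            using D P Y c d y NatTrans_natural[OF \<psi>, of h y] category_simps(9)[OF D, of h] presheaf_simps(1)[OF Y, of h y]
            by (simp add: ran_transpose_apply Act_ran functor_simps category_simps)
        qed
      qed
    qed
  qed (rule image_subsetI, erule ran_transpose_NatTrans[OF assms Y], rule image_subsetI, erule inv)
next
  assume Y: "presheaf D Y" and Y': "presheaf D Y'" and F: "presheaf C F" and F': "presheaf C F'"
    and \<kappa>: "\<kappa> \<in> NatTrans D Y' Y" and \<phi>: "\<phi> \<in> NatTrans C F F'" and \<theta>: "\<theta> \<in> NatTrans C (precomp_ob P Y) F"
  let ?l = "ncomp C (precomp_ob P Y') \<phi> (ncomp C (precomp_ob P Y') \<theta> (precomp_nat C P \<kappa>))"
  have l: "?l \<in> NatTrans C (precomp_ob P Y') F'"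
    by (rule ncomp_NatTrans[OF C precomp_presheaf[OF C P Y'] ncomp_NatTrans[OF C precomp_presheaf[OF C P Y']
          precomp_nat_NatTrans[OF C P \<kappa>] \<theta>] \<phi>])
  have r: "ncomp D Y' (ran_nat C D P F \<phi>) (ncomp D Y' (ran_transpose C D P Y \<theta>) \<kappa>) \<in> NatTrans D Y' (ran_ob C D P F')"
    by (rule ncomp_NatTrans[OF D Y' ncomp_NatTrans[OF D Y' \<kappa> ran_transpose_NatTrans[OF assms Y \<theta>]] ran_nat_NatTrans[OF assms F \<phi>]])
  show "ran_transpose C D P Y' ?l = ncomp D Y' (ran_nat C D P F \<phi>) (ncomp D Y' (ran_transpose C D P Y \<theta>) \<kappa>)"
  proof (rule NatTrans_eqI[OF ran_transpose_NatTrans[OF assms Y' l] r])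
    fix d y assume d: "d \<in> Obj D" and y: "y \<in> At Y' d"
    note [simp] = ran_transpose_mem[OF assms Y \<theta> d NatTrans_mem[OF \<kappa> d y]] NatTrans_mem[OF \<kappa> d y]
    show "ran_transpose C D P Y' ?l d y = ncomp D Y' (ran_nat C D P F \<phi>) (ncomp D Y' (ran_transpose C D P Y \<theta>) \<kappa>) d y"
    proof (rule NatTrans_eqI[OF ran_transpose_mem[OF assms Y' l d y, unfolded At_ran] NatTrans_mem[OF r d y, unfolded At_ran]])
      fix c h assume c: "c \<in> Obj C" and "h \<in> At (precomp_ob P (yoneda D d)) c"
      then have h: "h \<in> Arr D" "Dom D h = FOb P c" "Cod D h = d" by simp_all
      then show "ran_transpose C D P Y' ?l d y c h = ncomp D Y' (ran_nat C D P F \<phi>) (ncomp D Y' (ran_transpose C D P Y \<theta>) \<kappa>) d y c h"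
        using C D P c d y presheaf_simps(1)[OF Y', of h y] NatTrans_natural[OF \<kappa>, of h y]
        by (simp add: ran_transpose_apply ncomp_def precomp_nat_def ran_nat_def functor_simps)
    qed
  qed
qed



section \<open>Unital 2-Segal sets\<close>

text \<open>The arrow \<open>(m, \<alpha>, n)\<close> is the monotone map \<open>\<alpha> : {0..m} \<rightarrow> {0..n}\<close>.\<close>

type_synonym dmap = "nat \<times> (nat \<Rightarrow> nat) \<times> nat"

definition Delta :: "(nat, dmap) cat" where
  "Delta = \<lparr>Obj = UNIV,
     Arr = {(m, \<alpha>, n). \<alpha> \<in> {..m} \<rightarrow>\<^sub>E {..n} \<and> mono_on {..m} \<alpha>},
     Dom = (\<lambda>(m, \<alpha>, n). m),
     Cod = (\<lambda>(m, \<alpha>, n). n),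
     Ide = (\<lambda>n. (n, \<lambda>i\<in>{..n}. i, n)),
     Comp = (\<lambda>(_, \<beta>, k) (m, \<alpha>, _). (m, compose {..m} \<beta> \<alpha>, k))\<rparr>"

type_synonym 'a sset = "(nat, dmap, 'a) psh"
type_synonym 'a smap = "'a sset \<times> (nat \<Rightarrow> 'a \<Rightarrow> 'a) \<times> 'a sset"

text \<open>\<open>face X n i\<close> is \<open>d\<^sub>i : X\<^sub>n \<rightarrow> X\<^sub>n\<^sub>-\<^sub>1\<close> (for \<open>n \<ge> 1\<close>) and \<open>degen X n i\<close> is
  \<open>s\<^sub>i : X\<^sub>n \<rightarrow> X\<^sub>n\<^sub>+\<^sub>1\<close>.\<close>

definition face :: "'a sset \<Rightarrow> nat \<Rightarrow> nat \<Rightarrow> 'a \<Rightarrow> 'a" where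
  "face X n i = Act X (n - 1, \<lambda>j\<in>{..n - 1}. if j < i then j else j + 1, n)"

definition degen :: "'a sset \<Rightarrow> nat \<Rightarrow> nat \<Rightarrow> 'a \<Rightarrow> 'a" where
  "degen X n i = Act X (n + 1, \<lambda>j\<in>{..n + 1}. if j \<le> i then j else j - 1, n)"

definition vertex :: "'a sset \<Rightarrow> nat \<Rightarrow> nat \<Rightarrow> 'a \<Rightarrow> 'a" where
  "vertex X n i = Act X (0, \<lambda>j\<in>{..0}. i, n)"

definition edge :: "'a sset \<Rightarrow> nat \<Rightarrow> nat \<Rightarrow> 'a \<Rightarrow> 'a" where
  "edge X n i = Act X (1, \<lambda>j\<in>{..1}. i + j, n)"

text \<open>Triangulations of the convex \<open>(n+1)\<close>-gon with vertices \<open>0, ..., n\<close> in cyclic order: a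
  triangulation is given by the set \<open>E\<close> of all line segments occurring in it (the sides of the
  polygon included), a maximal set of pairwise non-crossing chords. Its triangles are the triples
  of vertices that are pairwise joined by elements of \<open>E\<close>.\<close>

definition chords :: "nat \<Rightarrow> (nat \<times> nat) set" where
  "chords n = {(a, b). a < b \<and> b \<le> n}"

definition crossing :: "nat \<times> nat \<Rightarrow> nat \<times> nat \<Rightarrow> bool" where
  "crossing = (\<lambda>(a, b) (c, d). (a < c \<and> c < b \<and> b < d) \<or> (c < a \<and> a < d \<and> d < b))"

definition triangulation :: "nat \<Rightarrow> (nat \<times> nat) set \<Rightarrow> bool" where
  "triangulation n E \<longleftrightarrow> E \<subseteq> chords n \<and> (\<forall>e\<in>E. \<forall>e'\<in>E. \<not> crossing e e') \<and>
     (\<forall>e\<in>chords n - E. \<exists>e'\<in>E. crossing e e')"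

definition triangles :: "(nat \<times> nat) set \<Rightarrow> nat set set" where
  "triangles E = {{a, b, c} |a b c. (a, b) \<in> E \<and> (b, c) \<in> E \<and> (a, c) \<in> E}"

definition DeltaT :: "nat \<Rightarrow> (nat \<times> nat) set \<Rightarrow> dmap sset" where
  "DeltaT n E = (yoneda Delta n)
     \<lparr>At := (\<lambda>k. {f \<in> At (yoneda Delta n) k. \<exists>t\<in>triangles E. under f ` {..k} \<subseteq> t})\<rparr>"

text \<open>The restriction map \<open>X\<^sub>n \<cong> Hom(\<Delta>[n], X) \<rightarrow> Hom(\<Delta>[T], X)\<close>.\<close>

definition segal_map :: "nat \<Rightarrow> (nat \<times> nat) set \<Rightarrow> 'a sset \<Rightarrow> 'a \<Rightarrow> nat \<Rightarrow> dmap \<Rightarrow> 'a" where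
  "segal_map n E X x = (\<lambda>k\<in>Obj Delta. \<lambda>f\<in>At (DeltaT n E) k. Act X f x)"

definition two_segal :: "'a sset \<Rightarrow> bool" where
  "two_segal X \<longleftrightarrow> (\<forall>n\<ge>3. \<forall>E. triangulation n E \<longrightarrow>
     bij_betw (segal_map n E X) (At X n) (NatTrans Delta (DeltaT n E) X))"

definition unital :: "'a sset \<Rightarrow> bool" where
  "unital X \<longleftrightarrow> (\<forall>n\<ge>2. \<forall>i\<le>n - 1.
     bij_betw (\<lambda>x. (degen X (n - 1) i x, vertex X (n - 1) i x)) (At X (n - 1))
       {(y, v). y \<in> At X n \<and> v \<in> At X 0 \<and> edge X n i y = degen X 0 0 v})"

definition U2Seg :: "('a sset, 'a smap) cat" where
  "U2Seg = full_subcat (PSh Delta) {X. two_segal X \<and> unital X}"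

definition J :: "('a sset, 'a smap, 'a sset, 'a smap) fctr" where
  "J = \<lparr>FOb = (\<lambda>X. X), FAr = (\<lambda>f. f)\<rparr>"


section \<open>Augmented stable double categories\<close>

text \<open>The fields with prefix \<open>sq\<close> concern squares: \<open>sq_hsrc\<close>, \<open>sq_htgt\<close> are \<open>s\<^sub>h, t\<^sub>h : Sq \<rightarrow> Ver\<close>,
  and \<open>sq_hid\<close>, \<open>sq_hcomp\<close> are the identities and the composition of the horizontal category with
  objects \<open>Ver\<close> and arrows \<open>Sq\<close>; dually for \<open>sq_vsrc\<close> etc. Compositions take the second arrow
  first: \<open>hcomp D g f\<close> is \<open>g\<close> after \<open>f\<close>.\<close>

record ('o, 'h, 'v, 's) dcat =
  Ob :: "'o set"
  Hor :: "'h set"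
  Ver :: "'v set"
  Sq :: "'s set"
  hsrc :: "'h \<Rightarrow> 'o"
  htgt :: "'h \<Rightarrow> 'o"
  vsrc :: "'v \<Rightarrow> 'o"
  vtgt :: "'v \<Rightarrow> 'o"
  sq_hsrc :: "'s \<Rightarrow> 'v"
  sq_htgt :: "'s \<Rightarrow> 'v"
  sq_vsrc :: "'s \<Rightarrow> 'h"
  sq_vtgt :: "'s \<Rightarrow> 'h"
  hid :: "'o \<Rightarrow> 'h"
  vid :: "'o \<Rightarrow> 'v"
  sq_hid :: "'v \<Rightarrow> 's"
  sq_vid :: "'h \<Rightarrow> 's"
  hcomp :: "'h \<Rightarrow> 'h \<Rightarrow> 'h"
  vcomp :: "'v \<Rightarrow> 'v \<Rightarrow> 'v"
  sq_hcomp :: "'s \<Rightarrow> 's \<Rightarrow> 's"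
  sq_vcomp :: "'s \<Rightarrow> 's \<Rightarrow> 's"
  Aug :: "'o set"

definition hcat :: "('o, 'h, 'v, 's) dcat \<Rightarrow> ('o, 'h) cat" where
  "hcat D = \<lparr>Obj = Ob D, Arr = Hor D, Dom = hsrc D, Cod = htgt D, Ide = hid D, Comp = hcomp D\<rparr>"

definition vcat :: "('o, 'h, 'v, 's) dcat \<Rightarrow> ('o, 'v) cat" where
  "vcat D = \<lparr>Obj = Ob D, Arr = Ver D, Dom = vsrc D, Cod = vtgt D, Ide = vid D, Comp = vcomp D\<rparr>"

definition sq_hcat :: "('o, 'h, 'v, 's) dcat \<Rightarrow> ('v, 's) cat" where
  "sq_hcat D = \<lparr>Obj = Ver D, Arr = Sq D, Dom = sq_hsrc D, Cod = sq_htgt D,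
     Ide = sq_hid D, Comp = sq_hcomp D\<rparr>"

definition sq_vcat :: "('o, 'h, 'v, 's) dcat \<Rightarrow> ('h, 's) cat" where
  "sq_vcat D = \<lparr>Obj = Hor D, Arr = Sq D, Dom = sq_vsrc D, Cod = sq_vtgt D,
     Ide = sq_vid D, Comp = sq_vcomp D\<rparr>"

text \<open>The fibre product \<open>D\<^sub>1 \<times>\<^bsub>D\<^sub>0\<^esub> D\<^sub>1\<close> for \<open>D\<^sub>1 = sq_vcat D\<close> and \<open>D\<^sub>0 = vcat D\<close>, on which the
  composition of the internal category \<open>D\<close> is defined.\<close>

definition pairs_cat :: "('o, 'h, 'v, 's) dcat \<Rightarrow> ('h \<times> 'h, 's \<times> 's) cat" where
  "pairs_cat D = \<lparr>Obj = {(g, f). g \<in> Hor D \<and> f \<in> Hor D \<and> hsrc D g = htgt D f},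
     Arr = {(b, a). b \<in> Sq D \<and> a \<in> Sq D \<and> sq_hsrc D b = sq_htgt D a},
     Dom = map_prod (sq_vsrc D) (sq_vsrc D),
     Cod = map_prod (sq_vtgt D) (sq_vtgt D),
     Ide = map_prod (sq_vid D) (sq_vid D),
     Comp = (\<lambda>(b', a') (b, a). (sq_vcomp D b' b, sq_vcomp D a' a))\<rparr>"

text \<open>A category object \<open>D\<^sub>1 \<rightrightarrows> D\<^sub>0\<close> in categories: source, target, identity and composition are
  functors, and the unit and associativity laws of the internal category hold on objects
  (\<open>hcat D\<close>) and on arrows (\<open>sq_hcat D\<close>).\<close>

definition double_category :: "('o, 'h, 'v, 's) dcat \<Rightarrow> bool" where
  "double_category D \<longleftrightarrow>
     category (vcat D) \<and> category (sq_vcat D) \<and> category (hcat D) \<and> category (sq_hcat D) \<and>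
     is_functor (sq_vcat D) (vcat D) \<lparr>FOb = hsrc D, FAr = sq_hsrc D\<rparr> \<and>
     is_functor (sq_vcat D) (vcat D) \<lparr>FOb = htgt D, FAr = sq_htgt D\<rparr> \<and>
     is_functor (vcat D) (sq_vcat D) \<lparr>FOb = hid D, FAr = sq_hid D\<rparr> \<and>
     is_functor (pairs_cat D) (sq_vcat D)
       \<lparr>FOb = (\<lambda>(g, f). hcomp D g f), FAr = (\<lambda>(b, a). sq_hcomp D b a)\<rparr>"

definition stable :: "('o, 'h, 'v, 's) dcat \<Rightarrow> bool" where
  "stable D \<longleftrightarrow>
     bij_betw (\<lambda>a. (sq_vsrc D a, sq_hsrc D a)) (Sq D)
       {(f, g). f \<in> Hor D \<and> g \<in> Ver D \<and> hsrc D f = vsrc D g} \<and>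
     bij_betw (\<lambda>a. (sq_htgt D a, sq_vtgt D a)) (Sq D)
       {(g, f). g \<in> Ver D \<and> f \<in> Hor D \<and> vtgt D g = htgt D f}"

definition augmented :: "('o, 'h, 'v, 's) dcat \<Rightarrow> bool" where
  "augmented D \<longleftrightarrow> Aug D \<subseteq> Ob D \<and>
     bij_betw (htgt D) {f \<in> Hor D. hsrc D f \<in> Aug D} (Ob D) \<and>
     bij_betw (vsrc D) {g \<in> Ver D. vtgt D g \<in> Aug D} (Ob D)"

definition aug_stable_dcat :: "('o, 'h, 'v, 's) dcat \<Rightarrow> bool" where
  "aug_stable_dcat D \<longleftrightarrow> double_category D \<and> stable D \<and> augmented D"

record ('o, 'h, 'v, 's, 'p, 'i, 'w, 't) dfun =
  DOb :: "'o \<Rightarrow> 'p"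
  DHor :: "'h \<Rightarrow> 'i"
  DVer :: "'v \<Rightarrow> 'w"
  DSq :: "'s \<Rightarrow> 't"

text \<open>Double functors preserving the augmentation sets, extensional on the carriers.\<close>

definition DHom :: "('o, 'h, 'v, 's) dcat \<Rightarrow> ('p, 'i, 'w, 't) dcat
    \<Rightarrow> ('o, 'h, 'v, 's, 'p, 'i, 'w, 't) dfun set" where
  "DHom D E = {F.
     DOb F \<in> extensional (Ob D) \<and> DHor F \<in> extensional (Hor D) \<and>
     DVer F \<in> extensional (Ver D) \<and> DSq F \<in> extensional (Sq D) \<and>
     is_functor (hcat D) (hcat E) \<lparr>FOb = DOb F, FAr = DHor F\<rparr> \<and>
     is_functor (vcat D) (vcat E) \<lparr>FOb = DOb F, FAr = DVer F\<rparr> \<and>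
     is_functor (sq_hcat D) (sq_hcat E) \<lparr>FOb = DVer F, FAr = DSq F\<rparr> \<and>
     is_functor (sq_vcat D) (sq_vcat E) \<lparr>FOb = DHor F, FAr = DSq F\<rparr> \<and>
     DOb F \<in> Aug D \<rightarrow> Aug E}"

definition did :: "('o, 'h, 'v, 's) dcat \<Rightarrow> ('o, 'h, 'v, 's, 'o, 'h, 'v, 's) dfun" where
  "did D = \<lparr>DOb = (\<lambda>x\<in>Ob D. x), DHor = (\<lambda>x\<in>Hor D. x), DVer = (\<lambda>x\<in>Ver D. x), DSq = (\<lambda>x\<in>Sq D. x)\<rparr>"

definition dcomp :: "('o, 'h, 'v, 's) dcat \<Rightarrow> ('p, 'i, 'w, 't, 'q, 'j, 'x, 'u) dfun
    \<Rightarrow> ('o, 'h, 'v, 's, 'p, 'i, 'w, 't) dfun \<Rightarrow> ('o, 'h, 'v, 's, 'q, 'j, 'x, 'u) dfun" where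
  "dcomp D G F =
     \<lparr>DOb = compose (Ob D) (DOb G) (DOb F), DHor = compose (Hor D) (DHor G) (DHor F),
      DVer = compose (Ver D) (DVer G) (DVer F), DSq = compose (Sq D) (DSq G) (DSq F)\<rparr>"

type_synonym ('o, 'h, 'v, 's) dmor =
  "('o, 'h, 'v, 's) dcat \<times> ('o, 'h, 'v, 's, 'o, 'h, 'v, 's) dfun \<times> ('o, 'h, 'v, 's) dcat"

definition DCat :: "(('o, 'h, 'v, 's) dcat, ('o, 'h, 'v, 's) dmor) cat" where
  "DCat = \<lparr>Obj = {D. aug_stable_dcat D},
     Arr = {(D, F, E). aug_stable_dcat D \<and> aug_stable_dcat E \<and> F \<in> DHom D E},
     Dom = (\<lambda>(D, F, E). D),
     Cod = (\<lambda>(D, F, E). E),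
     Ide = (\<lambda>D. (D, did D, D)),
     Comp = (\<lambda>(_, G, E) (D, F, _). (D, dcomp D G F, E))\<rparr>"

definition W :: "nat \<Rightarrow> (nat \<times> nat, nat \<times> nat \<times> nat, nat \<times> nat \<times> nat, nat \<times> nat \<times> nat \<times> nat) dcat" where
  "W n =
     \<lparr>Ob = {(i, j). i \<le> j \<and> j \<le> n},
      Hor = {(i, j, l). i \<le> j \<and> j \<le> l \<and> l \<le> n},
      Ver = {(i, k, j). i \<le> k \<and> k \<le> j \<and> j \<le> n},
      Sq = {(i, k, j, l). i \<le> k \<and> k \<le> j \<and> j \<le> l \<and> l \<le> n},
      hsrc = (\<lambda>(i, j, l). (i, j)), htgt = (\<lambda>(i, j, l). (i, l)),
      vsrc = (\<lambda>(i, k, j). (i, j)), vtgt = (\<lambda>(i, k, j). (k, j)),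
      sq_hsrc = (\<lambda>(i, k, j, l). (i, k, j)), sq_htgt = (\<lambda>(i, k, j, l). (i, k, l)),
      sq_vsrc = (\<lambda>(i, k, j, l). (i, j, l)), sq_vtgt = (\<lambda>(i, k, j, l). (k, j, l)),
      hid = (\<lambda>(i, j). (i, j, j)), vid = (\<lambda>(i, j). (i, i, j)),
      sq_hid = (\<lambda>(i, k, j). (i, k, j, j)), sq_vid = (\<lambda>(i, j, l). (i, i, j, l)),
      hcomp = (\<lambda>(_, _, m) (i, j, _). (i, j, m)),
      vcomp = (\<lambda>(_, m, _) (i, _, j). (i, m, j)),
      sq_hcomp = (\<lambda>(_, _, _, m) (i, k, j, _). (i, k, j, m)),
      sq_vcomp = (\<lambda>(_, m, _, _) (i, _, j, l). (i, m, j, l)),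
      Aug = {(i, j). i = j \<and> j \<le> n}\<rparr>"

definition Wmap :: "dmap \<Rightarrow> (nat \<times> nat, nat \<times> nat \<times> nat, nat \<times> nat \<times> nat, nat \<times> nat \<times> nat \<times> nat,
    nat \<times> nat, nat \<times> nat \<times> nat, nat \<times> nat \<times> nat, nat \<times> nat \<times> nat \<times> nat) dfun" where
  "Wmap = (\<lambda>(m, \<alpha>, n).
     \<lparr>DOb = (\<lambda>(i, j)\<in>Ob (W m). (\<alpha> i, \<alpha> j)),
      DHor = (\<lambda>(i, j, l)\<in>Hor (W m). (\<alpha> i, \<alpha> j, \<alpha> l)),
      DVer = (\<lambda>(i, k, j)\<in>Ver (W m). (\<alpha> i, \<alpha> k, \<alpha> j)),
      DSq = (\<lambda>(i, k, j, l)\<in>Sq (W m). (\<alpha> i, \<alpha> k, \<alpha> j, \<alpha> l))\<rparr>)"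

type_synonym ('o, 'h, 'v, 's) wfun =
  "(nat \<times> nat, nat \<times> nat \<times> nat, nat \<times> nat \<times> nat, nat \<times> nat \<times> nat \<times> nat, 'o, 'h, 'v, 's) dfun"


section \<open>The discrete path and Waldhausen constructions\<close>

text \<open>The element of \<open>X\<^sub>n\<close> with prescribed faces \<open>d\<^sub>i = x\<close>, \<open>d\<^sub>j = y\<close>.\<close>

definition fill :: "'a sset \<Rightarrow> nat \<Rightarrow> nat \<Rightarrow> nat \<Rightarrow> 'a \<Rightarrow> 'a \<Rightarrow> 'a" where
  "fill X n i j x y = the_inv_into (At X n) (\<lambda>z. (face X n i z, face X n j z)) (x, y)"

text \<open>The identity squares and the composites of squares are modelled on \<open>\<W>[n]\<close>: a square in
  \<open>X\<^sub>3\<close> has vertices \<open>(i, k, j, l)\<close>; the composites of \<open>(i, k, j, l)\<close> with \<open>(i, k, l, m)\<close> and of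
  \<open>(i, k, j, l)\<close> with \<open>(k, m, j, l)\<close> are faces of the 4-simplices \<open>(i, k, j, l, m)\<close> and
  \<open>(i, k, m, j, l)\<close>.\<close>

definition path_ob :: "'a sset \<Rightarrow> ('a, 'a, 'a, 'a) dcat" where
  "path_ob X =
     \<lparr>Ob = At X 1, Hor = At X 2, Ver = At X 2, Sq = At X 3,
      hsrc = face X 2 2, htgt = face X 2 1,
      vsrc = face X 2 1, vtgt = face X 2 0,
      sq_hsrc = face X 3 3, sq_htgt = face X 3 2,
      sq_vsrc = face X 3 1, sq_vtgt = face X 3 0,
      hid = degen X 1 1, vid = degen X 1 0,
      sq_hid = degen X 2 2, sq_vid = degen X 2 0,
      hcomp = (\<lambda>g f. face X 3 2 (fill X 3 3 1 f g)),
      vcomp = (\<lambda>g f. face X 3 1 (fill X 3 2 0 f g)),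
      sq_hcomp = (\<lambda>b a. face X 4 3 (fill X 4 4 2 a b)),
      sq_vcomp = (\<lambda>b a. face X 4 1 (fill X 4 2 0 a b)),
      Aug = degen X 0 0 ` At X 0\<rparr>"

definition path_nat :: "(nat \<Rightarrow> 'a \<Rightarrow> 'b) \<Rightarrow> ('a, 'a, 'a, 'a, 'b, 'b, 'b, 'b) dfun" where
  "path_nat \<theta> = \<lparr>DOb = \<theta> 1, DHor = \<theta> 2, DVer = \<theta> 2, DSq = \<theta> 3\<rparr>"

definition path_fctr :: "('a sset, 'a smap, ('a, 'a, 'a, 'a) dcat, ('a, 'a, 'a, 'a) dmor) fctr" ("\<pi>") where
  "\<pi> = \<lparr>FOb = path_ob, FAr = (\<lambda>(X, \<theta>, Y). (path_ob X, path_nat \<theta>, path_ob Y))\<rparr>"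

definition wald_ob :: "('o, 'h, 'v, 's) dcat \<Rightarrow> ('o, 'h, 'v, 's) wfun sset" where
  "wald_ob D = \<lparr>At = (\<lambda>n. DHom (W n) D), Act = (\<lambda>f F. dcomp (W (Dom Delta f)) F (Wmap f))\<rparr>"

definition wald_nat :: "('o, 'h, 'v, 's) dcat \<Rightarrow> ('o, 'h, 'v, 's, 'p, 'i, 'w, 't) dfun
    \<Rightarrow> nat \<Rightarrow> ('o, 'h, 'v, 's) wfun \<Rightarrow> ('p, 'i, 'w, 't) wfun" where
  "wald_nat D G = (\<lambda>n. \<lambda>F\<in>DHom (W n) D. dcomp (W n) G F)"

definition wald_fctr :: "(('o, 'h, 'v, 's) dcat, ('o, 'h, 'v, 's) dmor,
    ('o, 'h, 'v, 's) wfun sset, ('o, 'h, 'v, 's) wfun smap) fctr" ("\<sigma>") where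
  "\<sigma> = \<lparr>FOb = wald_ob, FAr = (\<lambda>(D, G, E). (wald_ob D, wald_nat D G, wald_ob E))\<rparr>"


section \<open>The category Sigma and the augmented double nerve\<close>

datatype sigma_ob = Minus1 | SPair nat nat

text \<open>\<open>STerm s\<close> is the unique arrow from \<open>s\<close> to the terminal object \<open>Minus1\<close>.\<close>

datatype sigma_arr = SProd dmap dmap | STerm sigma_ob

fun sigma_dom :: "sigma_arr \<Rightarrow> sigma_ob" where
  "sigma_dom (SProd a b) = SPair (Dom Delta a) (Dom Delta b)"
| "sigma_dom (STerm s) = s"

fun sigma_cod :: "sigma_arr \<Rightarrow> sigma_ob" where
  "sigma_cod (SProd a b) = SPair (Cod Delta a) (Cod Delta b)"
| "sigma_cod (STerm s) = Minus1"

fun sigma_id :: "sigma_ob \<Rightarrow> sigma_arr" where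
  "sigma_id Minus1 = STerm Minus1"
| "sigma_id (SPair q r) = SProd (Ide Delta q) (Ide Delta r)"

text \<open>There are no composites \<open>SProd a b \<circ> STerm s\<close>; the third equation is a dummy.\<close>

fun sigma_comp :: "sigma_arr \<Rightarrow> sigma_arr \<Rightarrow> sigma_arr" where
  "sigma_comp (STerm t) f = STerm (sigma_dom f)"
| "sigma_comp (SProd a b) (SProd c d) = SProd (Comp Delta a c) (Comp Delta b d)"
| "sigma_comp (SProd a b) (STerm s) = undefined"

definition Sigma_cat :: "(sigma_ob, sigma_arr) cat" where
  "Sigma_cat = \<lparr>Obj = UNIV,
     Arr = {SProd a b |a b. a \<in> Arr Delta \<and> b \<in> Arr Delta} \<union> range STerm,
     Dom = sigma_dom, Cod = sigma_cod, Ide = sigma_id, Comp = sigma_comp\<rparr>"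

fun p_ob :: "sigma_ob \<Rightarrow> nat" where
  "p_ob Minus1 = 0"
| "p_ob (SPair q r) = q + 1 + r"

fun p_arr :: "sigma_arr \<Rightarrow> dmap" where
  "p_arr (SProd (q, \<alpha>, q') (r, \<beta>, r')) =
     (q + 1 + r, \<lambda>i\<in>{..q + 1 + r}. if i \<le> q then \<alpha> i else q' + 1 + \<beta> (i - (q + 1)), q' + 1 + r')"
| "p_arr (STerm s) = (p_ob s, \<lambda>i\<in>{..p_ob s}. 0, 0)"

definition p_fctr :: "(sigma_ob, sigma_arr, nat, dmap) fctr" where
  "p_fctr = \<lparr>FOb = p_ob, FAr = p_arr\<rparr>"

type_synonym 'a sigma_set = "(sigma_ob, sigma_arr, 'a) psh"
type_synonym 'a sigma_map = "'a sigma_set \<times> (sigma_ob \<Rightarrow> 'a \<Rightarrow> 'a) \<times> 'a sigma_set"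

definition p_upper :: "('a sset, 'a smap, 'a sigma_set, 'a sigma_map) fctr" ("p\<^sup>*") where
  "p\<^sup>* = \<lparr>FOb = precomp_ob p_fctr,
     FAr = (\<lambda>(X, \<theta>, Y). (precomp_ob p_fctr X, precomp_nat Sigma_cat p_fctr \<theta>, precomp_ob p_fctr Y))\<rparr>"

definition p_lower :: "('a sigma_set, 'a sigma_map,
    (sigma_ob \<Rightarrow> dmap \<Rightarrow> 'a) sset, (sigma_ob \<Rightarrow> dmap \<Rightarrow> 'a) smap) fctr" ("p\<^sub>*") where
  "p\<^sub>* = \<lparr>FOb = ran_ob Sigma_cat Delta p_fctr,
     FAr = (\<lambda>(F, \<phi>, G). (ran_ob Sigma_cat Delta p_fctr F, ran_nat Sigma_cat Delta p_fctr F \<phi>,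
                         ran_ob Sigma_cat Delta p_fctr G))\<rparr>"

definition nerve_ob :: "('o, 'h, 'v, 's) dcat \<Rightarrow> ('o, 'h, 'v, 's) wfun sigma_set" where
  "nerve_ob D = \<lparr>At = (\<lambda>s. DHom (W (p_ob s)) D),
     Act = (\<lambda>f F. dcomp (W (p_ob (sigma_dom f))) F (Wmap (p_arr f)))\<rparr>"

definition nerve_nat :: "('o, 'h, 'v, 's) dcat \<Rightarrow> ('o, 'h, 'v, 's, 'p, 'i, 'w, 't) dfun
    \<Rightarrow> sigma_ob \<Rightarrow> ('o, 'h, 'v, 's) wfun \<Rightarrow> ('p, 'i, 'w, 't) wfun" where
  "nerve_nat D G = (\<lambda>s. \<lambda>F\<in>DHom (W (p_ob s)) D. dcomp (W (p_ob s)) G F)"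

definition nerve_fctr :: "(('o, 'h, 'v, 's) dcat, ('o, 'h, 'v, 's) dmor,
    ('o, 'h, 'v, 's) wfun sigma_set, ('o, 'h, 'v, 's) wfun sigma_map) fctr" ("N\<^sup>a") where
  "N\<^sup>a = \<lparr>FOb = nerve_ob, FAr = (\<lambda>(D, G, E). (nerve_ob D, nerve_nat D G, nerve_ob E))\<rparr>"


section \<open>The categories and functors are well defined\<close>

lemma category_Delta: "category Delta"
  unfolding category_def Delta_def
  by (auto simp: compose_def PiE_iff extensional_def Pi_iff mono_on_def fun_eq_iff)

lemma category_U2Seg: "category U2Seg"
  unfolding U2Seg_def by (intro category_full_subcat category_PSh category_Delta)

lemma Arr_Sigma_cat [simp]:
  "SProd a b \<in> Arr Sigma_cat \<longleftrightarrow> a \<in> Arr Delta \<and> b \<in> Arr Delta" "STerm s \<in> Arr Sigma_cat"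
  by (auto simp: Sigma_cat_def simp del: split_paired_Ex)

lemma category_Sigma_cat: "category Sigma_cat"
proof -
  note D = category_simps[OF category_Delta]
  have 1: "Ide Delta a \<in> Arr Delta" "Dom Delta (Ide Delta a) = a" "Cod Delta (Ide Delta a) = a" for a
    by (rule D; simp add: Delta_def)+
  have c1: "sigma_id s \<in> Arr Sigma_cat \<and> sigma_dom (sigma_id s) = s \<and> sigma_cod (sigma_id s) = s" for s
    by (cases s) (auto simp: 1)
  have c2: "sigma_comp g f \<in> Arr Sigma_cat \<and> sigma_dom (sigma_comp g f) = sigma_dom f \<and> sigma_cod (sigma_comp g f) = sigma_cod g"
    if "f \<in> Arr Sigma_cat" "g \<in> Arr Sigma_cat" "sigma_dom g = sigma_cod f" for f g
    using that by (cases g; cases f) (auto simp: D)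
  have c3: "sigma_comp f (sigma_id (sigma_dom f)) = f \<and> sigma_comp (sigma_id (sigma_cod f)) f = f" if "f \<in> Arr Sigma_cat" for f
    using that c1 by (cases f) (auto simp: D)
  have c4: "sigma_comp (sigma_comp h g) f = sigma_comp h (sigma_comp g f)"
    if "f \<in> Arr Sigma_cat" "g \<in> Arr Sigma_cat" "h \<in> Arr Sigma_cat" "sigma_dom g = sigma_cod f" "sigma_dom h = sigma_cod g" for f g h
    using that by (cases h; cases g; cases f) (auto simp: D)
  have [simp]: "Obj Sigma_cat = UNIV" "Dom Sigma_cat = sigma_dom" "Cod Sigma_cat = sigma_cod" "Ide Sigma_cat = sigma_id" "Comp Sigma_cat = sigma_comp"
    by (auto simp: Sigma_cat_def)
  show ?thesis
    unfolding category_def using c1 c2 c3 c4 by simp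
qed

lemma p_arr_Arr: "f \<in> Arr Sigma_cat \<Longrightarrow> p_arr f \<in> Arr Delta \<and>
    Dom Delta (p_arr f) = p_ob (sigma_dom f) \<and> Cod Delta (p_arr f) = p_ob (sigma_cod f)"
proof (cases f)
  case (SProd a b)
  obtain q \<alpha> q' r \<beta> r' where ab: "a = (q, \<alpha>, q')" "b = (r, \<beta>, r')" by (metis prod.exhaust)
  assume "f \<in> Arr Sigma_cat"
  then have "\<alpha> \<in> {..q} \<rightarrow>\<^sub>E {..q'}" "\<beta> \<in> {..r} \<rightarrow>\<^sub>E {..r'}" "mono_on {..q} \<alpha>" "mono_on {..r} \<beta>"
    unfolding SProd ab by (auto simp: Delta_def)
  moreover have "\<alpha> i \<le> q'" if "i \<le> q" for i
    using calculation that by (auto simp: PiE_iff)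
  moreover have "\<beta> i \<le> r'" if "i \<le> r" for i
    using calculation that by (auto simp: PiE_iff)
  moreover have "\<alpha> i \<le> Suc (q' + k)" if "i \<le> q" for i k
    using \<open>\<And>i. i \<le> q \<Longrightarrow> \<alpha> i \<le> q'\<close>[OF that] by linarith
  moreover have "\<beta> (i - Suc q) \<le> \<beta> (j - Suc q)" if "i \<le> j" "j \<le> Suc (q + r)" for i j
    using that by (intro mono_onD[OF \<open>mono_on {..r} \<beta>\<close>]) auto
  ultimately show ?thesis
    unfolding SProd ab by (auto simp: Delta_def PiE_iff mono_on_def)
next
  case (STerm s) then show ?thesis by (auto simp: Delta_def mono_on_def)
qed

lemma is_functor_p_fctr: "is_functor Sigma_cat Delta p_fctr"
proof -
  have 1: "p_arr (sigma_id s) = Ide Delta (p_ob s)" for s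
    by (cases s) (auto simp: Delta_def fun_eq_iff)
  have 2: "p_arr (sigma_comp g f) = Comp Delta (p_arr g) (p_arr f)"
    if gf: "f \<in> Arr Sigma_cat" "g \<in> Arr Sigma_cat" "sigma_dom g = sigma_cod f" for f g
  proof (cases g)
    case (STerm t)
    then show ?thesis using that p_arr_Arr[OF that(1)]
      by (cases "p_arr f") (auto simp: Delta_def compose_def fun_eq_iff PiE_iff)
  next
    case g: (SProd a b)
    then obtain c d where f: "f = SProd c d" using gf(3) by (cases f) auto
    obtain q \<alpha> q' r \<beta> r' where ab: "a = (q, \<alpha>, q')" "b = (r, \<beta>, r')" by (metis prod.exhaust)
    obtain k \<gamma> k' l \<delta> l' where cd: "c = (k, \<gamma>, k')" "d = (l, \<delta>, l')" by (metis prod.exhaust)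
    have \<gamma>: "\<gamma> i \<le> q" if "i \<le> k" for i
      using \<open>f \<in> Arr Sigma_cat\<close> \<open>sigma_dom g = sigma_cod f\<close> that unfolding f g ab cd
      by (auto simp: Delta_def PiE_iff)
    have \<delta>: "\<delta> i \<le> r" if "i \<le> l" for i
      using \<open>f \<in> Arr Sigma_cat\<close> \<open>sigma_dom g = sigma_cod f\<close> that unfolding f g ab cd
      by (auto simp: Delta_def PiE_iff)
    have "k' = q" "l' = r"
      using that(3) unfolding f g ab cd by (auto simp: Delta_def)
    then show ?thesis using \<gamma> \<delta> unfolding f g ab cd
      by (auto simp: Delta_def compose_def fun_eq_iff le_SucI trans_le_add1)
  qed
  show ?thesis
    unfolding is_functor_def p_fctr_def using 1 2 p_arr_Arr
    by (auto simp: Sigma_cat_def Delta_def[THEN arg_cong[of _ _ Obj]])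
qed

lemma is_functor_p_upper: "is_functor (PSh Delta) (PSh Sigma_cat) p\<^sup>*"
proof -
  note C = category_Sigma_cat category_Delta
  note P = is_functor_p_fctr
  have 1: "precomp_nat Sigma_cat p_fctr (nid Delta X) = nid Sigma_cat (precomp_ob p_fctr X)" for X :: "'a sset"
    by (auto simp: precomp_nat_def nid_def fun_eq_iff functor_simps[OF P])
  have 2: "precomp_nat Sigma_cat p_fctr (ncomp Delta X \<psi> \<theta>) =
     ncomp Sigma_cat (precomp_ob p_fctr X) (precomp_nat Sigma_cat p_fctr \<psi>) (precomp_nat Sigma_cat p_fctr \<theta>)"
    for X :: "'a sset" and \<psi> \<theta> :: "nat \<Rightarrow> 'a \<Rightarrow> 'a"
    by (auto simp: precomp_nat_def ncomp_def fun_eq_iff functor_simps[OF P])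
  show ?thesis
    unfolding is_functor_def PSh_def p_upper_def
    by (auto simp: 1 2 precomp_presheaf[OF C(1) P] precomp_nat_NatTrans[OF C(1) P])
qed

lemma is_functor_p_lower: "is_functor (PSh Sigma_cat) (PSh Delta) p\<^sub>*"
proof -
  note C = category_Sigma_cat category_Delta
  note P = is_functor_p_fctr
  have pre: "presheaf Sigma_cat (precomp_ob p_fctr (yoneda Delta n))" for n
    by (intro precomp_presheaf[OF C(1) P] yoneda_presheaf C)
  have 1: "ran_nat Sigma_cat Delta p_fctr F (nid Sigma_cat F) = nid Delta (ran_ob Sigma_cat Delta p_fctr F)"
    if F: "presheaf Sigma_cat F" for F :: "'a sigma_set"
  proof (rule NatTrans_eqI[OF ran_nat_NatTrans[OF C P F nid_NatTrans[OF C(1) F]] nid_NatTrans[OF C(2) ran_presheaf[OF C P]]])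
    fix n \<psi> assume "n \<in> Obj Delta" and \<psi>: "\<psi> \<in> At (ran_ob Sigma_cat Delta p_fctr F) n"
    then show "ran_nat Sigma_cat Delta p_fctr F (nid Sigma_cat F) n \<psi> = nid Delta (ran_ob Sigma_cat Delta p_fctr F) n \<psi>"
      using NatTrans_eqI[OF ncomp_NatTrans[OF C(1) pre \<psi>[unfolded At_ran] nid_NatTrans[OF C(1) F]] \<psi>[unfolded At_ran]]
      using NatTrans_mem[OF \<psi>[unfolded At_ran]]
      by (simp add: ran_nat_def nid_def ncomp_def)
  qed
  have 2: "ran_nat Sigma_cat Delta p_fctr F (ncomp Sigma_cat F \<psi> \<theta>) =
     ncomp Delta (ran_ob Sigma_cat Delta p_fctr F) (ran_nat Sigma_cat Delta p_fctr G \<psi>) (ran_nat Sigma_cat Delta p_fctr F \<theta>)"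
    if F: "presheaf Sigma_cat F" and G: "presheaf Sigma_cat G" and \<theta>: "\<theta> \<in> NatTrans Sigma_cat F G"
    for F G :: "'a sigma_set" and \<psi> \<theta> :: "sigma_ob \<Rightarrow> 'a \<Rightarrow> 'a"
  proof (intro ext)
    fix n \<phi> s h
    show "ran_nat Sigma_cat Delta p_fctr F (ncomp Sigma_cat F \<psi> \<theta>) n \<phi> s h =
     ncomp Delta (ran_ob Sigma_cat Delta p_fctr F) (ran_nat Sigma_cat Delta p_fctr G \<psi>) (ran_nat Sigma_cat Delta p_fctr F \<theta>) n \<phi> s h"
      using ncomp_NatTrans[OF C(1) pre _ \<theta>, of \<phi> n] NatTrans_mem[of \<phi> Sigma_cat "precomp_ob p_fctr (yoneda Delta n)" F s h]
      by (auto simp: ran_nat_def ncomp_def At_ran fun_eq_iff)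
  qed
  show ?thesis
    unfolding is_functor_def PSh_def p_lower_def
    by (auto simp: 1 2 ran_presheaf[OF C P] ran_nat_NatTrans[OF C P])
qed

lemma category_DCat: "category DCat"
proof -
  have mem: "DOb F x \<in> Ob E" if "F \<in> DHom D E" "x \<in> Ob D" for F x D E
    using that unfolding DHom_def is_functor_def hcat_def by auto
  have memH: "DHor F x \<in> Hor E" if "F \<in> DHom D E" "x \<in> Hor D" for F x D E
    using that unfolding DHom_def is_functor_def hcat_def by auto
  have memV: "DVer F x \<in> Ver E" if "F \<in> DHom D E" "x \<in> Ver D" for F x D E
    using that unfolding DHom_def is_functor_def vcat_def by auto
  have memS: "DSq F x \<in> Sq E" if "F \<in> DHom D E" "x \<in> Sq D" for F x D E
    using that unfolding DHom_def is_functor_def sq_hcat_def by auto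
  have 1: "is_functor C C \<lparr>FOb = restrict (\<lambda>x. x) (Obj C), FAr = restrict (\<lambda>x. x) (Arr C)\<rparr>" if "category C" for C
    using that unfolding is_functor_def category_def by auto
  have 2: "is_functor C E \<lparr>FOb = compose (Obj C) g f, FAr = compose (Arr C) g' f'\<rparr>"
    if "category C" "is_functor C D \<lparr>FOb = f, FAr = f'\<rparr>" "is_functor D E \<lparr>FOb = g, FAr = g'\<rparr>" for C D E f g f' g'
    using that unfolding is_functor_def category_def by (simp add: compose_def)
  have cats: "category (hcat D)" "category (vcat D)" "category (sq_hcat D)" "category (sq_vcat D)" "Aug D \<subseteq> Ob D"
    if "aug_stable_dcat D" for D
    using that by (auto simp: aug_stable_dcat_def double_category_def augmented_def)
  have 3: "did D \<in> DHom D D" if "aug_stable_dcat D" for D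
    using cats[OF that] 1[OF cats(1)[OF that]] 1[OF cats(2)[OF that]] 1[OF cats(3)[OF that]] 1[OF cats(4)[OF that]]
    by (auto simp: DHom_def did_def hcat_def vcat_def sq_hcat_def sq_vcat_def)
  have 4: "dcomp D G F \<in> DHom D E'" if "aug_stable_dcat D" "F \<in> DHom D E" "G \<in> DHom E E'" for D G F E E'
  proof -
    have "DOb F \<in> Aug D \<rightarrow> Aug E" "DOb G \<in> Aug E \<rightarrow> Aug E'"
      using that(2,3) unfolding DHom_def by auto
    then have "compose (Ob D) (DOb G) (DOb F) \<in> Aug D \<rightarrow> Aug E'"
      using cats(5)[OF that(1)] by (auto simp: compose_def Pi_iff)
    moreover have "is_functor (hcat D) (hcat E') \<lparr>FOb = DOb (dcomp D G F), FAr = DHor (dcomp D G F)\<rparr>"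
      using 2[OF cats(1)[OF that(1)], of "hcat E" "DOb F" "DHor F" "hcat E'" "DOb G" "DHor G"] that(2,3)
      unfolding DHom_def dcomp_def by (simp add: hcat_def)
    moreover have "is_functor (vcat D) (vcat E') \<lparr>FOb = DOb (dcomp D G F), FAr = DVer (dcomp D G F)\<rparr>"
      using 2[OF cats(2)[OF that(1)], of "vcat E" "DOb F" "DVer F" "vcat E'" "DOb G" "DVer G"] that(2,3)
      unfolding DHom_def dcomp_def by (simp add: vcat_def)
    moreover have "is_functor (sq_hcat D) (sq_hcat E') \<lparr>FOb = DVer (dcomp D G F), FAr = DSq (dcomp D G F)\<rparr>"
      using 2[OF cats(3)[OF that(1)], of "sq_hcat E" "DVer F" "DSq F" "sq_hcat E'" "DVer G" "DSq G"] that(2,3)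
      unfolding DHom_def dcomp_def by (simp add: sq_hcat_def)
    moreover have "is_functor (sq_vcat D) (sq_vcat E') \<lparr>FOb = DHor (dcomp D G F), FAr = DSq (dcomp D G F)\<rparr>"
      using 2[OF cats(4)[OF that(1)], of "sq_vcat E" "DHor F" "DSq F" "sq_vcat E'" "DHor G" "DSq G"] that(2,3)
      unfolding DHom_def dcomp_def by (simp add: sq_vcat_def)
    ultimately show ?thesis
      unfolding DHom_def by (simp add: dcomp_def)
  qed
  have ext: "DOb F \<in> extensional (Ob D)" "DHor F \<in> extensional (Hor D)" "DVer F \<in> extensional (Ver D)" "DSq F \<in> extensional (Sq D)" if "F \<in> DHom D E" for D F E
    using that by (auto simp: DHom_def)
  have 5: "dcomp D F (did D) = F" if "F \<in> DHom D E" for D F E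
    using ext[OF that]
    by (cases F) (auto simp: dcomp_def did_def compose_def fun_eq_iff extensional_def)
  have 6: "dcomp D (did E) F = F" if "F \<in> DHom D E" for D F E
    using ext[OF that] mem[OF that] memH[OF that] memV[OF that] memS[OF that]
    by (cases F) (auto simp: dcomp_def did_def compose_def fun_eq_iff extensional_def)
  have 7: "dcomp D (dcomp E H G) F = dcomp D H (dcomp D G F)" if "F \<in> DHom D E" for D F E G H
    using mem[OF that] memH[OF that] memV[OF that] memS[OF that]
    by (auto simp: dcomp_def compose_def fun_eq_iff)
  show ?thesis
    unfolding category_def DCat_def
    by (auto simp: 3 4 5 6 7)
qed

lemma aug_stable_dcat_W: "aug_stable_dcat (W n)"
proof -
  note defs = category_def is_functor_def hcat_def vcat_def sq_hcat_def sq_vcat_def pairs_cat_def W_def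
  have "category (hcat (W n))" "category (vcat (W n))" "category (sq_hcat (W n))" "category (sq_vcat (W n))"
    by (auto simp: defs)
  moreover have "is_functor (sq_vcat (W n)) (vcat (W n)) \<lparr>FOb = hsrc (W n), FAr = sq_hsrc (W n)\<rparr>"
     "is_functor (sq_vcat (W n)) (vcat (W n)) \<lparr>FOb = htgt (W n), FAr = sq_htgt (W n)\<rparr>"
     "is_functor (vcat (W n)) (sq_vcat (W n)) \<lparr>FOb = hid (W n), FAr = sq_hid (W n)\<rparr>"
     "is_functor (pairs_cat (W n)) (sq_vcat (W n))
       \<lparr>FOb = (\<lambda>(g, f). hcomp (W n) g f), FAr = (\<lambda>(b, a). sq_hcomp (W n) b a)\<rparr>"
    by (auto simp: defs)
  moreover have "stable (W n)"
    unfolding stable_def W_def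
    by (auto simp: bij_betw_def inj_on_def image_iff)
  moreover have "augmented (W n)"
    unfolding augmented_def W_def
    by (auto simp: bij_betw_def inj_on_def image_iff)
  ultimately show ?thesis
    by (simp add: aug_stable_dcat_def double_category_def)
qed

lemma Wmap_DHom: "f \<in> Arr Delta \<Longrightarrow> Wmap f \<in> DHom (W (Dom Delta f)) (W (Cod Delta f))"
proof -
  assume "f \<in> Arr Delta"
  then obtain m \<alpha> n where f: "f = (m, \<alpha>, n)" and mono: "\<And>i j. i \<le> j \<Longrightarrow> j \<le> m \<Longrightarrow> \<alpha> i \<le> \<alpha> j"
    and le: "\<And>i. i \<le> m \<Longrightarrow> \<alpha> i \<le> n"
    by (auto simp: Delta_def mono_on_def PiE_iff)
  show ?thesis
    unfolding f DHom_def Wmap_def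
    by (auto simp: is_functor_def Delta_def hcat_def vcat_def sq_hcat_def sq_vcat_def W_def extensional_def mono le)
qed

end

theory Submission
  imports Defs
begin

text \<open>Write \<open>\<W>[n]\<close> for \<open>W n\<close>. An element of the augmented double nerve over an object \<open>s\<close> of \<open>\<Sigma>\<close> is a double
  functor out of \<open>\<W>[p s]\<close>, that is, a \<open>p s\<close>-simplex of the Waldhausen construction. Hence
  \<open>N\<^sup>a = p\<^sup>* \<circ> J \<circ> \<sigma>\<close> holds on the nose (\<open>nerve_eq_p_upper_wald\<close>), and both isomorphisms become
  statements about \<open>\<sigma>\<close>.

  First isomorphism. Since \<open>N\<^sup>a \<circ> \<pi> = p\<^sup>* \<circ> (J \<circ> \<sigma> \<circ> \<pi>)\<close>, it is enough to show
  \<open>J \<cong> J \<circ> \<sigma> \<circ> \<pi>\<close> and to whisker with \<open>p\<^sup>*\<close>. An \<open>n\<close>-simplex \<open>x\<close> of \<open>X\<close> gives the double functor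
  \<open>\<W>[n] \<rightarrow> \<pi> X\<close> that sends a cell with index tuple \<open>(i, ..., l)\<close> to the restriction of \<open>x\<close> to these
  vertices. It is a bijection \<open>X\<^sub>n \<cong> Hom(\<W>[n], \<pi> X)\<close> (\<open>simplex_functor_bij\<close>) because both sides
  are described by the same data. On the right, stability and the augmentation force a double
  functor to be determined, for \<open>n \<ge> 2\<close>, by its values on the horizontal arrows \<open>(0, j, j + 1)\<close> with
  \<open>1 \<le> j < n\<close> (\<open>W_functor_eq_if_fan_eq\<close>). On the left, the 2-Segal condition for the triangulation of the
  polygon by the triangles \<open>{0, j, j + 1}\<close> says that an arbitrary matching sequence of 2-simplices
  is the restriction of exactly one \<open>n\<close>-simplex (\<open>two_segal_fan_first\<close>). Unitality enters through
  the augmentation of \<open>\<pi> X\<close>.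

  Second isomorphism. Here \<open>p\<^sub>* \<circ> N\<^sup>a = p\<^sub>* \<circ> p\<^sup>* \<circ> (J \<circ> \<sigma>)\<close>, and the isomorphism is the unit of the
  adjunction between \<open>p\<^sup>*\<close> and \<open>p\<^sub>*\<close> (\<open>unit_wald_bij\<close>). An \<open>n\<close>-simplex of the target is a family of
  double functors \<open>\<W>[q + 1 + r] \<rightarrow> D\<close>, one for each monotone map \<open>[q] * [r] \<rightarrow> [n]\<close>, compatible
  with restriction in each of the two blocks separately, together with values at \<open>[-1]\<close>. The index
  tuple of a cell of \<open>\<W>[n]\<close> splits into a left and a right block:
  \<open>(i | j)\<close>, \<open>(i | j, l)\<close>, \<open>(i, k | j)\<close>, \<open>(i, k | j, l)\<close>. So each cell is the image of a cell of some
  \<open>\<W>[q + 1 + r]\<close> lying over the cut between the blocks, where the family can be evaluated; this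
  defines a double functor \<open>\<W>[n] \<rightarrow> D\<close>, with the value at \<open>[-1]\<close> putting the objects \<open>(i, i)\<close> into
  the augmentation (\<open>glued_functor_DHom\<close>). It restricts to the given family on cells over the
  cut, and these determine a double functor (\<open>W_functor_eq_if_cut_eq\<close>).\<close>

section \<open>Natural isomorphisms of presheaf-valued functors\<close>

lemma is_functor_fcomp:
  assumes "is_functor C D F" "is_functor D E G"
  shows "is_functor C E (G \<circ>\<^sub>F F)"
  using assms unfolding is_functor_def fcomp_def by simp

text \<open>The inverse maps of a pointwise bijective transformation are automatically natural; the only
  care needed is to make them extensional.\<close>

lemma psh_iso_if_bij:
  assumes C: "category C" and X: "presheaf C X" and \<theta>: "\<theta> \<in> NatTrans C X Y"
    and bij: "\<And>c. c \<in> Obj C \<Longrightarrow> bij_betw (\<theta> c) (At X c) (At Y c)"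
  shows "psh_iso C X Y \<theta>"
proof -
  define \<psi> where "\<psi> = (\<lambda>c\<in>Obj C. \<lambda>y\<in>At Y c. the_inv_into (At X c) (\<theta> c) y)"
  have inv: "\<psi> c y \<in> At X c" "\<theta> c (\<psi> c y) = y" if "c \<in> Obj C" "y \<in> At Y c" for c y
    using bij[OF that(1)] that
    by (auto simp: \<psi>_def bij_betw_def f_the_inv_into_f intro!: the_inv_into_into)
  have inv': "\<psi> c (\<theta> c x) = x" if "c \<in> Obj C" "x \<in> At X c" for c x
    using bij[OF that(1)] that NatTrans_mem[OF \<theta> that]
    by (auto simp: \<psi>_def bij_betw_def the_inv_into_f_f)
  have \<psi>: "\<psi> \<in> NatTrans C Y X"
  proof (rule NatTransI)
    fix f y assume f: "f \<in> Arr C" and y: "y \<in> At Y (Cod C f)"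
    let ?x = "\<psi> (Cod C f) y"
    have x: "?x \<in> At X (Cod C f)" "\<theta> (Cod C f) ?x = y"
      using inv f y C by (simp_all add: category_simps)
    have "\<psi> (Dom C f) (Act Y f y) = \<psi> (Dom C f) (\<theta> (Dom C f) (Act X f ?x))"
      using NatTrans_natural[OF \<theta> f x(1)] x(2) by simp
    also have "\<dots> = Act X f ?x"
      using inv'[of "Dom C f" "Act X f ?x"] presheaf_simps(1)[OF X f x(1)] f C by (simp add: category_simps)
    finally show "\<psi> (Dom C f) (Act Y f y) = Act X f ?x" .
  next
    fix c assume "c \<in> Obj C"
    then show "\<psi> c \<in> At Y c \<rightarrow>\<^sub>E At X c"
      using inv(1)[of c] by (auto simp: PiE_iff \<psi>_def)
  qed (simp add: \<psi>_def)
  have "ncomp C X \<psi> \<theta> = nid C X" "ncomp C Y \<theta> \<psi> = nid C Y"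
    using inv inv' by (auto simp: ncomp_def nid_def fun_eq_iff)
  then show ?thesis
    using \<theta> \<psi> unfolding psh_iso_def by blast
qed

lemma Arr_functor_PSh:
  assumes "is_functor B (PSh C) F" "f \<in> Arr B"
  shows "under (FAr F f) \<in> NatTrans C (FOb F (Dom B f)) (FOb F (Cod B f))"
  using assms unfolding is_functor_def PSh_def under_def by (fastforce split: prod.splits)

lemma Obj_functor_PSh:
  "is_functor B (PSh C) F \<Longrightarrow> b \<in> Obj B \<Longrightarrow> presheaf C (FOb F b)"
  unfolding is_functor_def PSh_def by auto

lemma naturally_isomorphicI:
  assumes C: "category C" and F: "is_functor B (PSh C) F" and G: "is_functor B (PSh C) G"
    and \<eta>: "\<And>b. b \<in> Obj B \<Longrightarrow> \<eta> b \<in> NatTrans C (FOb F b) (FOb G b)"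
    and bij: "\<And>b c. b \<in> Obj B \<Longrightarrow> c \<in> Obj C \<Longrightarrow> bij_betw (\<eta> b c) (At (FOb F b) c) (At (FOb G b) c)"
    and nat: "\<And>f c x. f \<in> Arr B \<Longrightarrow> c \<in> Obj C \<Longrightarrow> x \<in> At (FOb F (Dom B f)) c \<Longrightarrow>
      \<eta> (Cod B f) c (under (FAr F f) c x) = under (FAr G f) c (\<eta> (Dom B f) c x)"
  shows "naturally_isomorphic B C F G"
  unfolding naturally_isomorphic_def
proof (intro conjI exI ballI)
  show "psh_iso C (FOb F b) (FOb G b) (\<eta> b)" if "b \<in> Obj B" for b
    using psh_iso_if_bij[OF C Obj_functor_PSh[OF F that] \<eta>[OF that] bij[OF that]] .
  show "ncomp C (FOb F (Dom B f)) (\<eta> (Cod B f)) (under (FAr F f)) =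
        ncomp C (FOb F (Dom B f)) (under (FAr G f)) (\<eta> (Dom B f))" if "f \<in> Arr B" for f
    using nat[OF that] by (auto simp: ncomp_def fun_eq_iff)
qed (fact F G)+

lemma ncomp_eq_nid:
  assumes "ncomp C X \<psi> \<theta> = nid C X" "c \<in> Obj C" "x \<in> At X c"
  shows "\<psi> c (\<theta> c x) = x"
  using fun_cong[OF fun_cong[OF assms(1), of c], of x] assms(2,3) by (simp add: ncomp_def nid_def)

lemma psh_iso_bij:
  assumes "psh_iso C X Y \<theta>" "c \<in> Obj C"
  shows "bij_betw (\<theta> c) (At X c) (At Y c)"
proof -
  obtain \<psi> where \<theta>: "\<theta> \<in> NatTrans C X Y" and \<psi>: "\<psi> \<in> NatTrans C Y X"
    and eq: "ncomp C X \<psi> \<theta> = nid C X" "ncomp C Y \<theta> \<psi> = nid C Y"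
    using assms(1) unfolding psh_iso_def by blast
  show ?thesis
  proof (rule bij_betw_byWitness[where f' = "\<psi> c"])
    show "\<forall>x\<in>At X c. \<psi> c (\<theta> c x) = x" "\<forall>y\<in>At Y c. \<theta> c (\<psi> c y) = y"
      using ncomp_eq_nid[OF eq(1) assms(2)] ncomp_eq_nid[OF eq(2) assms(2)] by blast+
    show "\<theta> c ` At X c \<subseteq> At Y c" "\<psi> c ` At Y c \<subseteq> At X c"
      using NatTrans_mem[OF \<theta> assms(2)] NatTrans_mem[OF \<psi> assms(2)] by blast+
  qed
qed

lemma naturally_isomorphicE:
  assumes "naturally_isomorphic B C F G"
  obtains \<eta> where "is_functor B (PSh C) F" "is_functor B (PSh C) G"
    "\<And>b. b \<in> Obj B \<Longrightarrow> psh_iso C (FOb F b) (FOb G b) (\<eta> b)"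
    "\<And>f c x. f \<in> Arr B \<Longrightarrow> c \<in> Obj C \<Longrightarrow> x \<in> At (FOb F (Dom B f)) c \<Longrightarrow>
      \<eta> (Cod B f) c (under (FAr F f) c x) = under (FAr G f) c (\<eta> (Dom B f) c x)"
proof -
  obtain \<eta> where \<eta>: "\<And>b. b \<in> Obj B \<Longrightarrow> psh_iso C (FOb F b) (FOb G b) (\<eta> b)"
    and nat: "\<And>f. f \<in> Arr B \<Longrightarrow> ncomp C (FOb F (Dom B f)) (\<eta> (Cod B f)) (under (FAr F f)) =
           ncomp C (FOb F (Dom B f)) (under (FAr G f)) (\<eta> (Dom B f))"
    using assms unfolding naturally_isomorphic_def by blast
  have "\<eta> (Cod B f) c (under (FAr F f) c x) = under (FAr G f) c (\<eta> (Dom B f) c x)"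
    if "f \<in> Arr B" "c \<in> Obj C" "x \<in> At (FOb F (Dom B f)) c" for f c x
    using fun_cong[OF fun_cong[OF nat[OF that(1)], of c], of x] that(2,3) by (simp add: ncomp_def)
  moreover have "is_functor B (PSh C) F" "is_functor B (PSh C) G"
    using assms unfolding naturally_isomorphic_def by blast+
  ultimately show thesis using \<eta> by (intro that)
qed

lemma naturally_isomorphic_sym:
  assumes B: "category B" and C: "category C" and iso: "naturally_isomorphic B C F G"
  shows "naturally_isomorphic B C G F"
proof -
  obtain \<eta> where F: "is_functor B (PSh C) F" and G: "is_functor B (PSh C) G"
    and \<eta>: "\<And>b. b \<in> Obj B \<Longrightarrow> psh_iso C (FOb F b) (FOb G b) (\<eta> b)"
    and nat: "\<And>f c x. f \<in> Arr B \<Longrightarrow> c \<in> Obj C \<Longrightarrow> x \<in> At (FOb F (Dom B f)) c \<Longrightarrow>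
      \<eta> (Cod B f) c (under (FAr F f) c x) = under (FAr G f) c (\<eta> (Dom B f) c x)"
    using iso by (rule naturally_isomorphicE) (rule that)
  have "\<exists>\<psi>. psh_iso C (FOb G b) (FOb F b) \<psi> \<and>
     (\<forall>c\<in>Obj C. (\<forall>x\<in>At (FOb F b) c. \<psi> c (\<eta> b c x) = x) \<and> (\<forall>y\<in>At (FOb G b) c. \<eta> b c (\<psi> c y) = y))"
    if b: "b \<in> Obj B" for b
  proof -
    obtain \<psi> where \<psi>: "\<psi> \<in> NatTrans C (FOb G b) (FOb F b)"
      and eq: "ncomp C (FOb F b) \<psi> (\<eta> b) = nid C (FOb F b)" "ncomp C (FOb G b) (\<eta> b) \<psi> = nid C (FOb G b)"
      using \<eta>[OF b] unfolding psh_iso_def by blast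
    have "psh_iso C (FOb G b) (FOb F b) \<psi>"
      using \<psi> eq \<eta>[OF b] unfolding psh_iso_def by blast
    then show ?thesis using ncomp_eq_nid[OF eq(1)] ncomp_eq_nid[OF eq(2)] by blast
  qed
  then obtain \<psi> where \<psi>: "\<And>b. b \<in> Obj B \<Longrightarrow> psh_iso C (FOb G b) (FOb F b) (\<psi> b)"
    and inv: "\<And>b c x. b \<in> Obj B \<Longrightarrow> c \<in> Obj C \<Longrightarrow> x \<in> At (FOb F b) c \<Longrightarrow> \<psi> b c (\<eta> b c x) = x"
    "\<And>b c y. b \<in> Obj B \<Longrightarrow> c \<in> Obj C \<Longrightarrow> y \<in> At (FOb G b) c \<Longrightarrow> \<eta> b c (\<psi> b c y) = y"
    by metis
  have mem: "\<psi> b c y \<in> At (FOb F b) c" if "b \<in> Obj B" "c \<in> Obj C" "y \<in> At (FOb G b) c" for b c y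
    using \<psi>[OF that(1)] that(2,3) NatTrans_mem unfolding psh_iso_def by fast
  show ?thesis
  proof (rule naturally_isomorphicI[OF C G F, where \<eta> = \<psi>])
    fix b c assume "b \<in> Obj B" "c \<in> Obj C"
    then show "bij_betw (\<psi> b c) (At (FOb G b) c) (At (FOb F b) c)"
      by (rule psh_iso_bij[OF \<psi>])
  next
    fix b assume "b \<in> Obj B"
    then show "\<psi> b \<in> NatTrans C (FOb G b) (FOb F b)" using \<psi> unfolding psh_iso_def by blast
  next
    fix f c y assume f: "f \<in> Arr B" and c: "c \<in> Obj C" and y: "y \<in> At (FOb G (Dom B f)) c"
    let ?x = "\<psi> (Dom B f) c y"
    have D: "Dom B f \<in> Obj B" "Cod B f \<in> Obj B" using f B by (simp_all add: category_simps)
    have x: "?x \<in> At (FOb F (Dom B f)) c" using mem[OF D(1) c y] .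
    have "under (FAr G f) c y = \<eta> (Cod B f) c (under (FAr F f) c ?x)"
      using nat[OF f c x] inv(2)[OF D(1) c y] by simp
    then show "\<psi> (Cod B f) c (under (FAr G f) c y) = under (FAr F f) c ?x"
      using inv(1)[OF D(2) c] NatTrans_mem[OF Arr_functor_PSh[OF F f] c x] by simp
  qed
qed

lemma FOb_fcomp [simp]: "FOb (G \<circ>\<^sub>F F) b = FOb G (FOb F b)"
  and FAr_fcomp [simp]: "FAr (G \<circ>\<^sub>F F) f = FAr G (FAr F f)"
  by (simp_all add: fcomp_def)

lemma FOb_FAr_simps [simp]:
  "FOb J X = X" "FAr J f = f" "FOb \<sigma> D = wald_ob D" "FAr \<sigma> (D, G, E) = (wald_ob D, wald_nat D G, wald_ob E)"
  "FOb \<pi> X = path_ob X" "FAr \<pi> (X, \<theta>, Y) = (path_ob X, path_nat \<theta>, path_ob Y)"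
  by (simp_all add: J_def wald_fctr_def path_fctr_def)

lemma FOb_p_upper [simp]: "FOb p\<^sup>* X = precomp_ob p_fctr X"
  and under_FAr_p_upper: "under (FAr p\<^sup>* f) = precomp_nat Sigma_cat p_fctr (under f)"
  by (simp_all add: p_upper_def under_def split: prod.splits)

text \<open>Whiskering with \<open>p\<^sup>*\<close>, which turns a comparison of simplicial sets into a comparison of
  presheaves on \<open>\<Sigma>\<close>.\<close>

lemma p_upper_naturally_isomorphic:
  assumes iso: "naturally_isomorphic B Delta F G"
  shows "naturally_isomorphic B Sigma_cat (p\<^sup>* \<circ>\<^sub>F F) (p\<^sup>* \<circ>\<^sub>F G)"
proof -
  obtain \<eta> where F: "is_functor B (PSh Delta) F" and G: "is_functor B (PSh Delta) G"
    and \<eta>: "\<And>b. b \<in> Obj B \<Longrightarrow> psh_iso Delta (FOb F b) (FOb G b) (\<eta> b)"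
    and nat: "\<And>f c x. f \<in> Arr B \<Longrightarrow> c \<in> Obj Delta \<Longrightarrow> x \<in> At (FOb F (Dom B f)) c \<Longrightarrow>
      \<eta> (Cod B f) c (under (FAr F f) c x) = under (FAr G f) c (\<eta> (Dom B f) c x)"
    using iso by (rule naturally_isomorphicE) (rule that)
  note P = is_functor_p_fctr
  show ?thesis
  proof (rule naturally_isomorphicI[OF category_Sigma_cat is_functor_fcomp[OF F is_functor_p_upper]
        is_functor_fcomp[OF G is_functor_p_upper], where \<eta> = "\<lambda>b. precomp_nat Sigma_cat p_fctr (\<eta> b)"])
    fix b assume b: "b \<in> Obj B"
    then have "\<eta> b \<in> NatTrans Delta (FOb F b) (FOb G b)" using \<eta> unfolding psh_iso_def by blast
    then show "precomp_nat Sigma_cat p_fctr (\<eta> b) \<in> NatTrans Sigma_cat (FOb (p\<^sup>* \<circ>\<^sub>F F) b) (FOb (p\<^sup>* \<circ>\<^sub>F G) b)"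
      by (simp add: precomp_nat_NatTrans[OF category_Sigma_cat P])
  next
    fix b c assume "b \<in> Obj B" "c \<in> Obj Sigma_cat"
    then show "bij_betw (precomp_nat Sigma_cat p_fctr (\<eta> b) c) (At (FOb (p\<^sup>* \<circ>\<^sub>F F) b) c) (At (FOb (p\<^sup>* \<circ>\<^sub>F G) b) c)"
      using psh_iso_bij[OF \<eta>, of b "FOb p_fctr c"] functor_simps(1)[OF P] by (simp add: precomp_nat_def)
  next
    fix f c x assume "f \<in> Arr B" "c \<in> Obj Sigma_cat" "x \<in> At (FOb (p\<^sup>* \<circ>\<^sub>F F) (Dom B f)) c"
    then show "precomp_nat Sigma_cat p_fctr (\<eta> (Cod B f)) c (under (FAr (p\<^sup>* \<circ>\<^sub>F F) f) c x) =
        under (FAr (p\<^sup>* \<circ>\<^sub>F G) f) c (precomp_nat Sigma_cat p_fctr (\<eta> (Dom B f)) c x)"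
      using nat[of f "FOb p_fctr c" x] functor_simps(1)[OF P]
      by (simp add: under_FAr_p_upper precomp_nat_def)
  qed
qed

section \<open>Functoriality of the Waldhausen construction and of the nerve\<close>

lemma is_functor_compose:
  assumes "category C" "is_functor C D \<lparr>FOb = f, FAr = f'\<rparr>" "is_functor D E \<lparr>FOb = g, FAr = g'\<rparr>"
  shows "is_functor C E \<lparr>FOb = compose (Obj C) g f, FAr = compose (Arr C) g' f'\<rparr>"
  using assms unfolding is_functor_def category_def by (simp add: compose_def)

lemma DHom_mem:
  assumes "F \<in> DHom D E"
  shows "x \<in> Ob D \<Longrightarrow> DOb F x \<in> Ob E" "h \<in> Hor D \<Longrightarrow> DHor F h \<in> Hor E"
    "v \<in> Ver D \<Longrightarrow> DVer F v \<in> Ver E" "s \<in> Sq D \<Longrightarrow> DSq F s \<in> Sq E"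
  using assms unfolding DHom_def is_functor_def hcat_def vcat_def sq_hcat_def by auto

lemma DHom_eqI:
  assumes "F \<in> DHom D E" "G \<in> DHom D E'"
    and "\<And>x. x \<in> Ob D \<Longrightarrow> DOb F x = DOb G x" "\<And>h. h \<in> Hor D \<Longrightarrow> DHor F h = DHor G h"
    "\<And>v. v \<in> Ver D \<Longrightarrow> DVer F v = DVer G v" "\<And>s. s \<in> Sq D \<Longrightarrow> DSq F s = DSq G s"
  shows "F = G"
proof -
  have "DOb F = DOb G" "DHor F = DHor G" "DVer F = DVer G" "DSq F = DSq G"
    using assms unfolding DHom_def by (auto intro: extensionalityI)
  then show ?thesis by (cases F; cases G) simp
qed

lemma dcomp_DHom:
  assumes D: "aug_stable_dcat D" and F: "F \<in> DHom D E" and G: "G \<in> DHom E E'"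
  shows "dcomp D G F \<in> DHom D E'"
proof -
  have cats: "category (hcat D)" "category (vcat D)" "category (sq_hcat D)" "category (sq_vcat D)" "Aug D \<subseteq> Ob D"
    using D by (auto simp: aug_stable_dcat_def double_category_def augmented_def)
  have fs: "is_functor (hcat D) (hcat E) \<lparr>FOb = DOb F, FAr = DHor F\<rparr>"
    "is_functor (vcat D) (vcat E) \<lparr>FOb = DOb F, FAr = DVer F\<rparr>"
    "is_functor (sq_hcat D) (sq_hcat E) \<lparr>FOb = DVer F, FAr = DSq F\<rparr>"
    "is_functor (sq_vcat D) (sq_vcat E) \<lparr>FOb = DHor F, FAr = DSq F\<rparr>"
    using F unfolding DHom_def by auto
  have gs: "is_functor (hcat E) (hcat E') \<lparr>FOb = DOb G, FAr = DHor G\<rparr>"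
    "is_functor (vcat E) (vcat E') \<lparr>FOb = DOb G, FAr = DVer G\<rparr>"
    "is_functor (sq_hcat E) (sq_hcat E') \<lparr>FOb = DVer G, FAr = DSq G\<rparr>"
    "is_functor (sq_vcat E) (sq_vcat E') \<lparr>FOb = DHor G, FAr = DSq G\<rparr>"
    using G unfolding DHom_def by auto
  have "DOb F \<in> Aug D \<rightarrow> Aug E" "DOb G \<in> Aug E \<rightarrow> Aug E'"
    using F G unfolding DHom_def by auto
  then have "compose (Ob D) (DOb G) (DOb F) \<in> Aug D \<rightarrow> Aug E'"
    using cats(5) by (auto simp: compose_def Pi_iff)
  moreover have carr: "Obj (hcat D) = Ob D" "Arr (hcat D) = Hor D" "Obj (vcat D) = Ob D" "Arr (vcat D) = Ver D"
    "Obj (sq_hcat D) = Ver D" "Arr (sq_hcat D) = Sq D" "Obj (sq_vcat D) = Hor D" "Arr (sq_vcat D) = Sq D"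
    by (simp_all add: hcat_def vcat_def sq_hcat_def sq_vcat_def)
  ultimately show ?thesis
    using is_functor_compose[OF cats(1) fs(1) gs(1)] is_functor_compose[OF cats(2) fs(2) gs(2)]
      is_functor_compose[OF cats(3) fs(3) gs(3)] is_functor_compose[OF cats(4) fs(4) gs(4)]
    unfolding DHom_def dcomp_def carr by simp
qed

lemma dcomp_apply:
  "x \<in> Ob D \<Longrightarrow> DOb (dcomp D G F) x = DOb G (DOb F x)"
  "h \<in> Hor D \<Longrightarrow> DHor (dcomp D G F) h = DHor G (DHor F h)"
  "v \<in> Ver D \<Longrightarrow> DVer (dcomp D G F) v = DVer G (DVer F v)"
  "s \<in> Sq D \<Longrightarrow> DSq (dcomp D G F) s = DSq G (DSq F s)"
  by (simp_all add: dcomp_def compose_def)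

lemma dcomp_assoc:
  assumes "F \<in> DHom D E"
  shows "dcomp D (dcomp E H G) F = dcomp D H (dcomp D G F)"
  using DHom_mem[OF assms] by (auto simp: dcomp_def compose_def fun_eq_iff)

lemma dcomp_did: "F \<in> DHom D E \<Longrightarrow> dcomp D F (did D) = F"
  and did_dcomp: "F \<in> DHom D E \<Longrightarrow> dcomp D (did E) F = F"
  using DHom_mem[of F D E] unfolding DHom_def dcomp_def did_def
  by (cases F; auto simp: compose_def fun_eq_iff extensional_def)+

lemma Wmap_Ide: "Wmap (Ide Delta n) = did (W n)"
  by (auto simp: Wmap_def did_def Delta_def W_def fun_eq_iff)

lemma Delta_arrE:
  assumes "f \<in> Arr Delta"
  obtains m \<alpha> n where "f = (m, \<alpha>, n)" "\<And>i. i \<le> m \<Longrightarrow> \<alpha> i \<le> n"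
    "\<And>i j. i \<le> j \<Longrightarrow> j \<le> m \<Longrightarrow> \<alpha> i \<le> \<alpha> j" "\<alpha> \<in> extensional {..m}"
proof -
  obtain m \<alpha> n where "f = (m, \<alpha>, n)" by (cases f)
  with assms show thesis by (intro that[of m \<alpha> n]) (auto simp: Delta_def mono_on_def PiE_iff)
qed

lemma Delta_simps [simp]:
  "Obj Delta = UNIV" "Dom Delta (m, \<alpha>, n) = m" "Cod Delta (m, \<alpha>, n) = n"
  "Comp Delta (n', \<beta>, k) (m, \<alpha>, n) = (m, compose {..m} \<beta> \<alpha>, k)"
  by (auto simp: Delta_def)

lemma Wmap_Comp:
  assumes "g \<in> Arr Delta" "f \<in> Arr Delta" "Dom Delta g = Cod Delta f"
  shows "Wmap (Comp Delta g f) = dcomp (W (Dom Delta f)) (Wmap g) (Wmap f)"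
proof -
  obtain m \<alpha> n where f: "f = (m, \<alpha>, n)" "\<And>i. i \<le> m \<Longrightarrow> \<alpha> i \<le> n" "\<And>i j. i \<le> j \<Longrightarrow> j \<le> m \<Longrightarrow> \<alpha> i \<le> \<alpha> j"
    using assms(2) by (rule Delta_arrE) (rule that)
  obtain k \<beta> where g: "g = (n, \<beta>, k)" using assms(3) f(1) by (cases g) auto
  show ?thesis
    unfolding f(1) g using f(2,3)
    by (auto simp: Wmap_def dcomp_def compose_def W_def fun_eq_iff)
qed

lemma presheaf_wald_ob: "presheaf Delta (wald_ob D)"
proof -
  have "dcomp (W (Dom Delta f)) (dcomp (W (Dom Delta g)) F (Wmap g)) (Wmap f)
      = dcomp (W (Dom Delta f)) F (Wmap (Comp Delta g f))"
    if "g \<in> Arr Delta" "f \<in> Arr Delta" "Dom Delta g = Cod Delta f" "F \<in> DHom (W (Cod Delta g)) D" for g f F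
    using dcomp_assoc[OF Wmap_DHom[OF that(2)], of F "Wmap g"] Wmap_Comp[OF that(1-3)] that(3) by simp
  moreover have "dcomp (W (Dom Delta f)) F (Wmap f) \<in> DHom (W (Dom Delta f)) D"
    if "f \<in> Arr Delta" "F \<in> DHom (W (Cod Delta f)) D" for f F
    using dcomp_DHom[OF aug_stable_dcat_W Wmap_DHom[OF that(1)] that(2)] .
  ultimately show ?thesis
    unfolding presheaf_def wald_ob_def
    by (simp add: Pi_iff Wmap_Ide dcomp_did category_simps[OF category_Delta] del: split_paired_All Delta_simps(2-4))
qed

lemma wald_nat_NatTrans:
  assumes G: "G \<in> DHom D E"
  shows "wald_nat D G \<in> NatTrans Delta (wald_ob D) (wald_ob E)"
proof (rule NatTransI)
  fix f F assume f: "f \<in> Arr Delta" and "F \<in> At (wald_ob D) (Cod Delta f)"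
  then have F: "F \<in> DHom (W (Cod Delta f)) D" by (simp add: wald_ob_def)
  have "dcomp (W (Dom Delta f)) F (Wmap f) \<in> DHom (W (Dom Delta f)) D"
    using dcomp_DHom[OF aug_stable_dcat_W Wmap_DHom[OF f] F] .
  then show "wald_nat D G (Dom Delta f) (Act (wald_ob D) f F) = Act (wald_ob E) f (wald_nat D G (Cod Delta f) F)"
    using F dcomp_assoc[OF Wmap_DHom[OF f], of G F]
    by (simp add: wald_nat_def wald_ob_def)
qed (auto simp: wald_nat_def wald_ob_def dcomp_DHom[OF aug_stable_dcat_W _ G])

lemma wald_nat_did: "wald_nat D (did D) = nid Delta (wald_ob D)"
  by (auto simp: wald_nat_def nid_def wald_ob_def fun_eq_iff did_dcomp)

lemma wald_nat_dcomp:
  assumes "G \<in> DHom D E" "H \<in> DHom E E'"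
  shows "wald_nat D (dcomp D H G) = ncomp Delta (wald_ob D) (wald_nat E H) (wald_nat D G)"
proof -
  have "dcomp (W n) (dcomp D H G) F = dcomp (W n) H (dcomp (W n) G F)"
    "dcomp (W n) G F \<in> DHom (W n) E" if "F \<in> DHom (W n) D" for n F
    using DHom_mem[OF that] dcomp_DHom[OF aug_stable_dcat_W that assms(1)]
    by (auto simp: dcomp_def compose_def fun_eq_iff)
  then show ?thesis
    by (auto simp: wald_nat_def ncomp_def wald_ob_def fun_eq_iff)
qed

lemma is_functor_wald: "is_functor DCat (PSh Delta) (J \<circ>\<^sub>F \<sigma>)"
  unfolding is_functor_def
  by (auto simp: DCat_def PSh_def J_def wald_fctr_def presheaf_wald_ob wald_nat_NatTrans wald_nat_did wald_nat_dcomp)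

lemma p_arr_dom: "Dom Delta (p_arr f) = p_ob (sigma_dom f)"
  by (cases f rule: p_arr.cases) auto

text \<open>The action of the nerve on an arrow \<open>f\<close> is indexed by \<open>p_ob (sigma_dom f)\<close>, that of the
  Waldhausen construction by the domain of \<open>p_arr f\<close>; these agree for every arrow term, so the
  presheaves are equal as records and not only isomorphic.\<close>

lemma nerve_ob_eq_precomp_wald: "nerve_ob D = precomp_ob p_fctr (wald_ob D)"
  by (auto simp: nerve_ob_def precomp_ob_def wald_ob_def p_fctr_def fun_eq_iff p_arr_dom)

lemma nerve_nat_eq_precomp_wald: "nerve_nat D G = precomp_nat Sigma_cat p_fctr (wald_nat D G)"
  by (auto simp: nerve_nat_def precomp_nat_def wald_nat_def p_fctr_def fun_eq_iff Sigma_cat_def)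

lemma nerve_eq_p_upper_wald: "N\<^sup>a = p\<^sup>* \<circ>\<^sub>F (J \<circ>\<^sub>F \<sigma>)"
  by (auto simp: nerve_fctr_def p_upper_def J_def wald_fctr_def fcomp_def fun_eq_iff
      nerve_ob_eq_precomp_wald nerve_nat_eq_precomp_wald)

lemma is_functor_nerve: "is_functor DCat (PSh Sigma_cat) N\<^sup>a"
  unfolding nerve_eq_p_upper_wald by (intro is_functor_fcomp[OF is_functor_wald is_functor_p_upper])

section \<open>Monotone maps as lists of values\<close>

text \<open>The order-preserving maps used below are given by explicit vertex lists, for which the
  composition with a vertex list is again a vertex list that the simplifier can evaluate.\<close>

definition verts :: "nat list \<Rightarrow> nat \<Rightarrow> dmap" where
  "verts l n = (length l - 1, \<lambda>i\<in>{..length l - 1}. l ! i, n)"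

lemma le_length_minus_1_iff: "l \<noteq> [] \<Longrightarrow> i \<le> length l - 1 \<longleftrightarrow> i < length l"
  by (cases l) auto

lemma verts_Arr: "l \<noteq> [] \<Longrightarrow> sorted l \<Longrightarrow> set l \<subseteq> {..n} \<Longrightarrow> verts l n \<in> Arr Delta"
  by (auto simp: verts_def Delta_def mono_on_def le_length_minus_1_iff[simplified] subset_iff intro!: sorted_nth_mono)

lemma Dom_verts [simp]: "Dom Delta (verts l n) = length l - 1"
  and Cod_verts [simp]: "Cod Delta (verts l n) = n"
  by (simp_all add: verts_def)

lemma Comp_verts:
  assumes "l \<noteq> []" "set l \<subseteq> {..m}"
  shows "Comp Delta (m, \<alpha>, n) (verts l m) = verts (map \<alpha> l) n"
  using assms by (auto simp: verts_def compose_def fun_eq_iff le_length_minus_1_iff[simplified])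

lemma Comp_verts_verts:
  assumes "k \<noteq> []" "set k \<subseteq> {..length l - 1}" "m = length l - 1"
  shows "Comp Delta (verts l n) (verts k m) = verts (map ((!) l) k) n"
proof -
  have "map (\<lambda>i\<in>{..length l - 1}. l ! i) k = map ((!) l) k"
    using assms(2) by auto
  then show ?thesis
    using Comp_verts[of k m "\<lambda>i\<in>{..length l - 1}. l ! i" n] assms by (metis verts_def)
qed

lemma verts_exists:
  assumes "f \<in> Arr Delta"
  obtains l where "f = verts l (Cod Delta f)" "length l = Suc (Dom Delta f)" "sorted l" "set l \<subseteq> {..Cod Delta f}"
proof -
  obtain m \<alpha> n where f: "f = (m, \<alpha>, n)" "\<And>i. i \<le> m \<Longrightarrow> \<alpha> i \<le> n" "\<And>i j. i \<le> j \<Longrightarrow> j \<le> m \<Longrightarrow> \<alpha> i \<le> \<alpha> j"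
    "\<alpha> \<in> extensional {..m}"
    using assms by (rule Delta_arrE) (rule that)
  have "f = verts (map \<alpha> [0..<Suc m]) n"
    using f(1,4) by (auto simp: verts_def fun_eq_iff extensional_def simp del: upt_Suc)
  moreover have "sorted (map \<alpha> [0..<Suc m])"
    using f(3) by (auto simp: sorted_iff_nth_mono simp del: upt_Suc)
  moreover have "set (map \<alpha> [0..<Suc m]) \<subseteq> {..n}"
    using f(2) by (auto simp del: upt_Suc simp: less_Suc_eq_le)
  ultimately show thesis using that f(1) by (simp del: upt_Suc)
qed

lemma Ide_Delta_verts: "Ide Delta n = verts [0..<Suc n] n"
  by (auto simp: Delta_def verts_def fun_eq_iff simp del: upt_Suc)

text \<open>The ordinal sum of two maps concatenates their vertex lists, the second one shifted past the
  first block.\<close>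

lemma p_arr_verts:
  assumes "a \<noteq> []" "b \<noteq> []"
  shows "p_arr (SProd (verts a q) (verts b r)) = verts (a @ map ((+) (q + 1)) b) (q + 1 + r)"
proof -
  have len: "length a - 1 + 1 = length a" "length b - 1 + 1 = length b" using assms by (cases a; cases b; simp)+
  have "(\<lambda>i\<in>{..length a + (length b - 1)}. if i \<le> length a - 1 then (\<lambda>i\<in>{..length a - 1}. a ! i) i
      else q + 1 + (\<lambda>i\<in>{..length b - 1}. b ! i) (i - (length a - 1 + 1)))
    = (\<lambda>i\<in>{..length a + (length b - 1)}. (a @ map ((+) (q + 1)) b) ! i)"
    using assms by (auto simp: fun_eq_iff nth_append Suc_le_eq less_Suc_eq_le[symmetric])
  moreover have "length (a @ map ((+) (q + 1)) b) - 1 = length a + (length b - 1)"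
    using assms by (cases b) auto
  ultimately show ?thesis
    unfolding verts_def p_arr.simps len by argo
qed

lemma p_arr_STerm: "p_arr (STerm s) = verts (replicate (Suc (p_ob s)) 0) 0"
  by (auto simp: verts_def fun_eq_iff nth_Cons split: nat.splits)

section \<open>Rigidity of double functors out of \<open>W n\<close>\<close>

text \<open>The functor axioms spelled out on index tuples. Composition of horizontal arrows and of
  vertical arrows are stated together because both are indexed by the four indices of a square, and
  similarly both compositions of squares are indexed by five.\<close>

lemma DHom_W_iff: "F \<in> DHom (W n) D \<longleftrightarrow>
   (DOb F \<in> extensional (Ob (W n)) \<and> DHor F \<in> extensional (Hor (W n)) \<and>
    DVer F \<in> extensional (Ver (W n)) \<and> DSq F \<in> extensional (Sq (W n))) \<and>
   (\<forall>i j. i \<le> j \<and> j \<le> n \<longrightarrow> DOb F (i, j) \<in> Ob D \<and>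
      DHor F (i, j, j) = hid D (DOb F (i, j)) \<and> DVer F (i, i, j) = vid D (DOb F (i, j))) \<and>
   (\<forall>i\<le>n. DOb F (i, i) \<in> Aug D) \<and>
   (\<forall>i j l. i \<le> j \<and> j \<le> l \<and> l \<le> n \<longrightarrow> DHor F (i, j, l) \<in> Hor D \<and>
      hsrc D (DHor F (i, j, l)) = DOb F (i, j) \<and> htgt D (DHor F (i, j, l)) = DOb F (i, l) \<and>
      DSq F (i, i, j, l) = sq_vid D (DHor F (i, j, l))) \<and>
   (\<forall>i k j. i \<le> k \<and> k \<le> j \<and> j \<le> n \<longrightarrow> DVer F (i, k, j) \<in> Ver D \<and>
      vsrc D (DVer F (i, k, j)) = DOb F (i, j) \<and> vtgt D (DVer F (i, k, j)) = DOb F (k, j) \<and>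
      DSq F (i, k, j, j) = sq_hid D (DVer F (i, k, j))) \<and>
   (\<forall>i k j l. i \<le> k \<and> k \<le> j \<and> j \<le> l \<and> l \<le> n \<longrightarrow> DSq F (i, k, j, l) \<in> Sq D \<and>
      sq_hsrc D (DSq F (i, k, j, l)) = DVer F (i, k, j) \<and> sq_htgt D (DSq F (i, k, j, l)) = DVer F (i, k, l) \<and>
      sq_vsrc D (DSq F (i, k, j, l)) = DHor F (i, j, l) \<and> sq_vtgt D (DSq F (i, k, j, l)) = DHor F (k, j, l)) \<and>
   (\<forall>i k j l. i \<le> k \<and> k \<le> j \<and> j \<le> l \<and> l \<le> n \<longrightarrow>
      DHor F (i, k, l) = hcomp D (DHor F (i, j, l)) (DHor F (i, k, j)) \<and>
      DVer F (i, j, l) = vcomp D (DVer F (k, j, l)) (DVer F (i, k, l))) \<and>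
   (\<forall>i k j l m. i \<le> k \<and> k \<le> j \<and> j \<le> l \<and> l \<le> m \<and> m \<le> n \<longrightarrow>
      DSq F (i, k, j, m) = sq_hcomp D (DSq F (i, k, l, m)) (DSq F (i, k, j, l)) \<and>
      DSq F (i, j, l, m) = sq_vcomp D (DSq F (k, j, l, m)) (DSq F (i, k, l, m)))"
    (is "?L \<longleftrightarrow> ?R")
proof
  assume L: ?L
  show ?R
    using L unfolding DHom_def is_functor_def hcat_def vcat_def sq_hcat_def sq_vcat_def W_def
    by (simp add: Pi_iff)
next
  assume R: ?R
  show ?L
    using R unfolding DHom_def is_functor_def hcat_def vcat_def sq_hcat_def sq_vcat_def W_def
    by (simp add: Pi_iff)
qed

lemma DHom_W_I:
  assumes "DOb F \<in> extensional (Ob (W n))" "DHor F \<in> extensional (Hor (W n))"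
    "DVer F \<in> extensional (Ver (W n))" "DSq F \<in> extensional (Sq (W n))"
    and "\<And>i j. i \<le> j \<Longrightarrow> j \<le> n \<Longrightarrow> DOb F (i, j) \<in> Ob D \<and>
      DHor F (i, j, j) = hid D (DOb F (i, j)) \<and> DVer F (i, i, j) = vid D (DOb F (i, j))"
    and "\<And>i. i \<le> n \<Longrightarrow> DOb F (i, i) \<in> Aug D"
    and "\<And>i j l. i \<le> j \<Longrightarrow> j \<le> l \<Longrightarrow> l \<le> n \<Longrightarrow> DHor F (i, j, l) \<in> Hor D \<and>
      hsrc D (DHor F (i, j, l)) = DOb F (i, j) \<and> htgt D (DHor F (i, j, l)) = DOb F (i, l) \<and>
      DSq F (i, i, j, l) = sq_vid D (DHor F (i, j, l))"
    and "\<And>i k j. i \<le> k \<Longrightarrow> k \<le> j \<Longrightarrow> j \<le> n \<Longrightarrow> DVer F (i, k, j) \<in> Ver D \<and>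
      vsrc D (DVer F (i, k, j)) = DOb F (i, j) \<and> vtgt D (DVer F (i, k, j)) = DOb F (k, j) \<and>
      DSq F (i, k, j, j) = sq_hid D (DVer F (i, k, j))"
    and "\<And>i k j l. i \<le> k \<Longrightarrow> k \<le> j \<Longrightarrow> j \<le> l \<Longrightarrow> l \<le> n \<Longrightarrow> DSq F (i, k, j, l) \<in> Sq D \<and>
      sq_hsrc D (DSq F (i, k, j, l)) = DVer F (i, k, j) \<and> sq_htgt D (DSq F (i, k, j, l)) = DVer F (i, k, l) \<and>
      sq_vsrc D (DSq F (i, k, j, l)) = DHor F (i, j, l) \<and> sq_vtgt D (DSq F (i, k, j, l)) = DHor F (k, j, l)"
    and "\<And>i k j l. i \<le> k \<Longrightarrow> k \<le> j \<Longrightarrow> j \<le> l \<Longrightarrow> l \<le> n \<Longrightarrow>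
      DHor F (i, k, l) = hcomp D (DHor F (i, j, l)) (DHor F (i, k, j)) \<and>
      DVer F (i, j, l) = vcomp D (DVer F (k, j, l)) (DVer F (i, k, l))"
    and "\<And>i k j l m. i \<le> k \<Longrightarrow> k \<le> j \<Longrightarrow> j \<le> l \<Longrightarrow> l \<le> m \<Longrightarrow> m \<le> n \<Longrightarrow>
      DSq F (i, k, j, m) = sq_hcomp D (DSq F (i, k, l, m)) (DSq F (i, k, j, l)) \<and>
      DSq F (i, j, l, m) = sq_vcomp D (DSq F (k, j, l, m)) (DSq F (i, k, l, m))"
  shows "F \<in> DHom (W n) D"
  unfolding DHom_W_iff
  by (intro conjI; ((intro allI impI)?, (elim conjE)?, rule assms; assumption))

lemma W_carriers [simp]:
  "(i, j) \<in> Ob (W n) \<longleftrightarrow> i \<le> j \<and> j \<le> n"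
  "(i, j, l) \<in> Hor (W n) \<longleftrightarrow> i \<le> j \<and> j \<le> l \<and> l \<le> n"
  "(i, k, j) \<in> Ver (W n) \<longleftrightarrow> i \<le> k \<and> k \<le> j \<and> j \<le> n"
  "(i, k, j, l) \<in> Sq (W n) \<longleftrightarrow> i \<le> k \<and> k \<le> j \<and> j \<le> l \<and> l \<le> n"
  by (simp_all add: W_def)

lemma Wmap_apply:
  "i \<le> j \<Longrightarrow> j \<le> m \<Longrightarrow> DOb (Wmap (m, \<alpha>, n)) (i, j) = (\<alpha> i, \<alpha> j)"
  "i \<le> j \<Longrightarrow> j \<le> l \<Longrightarrow> l \<le> m \<Longrightarrow> DHor (Wmap (m, \<alpha>, n)) (i, j, l) = (\<alpha> i, \<alpha> j, \<alpha> l)"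
  "i \<le> k \<Longrightarrow> k \<le> j \<Longrightarrow> j \<le> m \<Longrightarrow> DVer (Wmap (m, \<alpha>, n)) (i, k, j) = (\<alpha> i, \<alpha> k, \<alpha> j)"
  "i \<le> k \<Longrightarrow> k \<le> j \<Longrightarrow> j \<le> l \<Longrightarrow> l \<le> m \<Longrightarrow> DSq (Wmap (m, \<alpha>, n)) (i, k, j, l) = (\<alpha> i, \<alpha> k, \<alpha> j, \<alpha> l)"
  by (simp_all add: Wmap_def)

lemma Wmap_verts_apply:
  "i \<le> j \<Longrightarrow> j < length k \<Longrightarrow> DOb (Wmap (verts k n)) (i, j) = (k ! i, k ! j)"
  "i \<le> j \<Longrightarrow> j \<le> l \<Longrightarrow> l < length k \<Longrightarrow> DHor (Wmap (verts k n)) (i, j, l) = (k ! i, k ! j, k ! l)"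
  "i \<le> r \<Longrightarrow> r \<le> j \<Longrightarrow> j < length k \<Longrightarrow> DVer (Wmap (verts k n)) (i, r, j) = (k ! i, k ! r, k ! j)"
  "i \<le> r \<Longrightarrow> r \<le> j \<Longrightarrow> j \<le> l \<Longrightarrow> l < length k \<Longrightarrow>
    DSq (Wmap (verts k n)) (i, r, j, l) = (k ! i, k ! r, k ! j, k ! l)"
  by (auto simp: verts_def Wmap_apply)

context
  fixes D :: "('o, 'h, 'v, 's) dcat" and F G :: "('o, 'h, 'v, 's) wfun" and n :: nat
  assumes st: "stable D" and au: "augmented D" and F: "F \<in> DHom (W n) D" and G: "G \<in> DHom (W n) D"
begin

text \<open>The rules by which agreement of \<open>F\<close> and \<open>G\<close> spreads. The augmentation gives it for the arrows
  that start or end on the diagonal, since they are determined by their other end; stability gives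
  it for a square from two adjacent sides, and thereby for the other two sides.\<close>

lemma agree_hor_aug:
  assumes "j \<le> l" "l \<le> n" "DOb F (j, l) = DOb G (j, l)"
  shows "DHor F (j, j, l) = DHor G (j, j, l)"
proof -
  have "inj_on (htgt D) {f \<in> Hor D. hsrc D f \<in> Aug D}"
    using au unfolding augmented_def bij_betw_def by blast
  then show ?thesis
    by (rule inj_onD) (use F G assms in \<open>simp_all add: DHom_W_iff\<close>)
qed

lemma agree_ver_aug:
  assumes "i \<le> k" "k \<le> n" "DOb F (i, k) = DOb G (i, k)"
  shows "DVer F (i, k, k) = DVer G (i, k, k)"
proof -
  have "inj_on (vsrc D) {f \<in> Ver D. vtgt D f \<in> Aug D}"
    using au unfolding augmented_def bij_betw_def by blast
  then show ?thesis
    by (rule inj_onD) (use F G assms in \<open>simp_all add: DHom_W_iff\<close>)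
qed

lemma agree_sq_src:
  assumes "i \<le> k" "k \<le> j" "j \<le> l" "l \<le> n"
    and "DHor F (i, j, l) = DHor G (i, j, l)" "DVer F (i, k, j) = DVer G (i, k, j)"
  shows "DSq F (i, k, j, l) = DSq G (i, k, j, l)"
    and "DHor F (k, j, l) = DHor G (k, j, l)" "DVer F (i, k, l) = DVer G (i, k, l)"
proof -
  have "inj_on (\<lambda>a. (sq_vsrc D a, sq_hsrc D a)) (Sq D)"
    using st unfolding stable_def bij_betw_def by blast
  moreover have "DSq F (i, k, j, l) \<in> Sq D" "DSq G (i, k, j, l) \<in> Sq D"
      "sq_vsrc D (DSq F (i, k, j, l)) = sq_vsrc D (DSq G (i, k, j, l))"
      "sq_hsrc D (DSq F (i, k, j, l)) = sq_hsrc D (DSq G (i, k, j, l))"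
    using F G assms unfolding DHom_W_iff by simp_all
  ultimately show *: "DSq F (i, k, j, l) = DSq G (i, k, j, l)"
    by (auto dest: inj_onD)
  show "DHor F (k, j, l) = DHor G (k, j, l)" "DVer F (i, k, l) = DVer G (i, k, l)"
    using F G assms(1-4) * unfolding DHom_W_iff by metis+
qed

lemma agree_sq_tgt:
  assumes "i \<le> k" "k \<le> j" "j \<le> l" "l \<le> n"
    and "DVer F (i, k, l) = DVer G (i, k, l)" "DHor F (k, j, l) = DHor G (k, j, l)"
  shows "DHor F (i, j, l) = DHor G (i, j, l)" "DVer F (i, k, j) = DVer G (i, k, j)"
proof -
  have "inj_on (\<lambda>a. (sq_htgt D a, sq_vtgt D a)) (Sq D)"
    using st unfolding stable_def bij_betw_def by blast
  moreover have "DSq F (i, k, j, l) \<in> Sq D" "DSq G (i, k, j, l) \<in> Sq D"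
      "sq_vtgt D (DSq F (i, k, j, l)) = sq_vtgt D (DSq G (i, k, j, l))"
      "sq_htgt D (DSq F (i, k, j, l)) = sq_htgt D (DSq G (i, k, j, l))"
    using F G assms unfolding DHom_W_iff by simp_all
  ultimately have *: "DSq F (i, k, j, l) = DSq G (i, k, j, l)"
    by (auto dest: inj_onD)
  show "DHor F (i, j, l) = DHor G (i, j, l)" "DVer F (i, k, j) = DVer G (i, k, j)"
    using F G assms(1-4) * unfolding DHom_W_iff by metis+
qed

lemma agree_ob_hor:
  assumes "i \<le> j" "j \<le> l" "l \<le> n" "DHor F (i, j, l) = DHor G (i, j, l)"
  shows "DOb F (i, j) = DOb G (i, j)" "DOb F (i, l) = DOb G (i, l)"
  using F G assms unfolding DHom_W_iff by metis+

lemma agree_ob_ver: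
  assumes "i \<le> k" "k \<le> j" "j \<le> n" "DVer F (i, k, j) = DVer G (i, k, j)"
  shows "DOb F (i, j) = DOb G (i, j)" "DOb F (k, j) = DOb G (k, j)"
  using F G assms unfolding DHom_W_iff by metis+

text \<open>From the horizontal arrows with first index \<open>0\<close> everything spreads downwards. The vertical
  arrow \<open>(0, k, k)\<close> ends on the diagonal; it is the left side of the square \<open>(0, k, k, l)\<close>, whose right
  side \<open>(0, k, l)\<close> is thereby known. With all vertical arrows from the top row known, the squares
  \<open>(0, k, j, l)\<close> yield all horizontal arrows, and the same argument starting in row \<open>i\<close> yields
  all vertical arrows.\<close>

lemma W_functor_eq_if_top_row_eq:
  assumes top: "\<And>j l. j \<le> l \<Longrightarrow> l \<le> n \<Longrightarrow> DHor F (0, j, l) = DHor G (0, j, l)"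
  shows "F = G"
proof -
  have ver0: "DVer F (0, k, l) = DVer G (0, k, l)" if "k \<le> l" "l \<le> n" for k l
  proof -
    have "DVer F (0, k, k) = DVer G (0, k, k)"
      using agree_ver_aug[of 0 k] agree_ob_hor(1)[OF _ _ _ top[of k k]] that by simp
    then show ?thesis using agree_sq_src(3)[of 0 k k l] top that by simp
  qed
  have hor: "DHor F (k, j, l) = DHor G (k, j, l)" if "k \<le> j" "j \<le> l" "l \<le> n" for k j l
    using agree_sq_src(2)[of 0 k j l] top ver0 that by simp
  have ob: "DOb F (i, j) = DOb G (i, j)" if "i \<le> j" "j \<le> n" for i j
    using agree_ob_hor(1)[OF _ _ _ hor[of i j j]] that by simp
  have ver: "DVer F (i, k, j) = DVer G (i, k, j)" if "i \<le> k" "k \<le> j" "j \<le> n" for i k j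
    using agree_sq_src(3)[of i k k j] hor[of i k j] agree_ver_aug[of i k] ob[of i k] that by simp
  have sq: "DSq F (i, k, j, l) = DSq G (i, k, j, l)" if "i \<le> k" "k \<le> j" "j \<le> l" "l \<le> n" for i k j l
    using agree_sq_src(1)[of i k j l] hor[of i j l] ver[of i k j] that by simp
  show ?thesis
    by (rule DHom_eqI[OF F G]) (auto simp: W_def ob hor ver sq)
qed

text \<open>The rigidity used for the path construction: the top row consists of composites of the arrows
  \<open>(0, j, j + 1)\<close>. The first of them, \<open>(0, 0, 1)\<close>, is not prescribed because it starts on the
  diagonal; the value at \<open>(0, n)\<close> is prescribed because for \<open>n \<le> 1\<close> there are no other data.\<close>

lemma W_functor_eq_if_fan_eq:
  assumes ob: "DOb F (0, n) = DOb G (0, n)"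
    and fan: "\<And>j. 1 \<le> j \<Longrightarrow> j < n \<Longrightarrow> DHor F (0, j, Suc j) = DHor G (0, j, Suc j)"
  shows "F = G"
proof -
  have ob1: "DOb F (0, j) = DOb G (0, j)" if "1 \<le> j" "j \<le> n" for j
    using agree_ob_hor(1)[OF _ _ _ fan[of j]] ob that by (cases "j = n") auto
  have fan0: "DHor F (0, 0, Suc 0) = DHor G (0, 0, Suc 0)" if "0 < n"
    using agree_hor_aug[of 0 "Suc 0"] ob1[of 1] that by simp
  have ob': "DOb F (0, j) = DOb G (0, j)" if "j \<le> n" for j
    using ob1[of j] ob agree_ob_hor(1)[OF _ _ _ fan0] that by (cases "j = 0"; cases "n = 0") auto
  have "DHor F (0, j, l) = DHor G (0, j, l)" if "j \<le> l" "l \<le> n" for j l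
    using that
  proof (induction l rule: dec_induct)
    case base
    then show ?case using F G ob'[of j] unfolding DHom_W_iff by (metis le0)
  next
    case (step l)
    have "DHor F (0, l, Suc l) = DHor G (0, l, Suc l)"
      using fan[of l] fan0 step by (cases "l = 0") auto
    moreover have "DHor H (0, j, Suc l) = hcomp D (DHor H (0, l, Suc l)) (DHor H (0, j, l))"
      if "H \<in> DHom (W n) D" for H
      using that step unfolding DHom_W_iff by simp
    ultimately show ?case using step F G by simp
  qed
  then show ?thesis by (rule W_functor_eq_if_top_row_eq)
qed

text \<open>The rigidity used for the unit: cells over a cut between \<open>q\<close> and \<open>q + 1\<close> suffice. The cells
  with all indices to the left of the cut are recovered by completing squares from their target
  sides: the square \<open>(i, k, j, n)\<close> has known right side \<open>(i, k, n)\<close> and bottom side \<open>(k, j, n)\<close>, so that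
  its left side \<open>(i, k, j)\<close> is known. This gives the whole top row.\<close>

lemma W_functor_eq_if_cut_eq:
  assumes q: "q < n"
    and hor: "\<And>i j l. i \<le> q \<Longrightarrow> q < j \<Longrightarrow> j \<le> l \<Longrightarrow> l \<le> n \<Longrightarrow> DHor F (i, j, l) = DHor G (i, j, l)"
    and ver: "\<And>i k j. i \<le> k \<Longrightarrow> k \<le> q \<Longrightarrow> q < j \<Longrightarrow> j \<le> n \<Longrightarrow> DVer F (i, k, j) = DVer G (i, k, j)"
  shows "F = G"
proof -
  have ob: "DOb F (i, j) = DOb G (i, j)" if "i \<le> q" "q < j" "j \<le> n" for i j
    using agree_ob_hor(1)[OF _ _ _ hor[of i j j]] that by simp
  have hor': "DHor F (i, k, l) = DHor G (i, k, l)" if "i \<le> k" "k \<le> q" "q < l" "l \<le> n" for i k l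
    using agree_sq_tgt(1)[of i k k l] ver[of i k l] agree_hor_aug[of k l] ob[of k l] that by simp
  have ver': "DVer F (i, k, j) = DVer G (i, k, j)" if "i \<le> k" "k \<le> j" "j \<le> q" for i k j
    using agree_sq_tgt(2)[of i k j n] ver[of i k n] hor'[of k j n] that q by simp
  have ob': "DOb F (i, j) = DOb G (i, j)" if "i \<le> j" "j \<le> q" for i j
    using agree_ob_ver(1)[OF _ _ _ ver'[of i i j]] that q by simp
  have hor'': "DHor F (i, j, l) = DHor G (i, j, l)" if "i \<le> j" "j \<le> l" "l \<le> q" for i j l
    using agree_sq_tgt(1)[of i j j l] ver'[of i j l] agree_hor_aug[of j l] ob'[of j l] that q by simp
  have "DHor F (0, j, l) = DHor G (0, j, l)" if "j \<le> l" "l \<le> n" for j l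
    using hor[of 0 j l] hor'[of 0 j l] hor''[of 0 j l] that by linarith
  then show ?thesis by (rule W_functor_eq_if_top_row_eq)
qed

end

section \<open>Gluing a double functor from two-block simplices\<close>

text \<open>The double functor assembled from a family \<open>\<psi>\<close>. Each cell of \<open>W n\<close> is looked up in the
  smallest simplex \<open>[q] * [r]\<close> that carries it, where it is the cell with pairwise distinct indices.\<close>

definition glued_functor :: "nat \<Rightarrow> (sigma_ob \<Rightarrow> dmap \<Rightarrow> ('o, 'h, 'v, 's) wfun) \<Rightarrow> ('o, 'h, 'v, 's) wfun" where
  "glued_functor n \<psi> =
     \<lparr>DOb = (\<lambda>(i, j)\<in>Ob (W n). DOb (\<psi> (SPair 0 0) (verts [i, j] n)) (0, 1)),
      DHor = (\<lambda>(i, j, l)\<in>Hor (W n). DHor (\<psi> (SPair 0 1) (verts [i, j, l] n)) (0, 1, 2)),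
      DVer = (\<lambda>(i, k, j)\<in>Ver (W n). DVer (\<psi> (SPair 1 0) (verts [i, k, j] n)) (0, 1, 2)),
      DSq = (\<lambda>(i, k, j, l)\<in>Sq (W n). DSq (\<psi> (SPair 1 1) (verts [i, k, j, l] n)) (0, 1, 2, 3))\<rparr>"

context
  fixes D :: "('o, 'h, 'v, 's) dcat" and n :: nat and \<psi> :: "sigma_ob \<Rightarrow> dmap \<Rightarrow> ('o, 'h, 'v, 's) wfun"
  assumes \<psi>: "\<psi> \<in> NatTrans Sigma_cat (precomp_ob p_fctr (yoneda Delta n)) (nerve_ob D)"
begin

lemma family_mem:
  assumes "l \<noteq> []" "sorted l" "set l \<subseteq> {..n}" "length l = Suc (p_ob s)"
  shows "\<psi> s (verts l n) \<in> DHom (W (p_ob s)) D"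
  using NatTrans_mem[OF \<psi>, of s "verts l n"] verts_Arr[OF assms(1-3)] assms(4)
  by (simp add: Sigma_cat_def nerve_ob_def p_fctr_def)

text \<open>Naturality of the family along a map of \<open>\<Sigma>\<close> that is given on each block by a vertex list. The
  block structure only allows vertex lists \<open>k\<close> with at least one entry on each side of the cut.\<close>

lemma family_restrict:
  assumes l: "sorted l" "set l \<subseteq> {..n}" "length l = q + r + 2"
    and a: "a \<noteq> []" "sorted a" "set a \<subseteq> {..q}" and b: "b \<noteq> []" "sorted b" "set b \<subseteq> {..r}"
    and k: "k = a @ map ((+) (q + 1)) b"
  shows "\<psi> (SPair (length a - 1) (length b - 1)) (verts (map ((!) l) k) n) =
     dcomp (W (length a - 1 + 1 + (length b - 1))) (\<psi> (SPair q r) (verts l n)) (Wmap (verts k (q + 1 + r)))"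
proof -
  let ?f = "SProd (verts a q) (verts b r)"
  have f: "?f \<in> Arr Sigma_cat" using verts_Arr[OF a] verts_Arr[OF b] by simp
  have "set k \<subseteq> {..length l - 1}" using a(3) b(3) l(3) unfolding k by auto
  then have "Comp Delta (verts l n) (verts k (q + 1 + r)) = verts (map ((!) l) k) n"
    using l(3) a(1) unfolding k by (intro Comp_verts_verts) auto
  moreover have "verts l n \<in> At (precomp_ob p_fctr (yoneda Delta n)) (SPair q r)"
    using verts_Arr[OF _ l(1,2)] l(3) by (cases l) (auto simp: p_fctr_def)
  moreover note NatTrans_natural[OF \<psi> f, of "verts l n"]
  ultimately show ?thesis
    using p_arr_verts[OF a(1) b(1), of q r] unfolding k
    by (simp add: Sigma_cat_def nerve_ob_def p_fctr_def)
qed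

lemma family_ob:
  assumes l: "sorted l" "set l \<subseteq> {..n}" "length l = q + r + 2"
    and ij: "i \<le> q" "q < j" "j \<le> q + 1 + r"
  shows "DOb (\<psi> (SPair 0 0) (verts [l ! i, l ! j] n)) (0, 1) =
    DOb (\<psi> (SPair q r) (verts l n)) (i, j)"
proof -
  have "\<psi> (SPair 0 0) (verts [l ! i, l ! j] n) =
      dcomp (W 1) (\<psi> (SPair q r) (verts l n)) (Wmap (verts [i, j] (q + 1 + r)))"
    using family_restrict[OF l, of "[i]" "[j - (q + 1)]" "[i, j]"] ij
    by (simp add: le_diff_conv eval_nat_numeral)
  then show ?thesis using ij by (simp add: dcomp_apply Wmap_verts_apply eval_nat_numeral)
qed

lemma family_hor:
  assumes l: "sorted l" "set l \<subseteq> {..n}" "length l = q + r + 2"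
    and ij: "i \<le> q" "q < j" "j \<le> k" "k \<le> q + 1 + r"
  shows "DHor (\<psi> (SPair 0 1) (verts [l ! i, l ! j, l ! k] n)) (0, 1, 2) =
    DHor (\<psi> (SPair q r) (verts l n)) (i, j, k)"
proof -
  have "\<psi> (SPair 0 1) (verts [l ! i, l ! j, l ! k] n) =
      dcomp (W 2) (\<psi> (SPair q r) (verts l n)) (Wmap (verts [i, j, k] (q + 1 + r)))"
    using family_restrict[OF l, of "[i]" "[j - (q + 1), k - (q + 1)]" "[i, j, k]"] ij
    by (simp add: le_diff_conv eval_nat_numeral)
  then show ?thesis using ij by (simp add: dcomp_apply Wmap_verts_apply eval_nat_numeral)
qed

lemma family_ver:
  assumes l: "sorted l" "set l \<subseteq> {..n}" "length l = q + r + 2"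
    and ij: "i \<le> k" "k \<le> q" "q < j" "j \<le> q + 1 + r"
  shows "DVer (\<psi> (SPair 1 0) (verts [l ! i, l ! k, l ! j] n)) (0, 1, 2) =
    DVer (\<psi> (SPair q r) (verts l n)) (i, k, j)"
proof -
  have "\<psi> (SPair 1 0) (verts [l ! i, l ! k, l ! j] n) =
      dcomp (W 2) (\<psi> (SPair q r) (verts l n)) (Wmap (verts [i, k, j] (q + 1 + r)))"
    using family_restrict[OF l, of "[i, k]" "[j - (q + 1)]" "[i, k, j]"] ij
    by (simp add: le_diff_conv eval_nat_numeral)
  then show ?thesis using ij by (simp add: dcomp_apply Wmap_verts_apply eval_nat_numeral)
qed

lemma family_sq:
  assumes l: "sorted l" "set l \<subseteq> {..n}" "length l = q + r + 2"
    and ij: "i \<le> k" "k \<le> q" "q < j" "j \<le> m" "m \<le> q + 1 + r"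
  shows "DSq (\<psi> (SPair 1 1) (verts [l ! i, l ! k, l ! j, l ! m] n)) (0, 1, 2, 3) =
    DSq (\<psi> (SPair q r) (verts l n)) (i, k, j, m)"
proof -
  have "\<psi> (SPair 1 1) (verts [l ! i, l ! k, l ! j, l ! m] n) =
      dcomp (W 3) (\<psi> (SPair q r) (verts l n)) (Wmap (verts [i, k, j, m] (q + 1 + r)))"
    using family_restrict[OF l, of "[i, k]" "[j - (q + 1), m - (q + 1)]" "[i, k, j, m]"] ij
    by (simp add: le_diff_conv eval_nat_numeral)
  then show ?thesis using ij by (simp add: dcomp_apply Wmap_verts_apply eval_nat_numeral)
qed

text \<open>The constant map \<open>[0] * [0] \<rightarrow> [n]\<close> at \<open>i\<close> factors through \<open>[-1]\<close>. This puts the object \<open>(i, i)\<close> of the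
  assembled functor into the augmentation, as the object of \<open>W 0\<close> belongs to it.\<close>

lemma family_const:
  assumes "i \<le> n"
  shows "\<psi> (SPair 0 0) (verts [i, i] n) = dcomp (W 1) (\<psi> Minus1 (verts [i] n)) (Wmap (verts [0, 0] 0))"
proof -
  have "\<psi> (SPair 0 0) (Comp Delta (verts [i] n) (verts [0, 0] 0)) =
      dcomp (W 1) (\<psi> Minus1 (verts [i] n)) (Wmap (verts [0, 0] 0))"
    using NatTrans_natural[OF \<psi>, of "STerm (SPair 0 0)" "verts [i] n"] verts_Arr[of "[i]" n] assms
      p_arr_STerm[of "SPair 0 0"]
    by (simp add: Sigma_cat_def nerve_ob_def p_fctr_def)
  moreover have "Comp Delta (verts [i] n) (verts [0, 0] 0) = verts [i, i] n"
    by (subst Comp_verts_verts) auto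
  ultimately show ?thesis by simp
qed

text \<open>On a simplex \<open>[q] * [r]\<close> with vertex list \<open>l\<close>, the assembled functor reproduces the member of
  the family on all cells over the cut.\<close>

lemma glued_functor_eq_family:
  assumes "sorted l" "set l \<subseteq> {..n}" "length l = q + r + 2"
  shows "i \<le> q \<Longrightarrow> q < j \<Longrightarrow> j \<le> q + 1 + r \<Longrightarrow> DOb (glued_functor n \<psi>) (l ! i, l ! j) = DOb (\<psi> (SPair q r) (verts l n)) (i, j)"
    and "i \<le> q \<Longrightarrow> q < j \<Longrightarrow> j \<le> k \<Longrightarrow> k \<le> q + 1 + r \<Longrightarrow>
      DHor (glued_functor n \<psi>) (l ! i, l ! j, l ! k) = DHor (\<psi> (SPair q r) (verts l n)) (i, j, k)"
    and "i \<le> k \<Longrightarrow> k \<le> q \<Longrightarrow> q < j \<Longrightarrow> j \<le> q + 1 + r \<Longrightarrow>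
      DVer (glued_functor n \<psi>) (l ! i, l ! k, l ! j) = DVer (\<psi> (SPair q r) (verts l n)) (i, k, j)"
    and "i \<le> k \<Longrightarrow> k \<le> q \<Longrightarrow> q < j \<Longrightarrow> j \<le> m \<Longrightarrow> m \<le> q + 1 + r \<Longrightarrow>
      DSq (glued_functor n \<psi>) (l ! i, l ! k, l ! j, l ! m) = DSq (\<psi> (SPair q r) (verts l n)) (i, k, j, m)"
proof -
  have le: "l ! i \<le> l ! j" if "i \<le> j" "j \<le> q + 1 + r" for i j
    using assms(1,3) that by (intro sorted_nth_mono) auto
  have n: "l ! i \<le> n" if "i \<le> q + 1 + r" for i
    using subsetD[OF assms(2) nth_mem, of i] assms(3) that by simp
  show "i \<le> q \<Longrightarrow> q < j \<Longrightarrow> j \<le> q + 1 + r \<Longrightarrow> DOb (glued_functor n \<psi>) (l ! i, l ! j) = DOb (\<psi> (SPair q r) (verts l n)) (i, j)"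
    using family_ob[OF assms] le n by (simp add: glued_functor_def)
  show "i \<le> q \<Longrightarrow> q < j \<Longrightarrow> j \<le> k \<Longrightarrow> k \<le> q + 1 + r \<Longrightarrow>
      DHor (glued_functor n \<psi>) (l ! i, l ! j, l ! k) = DHor (\<psi> (SPair q r) (verts l n)) (i, j, k)"
    using family_hor[OF assms] le n by (simp add: glued_functor_def)
  show "i \<le> k \<Longrightarrow> k \<le> q \<Longrightarrow> q < j \<Longrightarrow> j \<le> q + 1 + r \<Longrightarrow>
      DVer (glued_functor n \<psi>) (l ! i, l ! k, l ! j) = DVer (\<psi> (SPair q r) (verts l n)) (i, k, j)"
    using family_ver[OF assms] le n by (simp add: glued_functor_def)
  show "i \<le> k \<Longrightarrow> k \<le> q \<Longrightarrow> q < j \<Longrightarrow> j \<le> m \<Longrightarrow> m \<le> q + 1 + r \<Longrightarrow>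
      DSq (glued_functor n \<psi>) (l ! i, l ! k, l ! j, l ! m) = DSq (\<psi> (SPair q r) (verts l n)) (i, k, j, m)"
    using family_sq[OF assms] le n by (simp add: glued_functor_def)
qed

text \<open>Apart from the augmentation, each axiom for the assembled functor involves cells that all lie over the cut of a common
  simplex \<open>[q] * [r]\<close> with \<open>q, r \<le> 2\<close>, so that it is inherited from the member \<open>?\<Phi>\<close> of the family at
  this simplex. For the identity axioms, a cell with an index repeated inside a block is an identity cell of
  a smaller simplex.\<close>

lemma glued_functor_DHom: "glued_functor n \<psi> \<in> DHom (W n) D"
proof -
  have fam: "\<psi> (SPair q r) (verts l n) \<in> DHom (W (q + 1 + r)) D"
    if "sorted l" "set l \<subseteq> {..n}" "length l = q + r + 2" for l q r
    using family_mem[OF _ that(1,2), of "SPair q r"] that(3) by (cases l) auto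
  have ob: "DOb (glued_functor n \<psi>) (i, j) \<in> Ob D \<and> DHor (glued_functor n \<psi>) (i, j, j) = hid D (DOb (glued_functor n \<psi>) (i, j)) \<and>
      DVer (glued_functor n \<psi>) (i, i, j) = vid D (DOb (glued_functor n \<psi>) (i, j))" if ij: "i \<le> j" "j \<le> n" for i j
  proof -
    have l: "sorted [i, j]" "set [i, j] \<subseteq> {..n}" "length [i, j] = 0 + 0 + 2" using ij by auto
    let ?\<Phi> = "\<psi> (SPair 0 0) (verts [i, j] n)"
    have "DOb ?\<Phi> (0, 1) \<in> Ob D \<and> DHor ?\<Phi> (0, 1, 1) = hid D (DOb ?\<Phi> (0, 1)) \<and>
      DVer ?\<Phi> (0, 0, 1) = vid D (DOb ?\<Phi> (0, 1))"
      using fam[OF l] unfolding DHom_W_iff by simp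
    then show ?thesis
      using glued_functor_eq_family(1)[OF l, of 0 1] glued_functor_eq_family(2)[OF l, of 0 1 1] glued_functor_eq_family(3)[OF l, of 0 0 1] by simp
  qed
  have aug: "DOb (glued_functor n \<psi>) (i, i) \<in> Aug D" if "i \<le> n" for i
  proof -
    have l: "sorted [i, i]" "set [i, i] \<subseteq> {..n}" "length [i, i] = 0 + 0 + 2" using that by auto
    let ?\<Phi> = "\<psi> Minus1 (verts [i] n)"
    have \<Phi>: "?\<Phi> \<in> DHom (W 0) D" using family_mem[of "[i]" Minus1] that by simp
    have "\<psi> (SPair 0 0) (verts [i, i] n) = dcomp (W 1) ?\<Phi> (Wmap (verts [0, 0] 0))"
      using family_const[OF that] .
    then have "DOb (glued_functor n \<psi>) (i, i) = DOb ?\<Phi> (0, 0)"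
      using glued_functor_eq_family(1)[OF l, of 0 1] by (simp add: dcomp_apply Wmap_verts_apply)
    then show ?thesis using \<Phi> unfolding DHom_W_iff by simp
  qed
  have hor: "DHor (glued_functor n \<psi>) (i, j, k) \<in> Hor D \<and>
      hsrc D (DHor (glued_functor n \<psi>) (i, j, k)) = DOb (glued_functor n \<psi>) (i, j) \<and> htgt D (DHor (glued_functor n \<psi>) (i, j, k)) = DOb (glued_functor n \<psi>) (i, k) \<and>
      DSq (glued_functor n \<psi>) (i, i, j, k) = sq_vid D (DHor (glued_functor n \<psi>) (i, j, k))" if ij: "i \<le> j" "j \<le> k" "k \<le> n" for i j k
  proof -
    have l: "sorted [i, j, k]" "set [i, j, k] \<subseteq> {..n}" "length [i, j, k] = 0 + 1 + 2" using ij by auto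
    let ?\<Phi> = "\<psi> (SPair 0 1) (verts [i, j, k] n)"
    have "DHor ?\<Phi> (0, 1, 2) \<in> Hor D \<and> hsrc D (DHor ?\<Phi> (0, 1, 2)) = DOb ?\<Phi> (0, 1) \<and>
        htgt D (DHor ?\<Phi> (0, 1, 2)) = DOb ?\<Phi> (0, 2) \<and> DSq ?\<Phi> (0, 0, 1, 2) = sq_vid D (DHor ?\<Phi> (0, 1, 2))"
      using fam[OF l] unfolding DHom_W_iff by simp
    then show ?thesis
      using glued_functor_eq_family(1)[OF l, of 0 1] glued_functor_eq_family(1)[OF l, of 0 2] glued_functor_eq_family(2)[OF l, of 0 1 2]
        glued_functor_eq_family(4)[OF l, of 0 0 1 2] by simp
  qed
  have ver: "DVer (glued_functor n \<psi>) (i, k, j) \<in> Ver D \<and>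
      vsrc D (DVer (glued_functor n \<psi>) (i, k, j)) = DOb (glued_functor n \<psi>) (i, j) \<and> vtgt D (DVer (glued_functor n \<psi>) (i, k, j)) = DOb (glued_functor n \<psi>) (k, j) \<and>
      DSq (glued_functor n \<psi>) (i, k, j, j) = sq_hid D (DVer (glued_functor n \<psi>) (i, k, j))" if ij: "i \<le> k" "k \<le> j" "j \<le> n" for i j k
  proof -
    have l: "sorted [i, k, j]" "set [i, k, j] \<subseteq> {..n}" "length [i, k, j] = 1 + 0 + 2" using ij by auto
    let ?\<Phi> = "\<psi> (SPair 1 0) (verts [i, k, j] n)"
    have "DVer ?\<Phi> (0, 1, 2) \<in> Ver D \<and> vsrc D (DVer ?\<Phi> (0, 1, 2)) = DOb ?\<Phi> (0, 2) \<and>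
        vtgt D (DVer ?\<Phi> (0, 1, 2)) = DOb ?\<Phi> (1, 2) \<and> DSq ?\<Phi> (0, 1, 2, 2) = sq_hid D (DVer ?\<Phi> (0, 1, 2))"
      using fam[OF l] unfolding DHom_W_iff by simp
    then show ?thesis
      using glued_functor_eq_family(1)[OF l, of 0 2] glued_functor_eq_family(1)[OF l, of 1 2] glued_functor_eq_family(3)[OF l, of 0 1 2]
        glued_functor_eq_family(4)[OF l, of 0 1 2 2] by simp
  qed
  have sq: "DSq (glued_functor n \<psi>) (i, k, j, m) \<in> Sq D \<and>
      sq_hsrc D (DSq (glued_functor n \<psi>) (i, k, j, m)) = DVer (glued_functor n \<psi>) (i, k, j) \<and> sq_htgt D (DSq (glued_functor n \<psi>) (i, k, j, m)) = DVer (glued_functor n \<psi>) (i, k, m) \<and>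
      sq_vsrc D (DSq (glued_functor n \<psi>) (i, k, j, m)) = DHor (glued_functor n \<psi>) (i, j, m) \<and> sq_vtgt D (DSq (glued_functor n \<psi>) (i, k, j, m)) = DHor (glued_functor n \<psi>) (k, j, m)"
    if ij: "i \<le> k" "k \<le> j" "j \<le> m" "m \<le> n" for i k j m
  proof -
    have l: "sorted [i, k, j, m]" "set [i, k, j, m] \<subseteq> {..n}" "length [i, k, j, m] = 1 + 1 + 2" using ij by auto
    let ?\<Phi> = "\<psi> (SPair 1 1) (verts [i, k, j, m] n)"
    have "DSq ?\<Phi> (0, 1, 2, 3) \<in> Sq D \<and> sq_hsrc D (DSq ?\<Phi> (0, 1, 2, 3)) = DVer ?\<Phi> (0, 1, 2) \<and>
        sq_htgt D (DSq ?\<Phi> (0, 1, 2, 3)) = DVer ?\<Phi> (0, 1, 3) \<and> sq_vsrc D (DSq ?\<Phi> (0, 1, 2, 3)) = DHor ?\<Phi> (0, 2, 3) \<and>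
        sq_vtgt D (DSq ?\<Phi> (0, 1, 2, 3)) = DHor ?\<Phi> (1, 2, 3)"
      using fam[OF l] unfolding DHom_W_iff by simp
    then show ?thesis
      using glued_functor_eq_family(2)[OF l, of 0 2 3] glued_functor_eq_family(2)[OF l, of 1 2 3] glued_functor_eq_family(3)[OF l, of 0 1 2]
        glued_functor_eq_family(3)[OF l, of 0 1 3] glued_functor_eq_family(4)[OF l, of 0 1 2 3] by simp
  qed
  have hcomp: "DHor (glued_functor n \<psi>) (i, k, m) = hcomp D (DHor (glued_functor n \<psi>) (i, j, m)) (DHor (glued_functor n \<psi>) (i, k, j))"
    if ij: "i \<le> k" "k \<le> j" "j \<le> m" "m \<le> n" for i k j m
  proof -
    have l: "sorted [i, k, j, m]" "set [i, k, j, m] \<subseteq> {..n}" "length [i, k, j, m] = 0 + 2 + 2" using ij by auto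
    let ?\<Phi> = "\<psi> (SPair 0 2) (verts [i, k, j, m] n)"
    have "DHor ?\<Phi> (0, 1, 3) = hcomp D (DHor ?\<Phi> (0, 2, 3)) (DHor ?\<Phi> (0, 1, 2))"
      using fam[OF l] unfolding DHom_W_iff by simp
    then show ?thesis
      using glued_functor_eq_family(2)[OF l, of 0 1 3] glued_functor_eq_family(2)[OF l, of 0 2 3] glued_functor_eq_family(2)[OF l, of 0 1 2] by simp
  qed
  have vcomp: "DVer (glued_functor n \<psi>) (i, j, m) = vcomp D (DVer (glued_functor n \<psi>) (k, j, m)) (DVer (glued_functor n \<psi>) (i, k, m))"
    if ij: "i \<le> k" "k \<le> j" "j \<le> m" "m \<le> n" for i k j m
  proof -
    have l: "sorted [i, k, j, m]" "set [i, k, j, m] \<subseteq> {..n}" "length [i, k, j, m] = 2 + 0 + 2" using ij by auto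
    let ?\<Phi> = "\<psi> (SPair 2 0) (verts [i, k, j, m] n)"
    have "DVer ?\<Phi> (0, 2, 3) = vcomp D (DVer ?\<Phi> (1, 2, 3)) (DVer ?\<Phi> (0, 1, 3))"
      using fam[OF l] unfolding DHom_W_iff by simp
    then show ?thesis
      using glued_functor_eq_family(3)[OF l, of 0 2 3] glued_functor_eq_family(3)[OF l, of 1 2 3] glued_functor_eq_family(3)[OF l, of 0 1 3] by simp
  qed
  have sq_hcomp: "DSq (glued_functor n \<psi>) (i, k, j, o') = sq_hcomp D (DSq (glued_functor n \<psi>) (i, k, m, o')) (DSq (glued_functor n \<psi>) (i, k, j, m))"
    if ij: "i \<le> k" "k \<le> j" "j \<le> m" "m \<le> o'" "o' \<le> n" for i k j m o'
  proof -
    have l: "sorted [i, k, j, m, o']" "set [i, k, j, m, o'] \<subseteq> {..n}" "length [i, k, j, m, o'] = 1 + 2 + 2" using ij by auto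
    let ?\<Phi> = "\<psi> (SPair 1 2) (verts [i, k, j, m, o'] n)"
    have "DSq ?\<Phi> (0, 1, 2, 4) = sq_hcomp D (DSq ?\<Phi> (0, 1, 3, 4)) (DSq ?\<Phi> (0, 1, 2, 3))"
      using fam[OF l] unfolding DHom_W_iff by simp
    then show ?thesis
      using glued_functor_eq_family(4)[OF l, of 0 1 2 4] glued_functor_eq_family(4)[OF l, of 0 1 3 4] glued_functor_eq_family(4)[OF l, of 0 1 2 3] by simp
  qed
  have sq_vcomp: "DSq (glued_functor n \<psi>) (i, j, m, o') = sq_vcomp D (DSq (glued_functor n \<psi>) (k, j, m, o')) (DSq (glued_functor n \<psi>) (i, k, m, o'))"
    if ij: "i \<le> k" "k \<le> j" "j \<le> m" "m \<le> o'" "o' \<le> n" for i k j m o'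
  proof -
    have l: "sorted [i, k, j, m, o']" "set [i, k, j, m, o'] \<subseteq> {..n}" "length [i, k, j, m, o'] = 2 + 1 + 2" using ij by auto
    let ?\<Phi> = "\<psi> (SPair 2 1) (verts [i, k, j, m, o'] n)"
    have "DSq ?\<Phi> (0, 2, 3, 4) = sq_vcomp D (DSq ?\<Phi> (1, 2, 3, 4)) (DSq ?\<Phi> (0, 1, 3, 4))"
      using fam[OF l] unfolding DHom_W_iff by simp
    then show ?thesis
      using glued_functor_eq_family(4)[OF l, of 0 2 3 4] glued_functor_eq_family(4)[OF l, of 1 2 3 4] glued_functor_eq_family(4)[OF l, of 0 1 3 4] by simp
  qed
  have ext: "DOb (glued_functor n \<psi>) \<in> extensional (Ob (W n))" "DHor (glued_functor n \<psi>) \<in> extensional (Hor (W n))"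
    "DVer (glued_functor n \<psi>) \<in> extensional (Ver (W n))" "DSq (glued_functor n \<psi>) \<in> extensional (Sq (W n))"
    by (simp_all add: glued_functor_def)
  show ?thesis
    using ext ob aug hor ver sq conjI[OF hcomp vcomp] conjI[OF sq_hcomp sq_vcomp] by (rule DHom_W_I)
qed

end

section \<open>The unit of the adjunction at the Waldhausen construction\<close>

text \<open>The transpose of the identity under the adjunction, read through \<open>nerve_ob_eq_precomp_wald\<close>.\<close>

definition unit_wald :: "('o, 'h, 'v, 's) dcat \<Rightarrow> nat \<Rightarrow> ('o, 'h, 'v, 's) wfun \<Rightarrow> sigma_ob \<Rightarrow> dmap \<Rightarrow> ('o, 'h, 'v, 's) wfun" where
  "unit_wald D = ran_transpose Sigma_cat Delta p_fctr (wald_ob D) (nid Sigma_cat (nerve_ob D))"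

lemma presheaf_nerve_ob: "presheaf Sigma_cat (nerve_ob D)"
  unfolding nerve_ob_eq_precomp_wald
  by (rule precomp_presheaf[OF category_Sigma_cat is_functor_p_fctr presheaf_wald_ob])

lemma nid_nerve_NatTrans:
  "nid Sigma_cat (nerve_ob D) \<in> NatTrans Sigma_cat (precomp_ob p_fctr (wald_ob D)) (nerve_ob D)"
  using nid_NatTrans[OF category_Sigma_cat presheaf_nerve_ob, of D]
  by (simp flip: nerve_ob_eq_precomp_wald)

lemma unit_wald_NatTrans:
  "unit_wald D \<in> NatTrans Delta (wald_ob D) (ran_ob Sigma_cat Delta p_fctr (nerve_ob D))"
  unfolding unit_wald_def
  by (rule ran_transpose_NatTrans[OF category_Sigma_cat category_Delta is_functor_p_fctr
        presheaf_wald_ob nid_nerve_NatTrans])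

lemma unit_wald_mem:
  assumes "F \<in> DHom (W n) D"
  shows "unit_wald D n F \<in> NatTrans Sigma_cat (precomp_ob p_fctr (yoneda Delta n)) (nerve_ob D)"
  using NatTrans_mem[OF unit_wald_NatTrans, of n F D] assms by (simp add: wald_ob_def At_ran)

lemma unit_wald_apply:
  assumes F: "F \<in> DHom (W n) D" and h: "h \<in> Arr Delta" "Dom Delta h = p_ob s" "Cod Delta h = n"
  shows "unit_wald D n F s h = dcomp (W (p_ob s)) F (Wmap h)"
proof -
  have "dcomp (W (p_ob s)) F (Wmap h) \<in> DHom (W (p_ob s)) D"
    using dcomp_DHom[OF aug_stable_dcat_W Wmap_DHom[OF h(1)]] F h by auto
  then show ?thesis using F h
    by (simp add: unit_wald_def ran_transpose_apply Sigma_cat_def p_fctr_def wald_ob_def nid_def nerve_ob_def)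
qed

text \<open>The inverse is given by \<open>glued_functor\<close>. Recovering a double functor from its restrictions is a direct
  evaluation; recovering a family from the assembled functor rests on rigidity, because off the
  cut the two are not comparable by naturality.\<close>

lemma unit_wald_bij:
  assumes D: "aug_stable_dcat D"
  shows "bij_betw (unit_wald D n) (At (wald_ob D) n) (At (ran_ob Sigma_cat Delta p_fctr (nerve_ob D)) n)"
proof (rule bij_betw_byWitness[where f' = "glued_functor n"])
  have st: "stable D" and au: "augmented D" using D by (auto simp: aug_stable_dcat_def)
  show "unit_wald D n ` At (wald_ob D) n \<subseteq> At (ran_ob Sigma_cat Delta p_fctr (nerve_ob D)) n"
    using unit_wald_mem by (auto simp: At_ran wald_ob_def)
  show "glued_functor n ` At (ran_ob Sigma_cat Delta p_fctr (nerve_ob D)) n \<subseteq> At (wald_ob D) n"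
    using glued_functor_DHom by (auto simp: At_ran wald_ob_def)
  show "\<forall>F\<in>At (wald_ob D) n. glued_functor n (unit_wald D n F) = F"
  proof
    fix F assume "F \<in> At (wald_ob D) n"
    then have F: "F \<in> DHom (W n) D" by (simp add: wald_ob_def)
    note \<psi> = unit_wald_mem[OF F]
    have T_verts: "unit_wald D n F s (verts l n) = dcomp (W (p_ob s)) F (Wmap (verts l n))"
      if "sorted l" "set l \<subseteq> {..n}" "length l = Suc (p_ob s)" for l s
      using that by (intro unit_wald_apply F verts_Arr) auto
    show "glued_functor n (unit_wald D n F) = F"
      by (rule DHom_eqI[OF glued_functor_DHom[OF \<psi>] F])
         (auto simp: glued_functor_def T_verts dcomp_apply Wmap_verts_apply eval_nat_numeral)
  qed
  show "\<forall>\<psi>\<in>At (ran_ob Sigma_cat Delta p_fctr (nerve_ob D)) n. unit_wald D n (glued_functor n \<psi>) = \<psi>"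
  proof
    fix \<psi> assume "\<psi> \<in> At (ran_ob Sigma_cat Delta p_fctr (nerve_ob D)) n"
    then have \<psi>: "\<psi> \<in> NatTrans Sigma_cat (precomp_ob p_fctr (yoneda Delta n)) (nerve_ob D)"
      by (simp add: At_ran)
    note G = glued_functor_DHom[OF \<psi>]
    show "unit_wald D n (glued_functor n \<psi>) = \<psi>"
    proof (rule NatTrans_eqI[OF unit_wald_mem[OF G] \<psi>])
      fix s h assume "h \<in> At (precomp_ob p_fctr (yoneda Delta n)) s"
      then have h: "h \<in> Arr Delta" "Dom Delta h = p_ob s" "Cod Delta h = n" by (auto simp: p_fctr_def)
      obtain l where l: "h = verts l n" "length l = Suc (p_ob s)" "sorted l" "set l \<subseteq> {..n}"
        by (rule verts_exists[OF h(1), unfolded h(2,3)]) (rule that)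
      have L: "dcomp (W (p_ob s)) (glued_functor n \<psi>) (Wmap h) \<in> DHom (W (p_ob s)) D"
        using dcomp_DHom[OF aug_stable_dcat_W Wmap_DHom[OF h(1)]] G h by auto
      have R: "\<psi> s h \<in> DHom (W (p_ob s)) D"
        using family_mem[OF \<psi>, of l s] l by (cases l) auto
      have "dcomp (W (p_ob s)) (glued_functor n \<psi>) (Wmap h) = \<psi> s h"
      proof (cases s)
        \<comment> \<open>Over \<open>[-1]\<close> there is no cut; but a double functor out of \<open>W 0\<close> is determined by its only object.\<close>
        case Minus1
        then obtain i where i: "l = [i]" using l(2) by (cases l) auto
        have "DOb (glued_functor n \<psi>) (i, i) = DOb (\<psi> (SPair 0 0) (verts [i, i] n)) (0, 1)"
          using glued_functor_eq_family(1)[OF \<psi>, of "[i, i]" 0 0 0 1] l i by simp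
        moreover have "\<psi> (SPair 0 0) (verts [i, i] n) = dcomp (W 1) (\<psi> Minus1 (verts [i] n)) (Wmap (verts [0, 0] 0))"
          using family_const[OF \<psi>, of i] l i by simp
        ultimately have "DOb (glued_functor n \<psi>) (i, i) = DOb (\<psi> s h) (0, 0)"
          using Minus1 i l by (simp add: dcomp_apply Wmap_verts_apply)
        then show ?thesis using Minus1 i l
          by (intro W_functor_eq_if_fan_eq[OF st au L R])
             (simp_all add: dcomp_apply Wmap_verts_apply)
      next
        case (SPair q r)
        have len: "length l = q + r + 2" using l(2) SPair by simp
        note eq = glued_functor_eq_family[OF \<psi> l(3,4) len]
        show ?thesis
          by (rule W_functor_eq_if_cut_eq[OF st au L R, of q])
             (simp_all add: SPair l(1) dcomp_apply Wmap_verts_apply eq len)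
      qed
      then show "unit_wald D n (glued_functor n \<psi>) s h = \<psi> s h" using unit_wald_apply[OF G h] by simp
    qed
  qed
qed

lemma wald_iso_p_lower_nerve: "naturally_isomorphic DCat Delta (J \<circ>\<^sub>F \<sigma>) (p\<^sub>* \<circ>\<^sub>F N\<^sup>a)"
proof (rule naturally_isomorphicI[OF category_Delta is_functor_wald
      is_functor_fcomp[OF is_functor_nerve is_functor_p_lower], where \<eta> = unit_wald])
  fix D :: "('o, 'h, 'v, 's) dcat" assume D: "D \<in> Obj DCat"
  have ob: "FOb (J \<circ>\<^sub>F \<sigma>) D = wald_ob D" "FOb (p\<^sub>* \<circ>\<^sub>F N\<^sup>a) D = ran_ob Sigma_cat Delta p_fctr (nerve_ob D)"
    by (simp_all add: J_def wald_fctr_def p_lower_def nerve_fctr_def)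
  show "unit_wald D \<in> NatTrans Delta (FOb (J \<circ>\<^sub>F \<sigma>) D) (FOb (p\<^sub>* \<circ>\<^sub>F N\<^sup>a) D)"
    unfolding ob by (rule unit_wald_NatTrans)
  show "bij_betw (unit_wald D n) (At (FOb (J \<circ>\<^sub>F \<sigma>) D) n) (At (FOb (p\<^sub>* \<circ>\<^sub>F N\<^sup>a) D) n)" for n
    unfolding ob using D by (intro unit_wald_bij) (simp add: DCat_def)
next
  fix f :: "('o, 'h, 'v, 's) dmor" and n F
  assume f: "f \<in> Arr DCat" and F0: "F \<in> At (FOb (J \<circ>\<^sub>F \<sigma>) (Dom DCat f)) n"
  obtain D G E where fD: "f = (D, G, E)" by (cases f)
  have G: "G \<in> DHom D E" using f by (simp add: fD DCat_def)
  have F: "F \<in> DHom (W n) D" using F0 by (simp add: fD DCat_def J_def wald_fctr_def wald_ob_def)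
  have GF: "dcomp (W n) G F \<in> DHom (W n) E" by (rule dcomp_DHom[OF aug_stable_dcat_W F G])
  have nat: "nerve_nat D G \<in> NatTrans Sigma_cat (nerve_ob D) (nerve_ob E)"
    unfolding nerve_nat_eq_precomp_wald nerve_ob_eq_precomp_wald
    by (rule precomp_nat_NatTrans[OF category_Sigma_cat is_functor_p_fctr wald_nat_NatTrans[OF G]])
  have pre: "presheaf Sigma_cat (precomp_ob p_fctr (yoneda Delta n))"
    by (intro precomp_presheaf[OF category_Sigma_cat is_functor_p_fctr] yoneda_presheaf category_Delta)
  have "unit_wald E n (dcomp (W n) G F) =
      ncomp Sigma_cat (precomp_ob p_fctr (yoneda Delta n)) (nerve_nat D G) (unit_wald D n F)"
  proof (rule NatTrans_eqI[OF unit_wald_mem[OF GF] ncomp_NatTrans[OF category_Sigma_cat pre unit_wald_mem[OF F] nat]])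
    fix s h assume "h \<in> At (precomp_ob p_fctr (yoneda Delta n)) s"
    then have h: "h \<in> Arr Delta" "Dom Delta h = p_ob s" "Cod Delta h = n" by (auto simp: p_fctr_def)
    have Wh: "Wmap h \<in> DHom (W (p_ob s)) (W n)" using Wmap_DHom[OF h(1)] h by simp
    have "nerve_nat D G s (dcomp (W (p_ob s)) F (Wmap h)) = dcomp (W (p_ob s)) G (dcomp (W (p_ob s)) F (Wmap h))"
      using dcomp_DHom[OF aug_stable_dcat_W Wh F] by (simp add: nerve_nat_def)
    then show "unit_wald E n (dcomp (W n) G F) s h =
        ncomp Sigma_cat (precomp_ob p_fctr (yoneda Delta n)) (nerve_nat D G) (unit_wald D n F) s h"
      using h dcomp_assoc[OF Wh, of G F]
      by (simp add: ncomp_def unit_wald_apply[OF GF h] unit_wald_apply[OF F h] Sigma_cat_def p_fctr_def)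
  qed
  moreover have "unit_wald D n F \<in> At (ran_ob Sigma_cat Delta p_fctr (nerve_ob D)) n"
    using unit_wald_mem[OF F] by (simp add: At_ran)
  ultimately show "unit_wald (Cod DCat f) n (under (FAr (J \<circ>\<^sub>F \<sigma>) f) n F) =
      under (FAr (p\<^sub>* \<circ>\<^sub>F N\<^sup>a) f) n (unit_wald (Dom DCat f) n F)"
    using F by (simp add: fD DCat_def J_def wald_fctr_def p_lower_def nerve_fctr_def wald_nat_def ran_nat_def under_def)
qed

section \<open>Gluing simplices along fan triangulations\<close>

lemma Act_verts_mem:
  assumes "presheaf Delta X" "x \<in> At X n" "length l = Suc m" "sorted l" "set l \<subseteq> {..n}"
  shows "Act X (verts l n) x \<in> At X m"
  using presheaf_simps(1)[OF assms(1) verts_Arr[of l n], of x] assms by (cases l) auto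

lemma Act_verts_verts:
  assumes "presheaf Delta X" "x \<in> At X n" "length l = Suc m" "sorted l" "set l \<subseteq> {..n}"
    and "k \<noteq> []" "sorted k" "set k \<subseteq> {..m}"
  shows "Act X (verts k m) (Act X (verts l n) x) = Act X (verts (map ((!) l) k) n) x"
proof -
  have "Comp Delta (verts l n) (verts k m) = verts (map ((!) l) k) n"
    using assms by (intro Comp_verts_verts) auto
  moreover have "verts l n \<in> Arr Delta" using assms by (intro verts_Arr) auto
  moreover have "verts k m \<in> Arr Delta" using assms by (intro verts_Arr) auto
  ultimately show ?thesis
    using presheaf_simps(3)[OF assms(1), of "verts l n" "verts k m" x] assms(2,3) by simp
qed

lemma Act_verts_id:
  assumes "presheaf Delta X" "x \<in> At X n" "l = [0..<Suc n]"
  shows "Act X (verts l n) x = x"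
  using presheaf_simps(2)[OF assms(1) _ assms(2)] unfolding assms(3) Ide_Delta_verts by simp

text \<open>The factorisation of a map with image in a triangle \<open>{a, b, c}\<close> through the map \<open>[2] \<rightarrow> [n]\<close> with
  these vertices. The third vertex does not occur: every value other than \<open>a\<close> and \<open>b\<close> goes to \<open>2\<close>.\<close>

definition triangle_coord :: "nat \<Rightarrow> nat \<Rightarrow> dmap \<Rightarrow> dmap" where
  "triangle_coord a b f = (Dom Delta f,
     \<lambda>i\<in>{..Dom Delta f}. if under f i = a then 0 else if under f i = b then 1 else 2, 2)"

lemma under_simp [simp]: "under (m, \<alpha>, n) = \<alpha>"
  by (simp add: under_def)

lemma triangle_coord_Arr:
  assumes f: "f \<in> Arr Delta" and abc: "a < b" "b < c" and im: "under f ` {..Dom Delta f} \<subseteq> {a, b, c}"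
  shows "triangle_coord a b f \<in> Arr Delta"
proof -
  obtain m \<alpha> n where f': "f = (m, \<alpha>, n)" "\<And>i j. i \<le> j \<Longrightarrow> j \<le> m \<Longrightarrow> \<alpha> i \<le> \<alpha> j"
    using f by (rule Delta_arrE) (rule that)
  have "\<alpha> i = a \<or> \<alpha> i = b \<or> \<alpha> i = c" if "i \<le> m" for i
    using im that unfolding f' by auto
  moreover define r where "r x = (if x = a then 0 else if x = b then 1 else (2 :: nat))" for x
  ultimately have "r (\<alpha> i) \<le> r (\<alpha> j)" if "i \<le> j" "j \<le> m" for i j
    using f'(2)[OF that] that abc by (smt (verit) le_trans linorder_not_le nat_less_le one_le_numeral zero_le)
  moreover have "r x \<le> 2" for x by (simp add: r_def)
  moreover have "triangle_coord a b f = (m, \<lambda>i\<in>{..m}. r (\<alpha> i), 2)" unfolding f' triangle_coord_def r_def by auto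
  ultimately show ?thesis by (auto simp: Delta_def mono_on_def)
qed

lemma Comp_triangle_coord:
  assumes f: "f \<in> Arr Delta" "Cod Delta f = n"
    and abc: "a < b" "b < c" and im: "under f ` {..Dom Delta f} \<subseteq> {a, b, c}"
  shows "Comp Delta (verts [a, b, c] n) (triangle_coord a b f) = f"
proof -
  obtain m \<alpha> where f': "f = (m, \<alpha>, n)" and ext: "\<alpha> \<in> extensional {..m}"
    using f(1) by (rule Delta_arrE) (rule that, use f(2) in simp_all)
  have "\<alpha> i = a \<or> \<alpha> i = b \<or> \<alpha> i = c" if "i \<le> m" for i
    using im that unfolding f' by auto
  then show ?thesis
    using ext abc unfolding f' triangle_coord_def verts_def
    by (fastforce simp: compose_def fun_eq_iff extensional_def)
qed

lemma triangle_coord_Comp: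
  assumes "f \<in> Arr Delta" "g \<in> Arr Delta" "Dom Delta f = Cod Delta g"
  shows "triangle_coord a b (Comp Delta f g) = Comp Delta (triangle_coord a b f) g"
proof -
  obtain m \<alpha> n where g: "g = (m, \<alpha>, n)" "\<And>i. i \<le> m \<Longrightarrow> \<alpha> i \<le> n"
    using assms(2) by (rule Delta_arrE) (rule that)
  moreover obtain \<beta> k where "f = (n, \<beta>, k)" using assms(3) g by (cases f) auto
  ultimately show ?thesis
    by (auto simp: triangle_coord_def compose_def fun_eq_iff)
qed

lemma triangle_coord_self: "a < b \<Longrightarrow> b < c \<Longrightarrow> triangle_coord a b (verts [a, b, c] n) = Ide Delta 2"
  by (auto simp: triangle_coord_def verts_def Delta_def fun_eq_iff le_Suc_eq numeral_2_eq_2)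

lemma At_DeltaT: "f \<in> At (DeltaT n E) k \<longleftrightarrow> f \<in> Arr Delta \<and> Dom Delta f = k \<and> Cod Delta f = n \<and>
    (\<exists>t\<in>triangles E. under f ` {..k} \<subseteq> t)"
  and Act_DeltaT: "Act (DeltaT n E) g f = Comp Delta f g"
  by (auto simp: DeltaT_def yoneda_def)

lemma under_Comp_image:
  assumes "f \<in> Arr Delta" "g \<in> Arr Delta" "Dom Delta f = Cod Delta g"
  shows "under (Comp Delta f g) ` {..Dom Delta g} \<subseteq> under f ` {..Dom Delta f}"
proof -
  obtain m \<alpha> n where g: "g = (m, \<alpha>, n)" "\<And>i. i \<le> m \<Longrightarrow> \<alpha> i \<le> n"
    using assms(2) by (rule Delta_arrE) (rule that)
  moreover obtain \<beta> k where "f = (n, \<beta>, k)" using assms(3) g by (cases f) auto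
  ultimately show ?thesis by (auto simp: compose_def)
qed

text \<open>A map out of \<open>\<Delta>[T]\<close> is constructed by choosing, for each simplex of \<open>\<Delta>[T]\<close>, a triangle that
  contains it. Independence of the choice reduces to consecutive triangles if the triangles are listed
  such that a simplex in two of them lies in all triangles in between; in a fan this holds since
  non-consecutive triangles meet in the apex only.\<close>

lemma two_segal_glue:
  fixes a b c :: "nat \<Rightarrow> nat" and t :: "nat \<Rightarrow> 'a"
  assumes X: "presheaf Delta X" and seg: "two_segal X" and n: "n \<ge> 3" and E: "triangulation n E"
    and tri: "triangles E = (\<lambda>i. {a i, b i, c i}) ` {lo..<hi}"
    and abc: "\<And>i. i \<in> {lo..<hi} \<Longrightarrow> a i < b i \<and> b i < c i \<and> c i \<le> n"
    and convex: "\<And>i m j. lo \<le> i \<Longrightarrow> i \<le> m \<Longrightarrow> m \<le> j \<Longrightarrow> j < hi \<Longrightarrow>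
      {a i, b i, c i} \<inter> {a j, b j, c j} \<subseteq> {a m, b m, c m}"
    and t: "\<And>i. i \<in> {lo..<hi} \<Longrightarrow> t i \<in> At X 2"
    and step: "\<And>i f. lo \<le> i \<Longrightarrow> Suc i < hi \<Longrightarrow> f \<in> Arr Delta \<Longrightarrow> Cod Delta f = n \<Longrightarrow>
      under f ` {..Dom Delta f} \<subseteq> {a i, b i, c i} \<Longrightarrow>
      under f ` {..Dom Delta f} \<subseteq> {a (Suc i), b (Suc i), c (Suc i)} \<Longrightarrow>
      Act X (triangle_coord (a i) (b i) f) (t i) = Act X (triangle_coord (a (Suc i)) (b (Suc i)) f) (t (Suc i))"
  shows "\<exists>!x. x \<in> At X n \<and> (\<forall>i\<in>{lo..<hi}. Act X (verts [a i, b i, c i] n) x = t i)"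
proof -
  let ?T = "\<lambda>i. {a i, b i, c i}"
  define val where "val = (\<lambda>f i. Act X (triangle_coord (a i) (b i) f) (t i))"
  have le: "val f i = val f j" if ij: "lo \<le> i" "i \<le> j" "j < hi"
    and f: "f \<in> Arr Delta" "Cod Delta f = n" and im: "under f ` {..Dom Delta f} \<subseteq> ?T i" "under f ` {..Dom Delta f} \<subseteq> ?T j"
    for i j f
  proof -
    have im: "under f ` {..Dom Delta f} \<subseteq> ?T m" if "i \<le> m" "m \<le> j" for m
      using convex[OF ij(1) that ij(3)] im by blast
    have "m \<le> j \<Longrightarrow> val f i = val f m" if "i \<le> m" for m
      using that
    proof (induction m rule: dec_induct)
      case (step m)
      then show ?case
        using \<open>lo \<le> i\<close> \<open>j < hi\<close> assms(9)[of m f] f im[of m] im[of "Suc m"] unfolding val_def by simp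
    qed simp
    then show ?thesis using ij by blast
  qed
  \<comment> \<open>The value at \<open>f\<close> does not depend on the chosen triangle \<open>i\<close>.\<close>
  have indep: "val f i = val f j" if "i \<in> {lo..<hi}" "j \<in> {lo..<hi}"
    and "f \<in> Arr Delta" "Cod Delta f = n" "under f ` {..Dom Delta f} \<subseteq> ?T i" "under f ` {..Dom Delta f} \<subseteq> ?T j"
    for i j f
  proof (cases "i \<le> j")
    case True
    then show ?thesis using le[of i j f] that by simp
  next
    case False
    then show ?thesis using le[of j i f] that by simp
  qed
  define ix where "ix = (\<lambda>f. SOME i. i \<in> {lo..<hi} \<and> under f ` {..Dom Delta f} \<subseteq> ?T i)"
  have ix: "ix f \<in> {lo..<hi} \<and> under f ` {..Dom Delta f} \<subseteq> ?T (ix f)" if "f \<in> At (DeltaT n E) k" for f k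
  proof -
    have "\<exists>i. i \<in> {lo..<hi} \<and> under f ` {..Dom Delta f} \<subseteq> ?T i"
      using that unfolding At_DeltaT tri by auto
    then show ?thesis unfolding ix_def by (rule someI_ex)
  qed
  define \<theta> where "\<theta> = (\<lambda>k\<in>Obj Delta. \<lambda>f\<in>At (DeltaT n E) k. val f (ix f))"
  have \<theta>_eq: "\<theta> k f = val f i"
    if f: "f \<in> At (DeltaT n E) k" and i: "i \<in> {lo..<hi}" "under f ` {..k} \<subseteq> ?T i" for f k i
  proof -
    have "val f (ix f) = val f i"
      using ix[OF f] f i by (intro indep) (auto simp: At_DeltaT)
    then show ?thesis using f by (simp add: \<theta>_def)
  qed
  have val_mem: "val f i \<in> At X (Dom Delta f)"
    if "i \<in> {lo..<hi}" "f \<in> Arr Delta" "under f ` {..Dom Delta f} \<subseteq> ?T i" for f i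
  proof -
    have "triangle_coord (a i) (b i) f \<in> Arr Delta"
      using triangle_coord_Arr[of f "a i" "b i" "c i"] abc[OF that(1)] that by blast
    then show ?thesis
      using presheaf_simps(1)[OF X, of "triangle_coord (a i) (b i) f" "t i"] t[OF that(1)]
      by (simp add: val_def triangle_coord_def)
  qed
  have \<theta>: "\<theta> \<in> NatTrans Delta (DeltaT n E) X"
  proof (rule NatTransI)
    fix k :: nat
    show "\<theta> k \<in> At (DeltaT n E) k \<rightarrow>\<^sub>E At X k"
    proof (rule PiE_I)
      fix f assume f: "f \<in> At (DeltaT n E) k"
      then show "\<theta> k f \<in> At X k"
        using \<theta>_eq[OF f, of "ix f"] ix[OF f] val_mem[of "ix f" f] unfolding At_DeltaT by auto
    qed (simp add: \<theta>_def)
  next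
    fix g f assume g: "g \<in> Arr Delta" and f: "f \<in> At (DeltaT n E) (Cod Delta g)"
    let ?i = "ix f"
    note i = ix[OF f]
    have f': "f \<in> Arr Delta" "Dom Delta f = Cod Delta g" "Cod Delta f = n" using f by (auto simp: At_DeltaT)
    have fg: "Comp Delta f g \<in> Arr Delta" "Dom Delta (Comp Delta f g) = Dom Delta g" "Cod Delta (Comp Delta f g) = n"
      using category_simps[OF category_Delta] f' g by auto
    have im: "under (Comp Delta f g) ` {..Dom Delta g} \<subseteq> ?T ?i"
      using under_Comp_image[OF f'(1) g f'(2)] i by blast
    then have "Comp Delta f g \<in> At (DeltaT n E) (Dom Delta g)"
      using fg i unfolding At_DeltaT tri by blast
    then have "\<theta> (Dom Delta g) (Comp Delta f g) = val (Comp Delta f g) ?i"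
      using \<theta>_eq i im by blast
    also have "\<dots> = Act X g (val f ?i)"
    proof -
      have "triangle_coord (a ?i) (b ?i) f \<in> Arr Delta"
        using triangle_coord_Arr[of f "a ?i" "b ?i" "c ?i"] abc[of ?i] i f' by blast
      then show ?thesis
        unfolding val_def triangle_coord_Comp[OF f'(1) g f'(2)]
        using presheaf_simps(3)[OF X, of "triangle_coord (a ?i) (b ?i) f" g "t ?i"] g f'(2) t i
        by (simp add: triangle_coord_def)
    qed
    also have "val f ?i = \<theta> (Cod Delta g) f"
      using \<theta>_eq[OF f, of ?i] i f' by simp
    finally show "\<theta> (Dom Delta g) (Act (DeltaT n E) g f) = Act X g (\<theta> (Cod Delta g) f)"
      by (simp add: Act_DeltaT)
  qed (simp add: \<theta>_def)
  have bij: "bij_betw (segal_map n E X) (At X n) (NatTrans Delta (DeltaT n E) X)"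
    using seg n E unfolding two_segal_def by blast
  have tri_mem: "verts [a i, b i, c i] n \<in> At (DeltaT n E) 2" if "i \<in> {lo..<hi}" for i
  proof -
    have "under (verts [a i, b i, c i] n) ` {..2} \<subseteq> ?T i"
      by (auto simp: verts_def le_Suc_eq numeral_2_eq_2)
    then have "\<exists>t\<in>triangles E. under (verts [a i, b i, c i] n) ` {..2} \<subseteq> t"
      using that unfolding tri by blast
    then show ?thesis
      using verts_Arr[of "[a i, b i, c i]" n] abc[OF that] unfolding At_DeltaT by simp
  qed
  show ?thesis
  proof (rule ex_ex1I)
    obtain x where x: "x \<in> At X n" "segal_map n E X x = \<theta>"
      using bij_betw_imp_surj_on[OF bij] \<theta> by (metis imageE)
    have "Act X (verts [a i, b i, c i] n) x = t i" if i: "i \<in> {lo..<hi}" for i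
    proof -
      have "Act X (verts [a i, b i, c i] n) x = \<theta> 2 (verts [a i, b i, c i] n)"
        using tri_mem[OF i] unfolding x(2)[symmetric] segal_map_def by simp
      also have "\<dots> = val (verts [a i, b i, c i] n) i"
        using i by (intro \<theta>_eq tri_mem) (auto simp: verts_def le_Suc_eq numeral_2_eq_2)
      also have "\<dots> = t i"
        using abc[OF i] presheaf_simps(2)[OF X _ t[OF i]] by (simp add: val_def triangle_coord_self)
      finally show ?thesis .
    qed
    with x(1) show "\<exists>x. x \<in> At X n \<and> (\<forall>i\<in>{lo..<hi}. Act X (verts [a i, b i, c i] n) x = t i)" by blast
  next
    fix x y assume x: "x \<in> At X n \<and> (\<forall>i\<in>{lo..<hi}. Act X (verts [a i, b i, c i] n) x = t i)"
      and y: "y \<in> At X n \<and> (\<forall>i\<in>{lo..<hi}. Act X (verts [a i, b i, c i] n) y = t i)"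
    have eq: "Act X f z = val f (ix f)"
      if z: "z \<in> At X n \<and> (\<forall>i\<in>{lo..<hi}. Act X (verts [a i, b i, c i] n) z = t i)"
        and f: "f \<in> At (DeltaT n E) k" for z f k
    proof -
      let ?i = "ix f"
      note i = ix[OF f]
      have f': "f \<in> Arr Delta" "Cod Delta f = n" using f by (auto simp: At_DeltaT)
      have "Comp Delta (verts [a ?i, b ?i, c ?i] n) (triangle_coord (a ?i) (b ?i) f) = f"
        using Comp_triangle_coord[OF f', of "a ?i" "b ?i" "c ?i"] abc[of ?i] i by blast
      moreover have "triangle_coord (a ?i) (b ?i) f \<in> Arr Delta"
        using triangle_coord_Arr[of f "a ?i" "b ?i" "c ?i"] abc[of ?i] i f' by blast
      moreover have "verts [a ?i, b ?i, c ?i] n \<in> Arr Delta"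
        using verts_Arr[of "[a ?i, b ?i, c ?i]" n] abc[of ?i] i by auto
      ultimately show ?thesis
        using presheaf_simps(3)[OF X, of "verts [a ?i, b ?i, c ?i] n" "triangle_coord (a ?i) (b ?i) f" z] z i
        by (simp add: val_def triangle_coord_def)
    qed
    have "segal_map n E X x = segal_map n E X y"
      unfolding segal_map_def using eq[OF x] eq[OF y] by (auto simp: fun_eq_iff)
    then show "x = y" using inj_onD[OF bij_betw_imp_inj_on[OF bij]] x y by blast
  qed
qed

text \<open>The two triangulations in which all diagonals share the first, respectively the last, vertex.\<close>

definition fan_first :: "nat \<Rightarrow> (nat \<times> nat) set" where
  "fan_first n = {(a, b). a < b \<and> b \<le> n \<and> (a = 0 \<or> b = Suc a)}"

definition fan_last :: "nat \<Rightarrow> (nat \<times> nat) set" where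
  "fan_last n = {(a, b). a < b \<and> b \<le> n \<and> (b = n \<or> b = Suc a)}"

text \<open>A chord \<open>(a, b)\<close> that is neither a side nor at the apex separates \<open>a + 1\<close> from the apex \<open>0\<close>, hence it
  crosses the diagonal between these two.\<close>

lemma triangulation_fan_first: "triangulation n (fan_first n)"
proof -
  have "\<exists>e\<in>fan_first n. crossing (a, b) e" if "(a, b) \<in> chords n - fan_first n" for a b
    using that by (intro bexI[of _ "(0, Suc a)"]) (auto simp: fan_first_def chords_def crossing_def)
  then have "\<forall>e\<in>chords n - fan_first n. \<exists>e'\<in>fan_first n. crossing e e'" by fast
  moreover have "fan_first n \<subseteq> chords n" "\<forall>e\<in>fan_first n. \<forall>e'\<in>fan_first n. \<not> crossing e e'"
    by (auto simp: fan_first_def chords_def crossing_def)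
  ultimately show ?thesis unfolding triangulation_def by blast
qed

text \<open>As before, with the diagonal from \<open>b - 1\<close> to the apex \<open>n\<close>.\<close>

lemma triangulation_fan_last: "triangulation n (fan_last n)"
proof -
  have "\<exists>e\<in>fan_last n. crossing (a, b) e" if "(a, b) \<in> chords n - fan_last n" for a b
    using that by (intro bexI[of _ "(b - 1, n)"]) (auto simp: fan_last_def chords_def crossing_def)
  then have "\<forall>e\<in>chords n - fan_last n. \<exists>e'\<in>fan_last n. crossing e e'" by fast
  moreover have "fan_last n \<subseteq> chords n" "\<forall>e\<in>fan_last n. \<forall>e'\<in>fan_last n. \<not> crossing e e'"
    by (auto simp: fan_last_def chords_def crossing_def)
  ultimately show ?thesis unfolding triangulation_def by blast
qed

lemma triangles_fan_first: "triangles (fan_first n) = (\<lambda>i. {0, i, Suc i}) ` {1..<n}"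
  by (fastforce simp: triangles_def fan_first_def)

lemma triangles_fan_last: "triangles (fan_last n) = (\<lambda>i. {i, Suc i, n}) ` {0..<n - 1}"
  by (fastforce simp: triangles_def fan_last_def)

definition edge_coord :: "nat \<Rightarrow> dmap \<Rightarrow> dmap" where
  "edge_coord a f = (Dom Delta f, \<lambda>i\<in>{..Dom Delta f}. if under f i = a then 0 else 1, 1)"

lemma edge_coord_Arr:
  assumes f: "f \<in> Arr Delta" and im: "under f ` {..Dom Delta f} \<subseteq> {a, b}" "a < b"
  shows "edge_coord a f \<in> Arr Delta"
proof -
  obtain m \<alpha> n where f': "f = (m, \<alpha>, n)" "\<And>i j. i \<le> j \<Longrightarrow> j \<le> m \<Longrightarrow> \<alpha> i \<le> \<alpha> j"
    using f by (rule Delta_arrE) (rule that)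
  have "\<alpha> i = a \<or> \<alpha> i = b" if "i \<le> m" for i
    using im that unfolding f' by auto
  moreover define r where "r x = (if x = a then 0 else (1 :: nat))" for x
  ultimately have "r (\<alpha> i) \<le> r (\<alpha> j)" if "i \<le> j" "j \<le> m" for i j
    using f'(2)[OF that] that im(2) by (metis le_trans linorder_not_le order_refl zero_le)
  moreover have "r x \<le> 1" for x by (simp add: r_def)
  moreover have "edge_coord a f = (m, \<lambda>i\<in>{..m}. r (\<alpha> i), 1)" unfolding f' edge_coord_def r_def by simp
  ultimately show ?thesis by (auto simp: Delta_def mono_on_def)
qed

text \<open>If the image of \<open>f\<close> lies in an edge of a triangle, the value of \<open>f\<close> on the triangle only depends
  on that edge. The vertices of the edge are number \<open>p\<close> and \<open>q\<close> in the triangle, which differ between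
  the two triangles that share it.\<close>

lemma Act_edge_coord:
  assumes X: "presheaf Delta X" and x: "x \<in> At X 2"
    and f: "f \<in> Arr Delta" and im: "under f ` {..Dom Delta f} \<subseteq> {a, b}" "a < b" and pq: "p \<le> q" "q \<le> 2"
  shows "Act X (Dom Delta f, \<lambda>i\<in>{..Dom Delta f}. if under f i = a then p else q, 2) x =
    Act X (edge_coord a f) (Act X (verts [p, q] 2) x)"
proof -
  have "Comp Delta (verts [p, q] 2) (edge_coord a f) = (Dom Delta f, \<lambda>i\<in>{..Dom Delta f}. if under f i = a then p else q, 2)"
    by (auto simp: verts_def edge_coord_def compose_def fun_eq_iff)
  then show ?thesis
    using presheaf_simps(3)[OF X verts_Arr[of "[p, q]" 2] edge_coord_Arr[OF f im], of x] x pq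
    by (simp add: edge_coord_def)
qed

text \<open>Consecutive triangles of the fan share the diagonal from \<open>0\<close> to \<open>i + 1\<close>, and all others meet in \<open>0\<close> only;
  matching on these diagonals therefore makes the data a map out of the union of the triangles.\<close>

lemma two_segal_fan_first:
  assumes X: "presheaf Delta X" and seg: "two_segal X" and n: "n \<ge> 2"
    and t: "\<And>i. i \<in> {1..<n} \<Longrightarrow> t i \<in> At X 2"
    and match: "\<And>i. 1 \<le> i \<Longrightarrow> Suc i < n \<Longrightarrow> Act X (verts [0, 2] 2) (t i) = Act X (verts [0, 1] 2) (t (Suc i))"
  shows "\<exists>!x. x \<in> At X n \<and> (\<forall>i\<in>{1..<n}. Act X (verts [0, i, Suc i] n) x = t i)"
proof (cases "n = 2")
  case True
  have "Act X (verts [0, 1, 2] 2) x = x" if "x \<in> At X 2" for x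
    using that by (intro Act_verts_id[OF X]) (auto simp: eval_nat_numeral)
  moreover have "{1..<n} = {1}" using True by auto
  ultimately show ?thesis using t[of 1] True by (auto simp: eval_nat_numeral)
next
  case False
  show ?thesis
  proof (rule two_segal_glue[OF X seg _ triangulation_fan_first triangles_fan_first _ _ t])
    fix i f assume i: "1 \<le> i" "Suc i < n" and f: "f \<in> Arr Delta"
      and im: "under f ` {..Dom Delta f} \<subseteq> {0, i, Suc i}" "under f ` {..Dom Delta f} \<subseteq> {0, Suc i, Suc (Suc i)}"
    have im': "under f ` {..Dom Delta f} \<subseteq> {0, Suc i}"
    proof
      fix x assume "x \<in> under f ` {..Dom Delta f}"
      then show "x \<in> {0, Suc i}" using im by fastforce
    qed
    have "triangle_coord 0 i f = (Dom Delta f, \<lambda>i\<in>{..Dom Delta f}. if under f i = 0 then 0 else 2, 2)"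
      "triangle_coord 0 (Suc i) f = (Dom Delta f, \<lambda>i\<in>{..Dom Delta f}. if under f i = 0 then 0 else 1, 2)"
      using im' i by (auto simp: triangle_coord_def fun_eq_iff)
    then show "Act X (triangle_coord 0 i f) (t i) = Act X (triangle_coord 0 (Suc i) f) (t (Suc i))"
      using Act_edge_coord[OF X t[of i] f im', of 0 2] Act_edge_coord[OF X t[of "Suc i"] f im', of 0 1] match[OF i] i by simp
  qed (use n False in auto)
qed

text \<open>The fan for vertical composition, whose fillers are determined by their triangles at the last
  vertex; the shared diagonals run from \<open>i + 1\<close> to \<open>n\<close>.\<close>

lemma two_segal_fan_last:
  assumes X: "presheaf Delta X" and seg: "two_segal X" and n: "n \<ge> 3"
    and t: "\<And>i. i \<in> {0..<n - 1} \<Longrightarrow> t i \<in> At X 2"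
    and match: "\<And>i. Suc i < n - 1 \<Longrightarrow> Act X (verts [1, 2] 2) (t i) = Act X (verts [0, 2] 2) (t (Suc i))"
  shows "\<exists>!x. x \<in> At X n \<and> (\<forall>i\<in>{0..<n - 1}. Act X (verts [i, Suc i, n] n) x = t i)"
proof (rule two_segal_glue[OF X seg n triangulation_fan_last triangles_fan_last _ _ t])
  fix i f assume i: "Suc i < n - 1" and f: "f \<in> Arr Delta"
    and im: "under f ` {..Dom Delta f} \<subseteq> {i, Suc i, n}" "under f ` {..Dom Delta f} \<subseteq> {Suc i, Suc (Suc i), n}"
  have im': "under f ` {..Dom Delta f} \<subseteq> {Suc i, n}"
  proof
    fix x assume "x \<in> under f ` {..Dom Delta f}"
    then show "x \<in> {Suc i, n}" using im i by fastforce
  qed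
  have "under f j = Suc i \<or> under f j = n" if "j \<le> Dom Delta f" for j
    using im' that by auto
  then have "triangle_coord i (Suc i) f = (Dom Delta f, \<lambda>j\<in>{..Dom Delta f}. if under f j = Suc i then 1 else 2, 2)"
    "triangle_coord (Suc i) (Suc (Suc i)) f = (Dom Delta f, \<lambda>j\<in>{..Dom Delta f}. if under f j = Suc i then 0 else 2, 2)"
    using i by (fastforce simp: triangle_coord_def fun_eq_iff)+
  then show "Act X (triangle_coord i (Suc i) f) (t i) = Act X (triangle_coord (Suc i) (Suc (Suc i)) f) (t (Suc i))"
    using Act_edge_coord[OF X t[of i] f im', of 1 2] Act_edge_coord[OF X t[of "Suc i"] f im', of 0 2] match[OF i] i by simp
qed auto

section \<open>Fillers, stability and augmentation of the path construction\<close>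

lemma face_verts:
  assumes "n > 0"
  shows "face X n i = Act X (verts (map (\<lambda>j. if j < i then j else Suc j) [0..<n]) n)"
  unfolding face_def verts_def using assms
  by (intro arg_cong[where f = "Act X"]) (auto simp: fun_eq_iff)

lemma degen_verts: "degen X n i = Act X (verts (map (\<lambda>j. if j \<le> i then j else j - 1) [0..<n + 2]) n)"
  unfolding degen_def verts_def
  by (intro arg_cong[where f = "Act X"]) (auto simp: fun_eq_iff simp del: upt_Suc)

lemma face_eqs:
  "face X 2 0 = Act X (verts [1, 2] 2)" "face X 2 (Suc 0) = Act X (verts [0, 2] 2)" "face X 2 2 = Act X (verts [0, 1] 2)"
  "face X 3 0 = Act X (verts [1, 2, 3] 3)" "face X 3 (Suc 0) = Act X (verts [0, 2, 3] 3)"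
  "face X 3 2 = Act X (verts [0, 1, 3] 3)" "face X 3 3 = Act X (verts [0, 1, 2] 3)"
  "face X 4 0 = Act X (verts [1, 2, 3, 4] 4)" "face X 4 (Suc 0) = Act X (verts [0, 2, 3, 4] 4)"
  "face X 4 2 = Act X (verts [0, 1, 3, 4] 4)" "face X 4 3 = Act X (verts [0, 1, 2, 4] 4)"
  "face X 4 4 = Act X (verts [0, 1, 2, 3] 4)"
  by (simp_all add: face_verts upt_rec eval_nat_numeral)

lemma degen_eqs:
  "degen X 0 0 = Act X (verts [0, 0] 0)"
  "degen X (Suc 0) 0 = Act X (verts [0, 0, 1] 1)" "degen X (Suc 0) (Suc 0) = Act X (verts [0, 1, 1] 1)"
  "degen X 2 0 = Act X (verts [0, 0, 1, 2] 2)" "degen X 2 2 = Act X (verts [0, 1, 2, 2] 2)"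
  by (simp_all add: degen_verts upt_rec eval_nat_numeral)

lemma vertex_edge_eqs: "vertex X n i = Act X (verts [i] n)" "edge X n i = Act X (verts [i, Suc i] n)"
proof -
  have "(0, \<lambda>j\<in>{..0}. i, n) = verts [i] n" "(1, \<lambda>j\<in>{..1}. i + j, n) = verts [i, Suc i] n"
    by (auto simp: verts_def fun_eq_iff le_Suc_eq)
  then show "vertex X n i = Act X (verts [i] n)" "edge X n i = Act X (verts [i, Suc i] n)"
    unfolding vertex_def edge_def by simp_all
qed

lemma bij_betw_if_ex1:
  assumes "\<And>x. x \<in> A \<Longrightarrow> f x \<in> B" "\<And>y. y \<in> B \<Longrightarrow> \<exists>!x. x \<in> A \<and> f x = y"
  shows "bij_betw f A B"
  unfolding bij_betw_def
proof
  show "inj_on f A" by (rule inj_onI) (metis assms)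
  show "f ` A = B" using assms by (auto simp: image_iff) metis
qed

text \<open>The definition of \<open>fill\<close> is a description, so that a uniquely existing simplex with the right
  faces computes it.\<close>

lemma fill_eqI:
  assumes "\<exists>!z. z \<in> At X n \<and> face X n i z = x \<and> face X n j z = y"
    and "z \<in> At X n" "face X n i z = x" "face X n j z = y"
  shows "fill X n i j x y = z"
  unfolding fill_def the_inv_into_def using assms by (intro the1_equality) auto

context
  fixes X :: "'a sset"
  assumes X: "presheaf Delta X" and seg: "two_segal X"
begin

lemmas act_simps = Act_verts_verts[OF X] Act_verts_mem[OF X] face_eqs degen_eqs

text \<open>Uniqueness follows from gluing: \<open>y\<close> itself provides matching data, and \<open>x\<close> is another solution for it.\<close>

lemma fan_first_inj:
  assumes "n \<ge> 2" "x \<in> At X n" "y \<in> At X n"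
    and "\<And>i. 1 \<le> i \<Longrightarrow> i < n \<Longrightarrow> Act X (verts [0, i, Suc i] n) x = Act X (verts [0, i, Suc i] n) y"
  shows "x = y"
proof -
  have "\<exists>!z. z \<in> At X n \<and> (\<forall>i\<in>{1..<n}. Act X (verts [0, i, Suc i] n) z = Act X (verts [0, i, Suc i] n) y)"
    using assms(1,3) by (intro two_segal_fan_first[OF X seg]) (simp_all add: act_simps)
  moreover have "x \<in> At X n \<and> (\<forall>i\<in>{1..<n}. Act X (verts [0, i, Suc i] n) x = Act X (verts [0, i, Suc i] n) y)"
    using assms(2,4) by auto
  ultimately show ?thesis using assms(3) by blast
qed

text \<open>The filler for horizontal composition of arrows. The faces \<open>3\<close> and \<open>1\<close> are the triangles \<open>012\<close> and
  \<open>023\<close> of the fan at \<open>0\<close>.\<close>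

lemma ex1_simplex_faces_3_3_1:
  assumes "f \<in> At X 2" "g \<in> At X 2" "face X 2 1 f = face X 2 2 g"
  shows "\<exists>!z. z \<in> At X 3 \<and> face X 3 3 z = f \<and> face X 3 1 z = g"
proof -
  define t where "t i = (if i = 1 then f else g)" for i :: nat
  have set: "{1..<3} = {1, 2 :: nat}" by auto
  have ex1: "\<exists>!z. z \<in> At X 3 \<and> (\<forall>i\<in>{1..<3}. Act X (verts [0, i, Suc i] 3) z = t i)"
  proof (rule two_segal_fan_first[OF X seg])
    fix i :: nat assume "1 \<le> i" "Suc i < 3"
    then have "i = 1" by simp
    then show "Act X (verts [0, 2] 2) (t i) = Act X (verts [0, 1] 2) (t (Suc i))"
      using assms(3) by (simp add: t_def face_eqs)
  qed (use assms in \<open>auto simp: t_def\<close>)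
  have "(\<forall>i\<in>{1..<3}. Act X (verts [0, i, Suc i] 3) z = t i) \<longleftrightarrow> face X 3 3 z = f \<and> face X 3 1 z = g" for z
    unfolding set unfolding One_nat_def face_eqs t_def by (simp add: eval_nat_numeral)
  with ex1 show ?thesis by simp
qed

text \<open>The filler for vertical composition of arrows. The faces \<open>2\<close> and \<open>0\<close> are the triangles \<open>013\<close> and
  \<open>123\<close> of the fan at the last vertex.\<close>

lemma ex1_simplex_faces_3_2_0:
  assumes "f \<in> At X 2" "g \<in> At X 2" "face X 2 0 f = face X 2 1 g"
  shows "\<exists>!z. z \<in> At X 3 \<and> face X 3 2 z = f \<and> face X 3 0 z = g"
proof -
  define t where "t i = (if i = 0 then f else g)" for i :: nat
  have set: "{0..<3 - 1} = {0, 1 :: nat}" by auto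
  have ex1: "\<exists>!z. z \<in> At X 3 \<and> (\<forall>i\<in>{0..<3 - 1}. Act X (verts [i, Suc i, 3] 3) z = t i)"
  proof (rule two_segal_fan_last[OF X seg])
    fix i :: nat assume "Suc i < 3 - 1"
    then have "i = 0" by simp
    then show "Act X (verts [1, 2] 2) (t i) = Act X (verts [0, 2] 2) (t (Suc i))"
      using assms(3) by (simp add: t_def face_eqs)
  qed (use assms in \<open>auto simp: t_def\<close>)
  have "(\<forall>i\<in>{0..<3 - 1}. Act X (verts [i, Suc i, 3] 3) z = t i) \<longleftrightarrow> face X 3 2 z = f \<and> face X 3 0 z = g" for z
    unfolding set unfolding One_nat_def face_eqs t_def by (simp add: eval_nat_numeral)
  with ex1 show ?thesis by simp
qed

lemma eq_3_by_fan_first: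
  assumes "x \<in> At X 3" "y \<in> At X 3"
    and "Act X (verts [0, 1, 2] 3) x = Act X (verts [0, 1, 2] 3) y" "Act X (verts [0, 2, 3] 3) x = Act X (verts [0, 2, 3] 3) y"
  shows "x = y"
proof -
  have "face X 3 3 y \<in> At X 2" "face X 3 1 y \<in> At X 2" "face X 2 1 (face X 3 3 y) = face X 2 2 (face X 3 1 y)"
    using assms(2) by (simp_all add: act_simps)
  moreover have "face X 3 3 x = face X 3 3 y" "face X 3 1 x = face X 3 1 y"
    using assms(3,4) by (simp_all add: face_eqs)
  ultimately show ?thesis using ex1_simplex_faces_3_3_1 assms(1,2) by metis
qed

lemma eq_3_by_fan_last:
  assumes "x \<in> At X 3" "y \<in> At X 3"
    and "Act X (verts [0, 1, 3] 3) x = Act X (verts [0, 1, 3] 3) y" "Act X (verts [1, 2, 3] 3) x = Act X (verts [1, 2, 3] 3) y"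
  shows "x = y"
proof -
  have "face X 3 2 y \<in> At X 2" "face X 3 0 y \<in> At X 2" "face X 2 0 (face X 3 2 y) = face X 2 1 (face X 3 0 y)"
    using assms(2) by (simp_all add: act_simps)
  moreover have "face X 3 2 x = face X 3 2 y" "face X 3 0 x = face X 3 0 y"
    using assms(3,4) by (simp_all add: face_eqs)
  ultimately show ?thesis using ex1_simplex_faces_3_2_0 assms(1,2) by metis
qed

text \<open>The filler for horizontal composition of squares. The faces \<open>a\<close> and \<open>b\<close> have the vertices \<open>0, 1, 2, 3\<close> and \<open>0, 1, 3, 4\<close>. Prescribing them amounts to
  prescribing the triangles of the fan at \<open>0\<close>: the triangles \<open>012\<close> and \<open>023\<close> determine \<open>a\<close>, and the
  triangles \<open>013\<close> (shared with \<open>a\<close>) and \<open>034\<close> determine \<open>b\<close>.\<close>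

lemma ex1_simplex_faces_4_4_2:
  assumes a: "a \<in> At X 3" and b: "b \<in> At X 3" and ab: "face X 3 2 a = face X 3 3 b"
  shows "\<exists>!z. z \<in> At X 4 \<and> face X 4 4 z = a \<and> face X 4 2 z = b"
proof -
  define t where "t i = (if i = 1 then Act X (verts [0, 1, 2] 3) a else if i = 2 then Act X (verts [0, 2, 3] 3) a
    else Act X (verts [0, 2, 3] 3) b)" for i :: nat
  have ab': "Act X (verts [0, 1, 3] 3) a = Act X (verts [0, 1, 2] 3) b" using ab by (simp add: face_eqs)
  have "Act X (verts [0, 2] 2) (Act X (verts [0, 1, 3] 3) a) = Act X (verts [0, 2] 2) (Act X (verts [0, 1, 2] 3) b)"
    using ab' by simp
  then have ab'': "Act X (verts [0, 3] 3) a = Act X (verts [0, 2] 3) b"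
    using a b by (simp add: act_simps)
  have t_mem: "t i \<in> At X 2" if "i \<in> {1..<4}" for i
    using a b by (simp add: t_def act_simps)
  have t_match: "Act X (verts [0, 2] 2) (t i) = Act X (verts [0, 1] 2) (t (Suc i))" if "1 \<le> i" "Suc i < 4" for i
  proof -
    have "i = 1 \<or> i = 2" using that by auto
    then show ?thesis using a b ab'' by (auto simp: t_def act_simps)
  qed
  have ex1: "\<exists>!z. z \<in> At X 4 \<and> (\<forall>i\<in>{1..<4}. Act X (verts [0, i, Suc i] 4) z = t i)"
    by (rule two_segal_fan_first[where t = t, OF X seg _ t_mem t_match]) auto
  have "(\<forall>i\<in>{1..<4}. Act X (verts [0, i, Suc i] 4) z = t i) \<longleftrightarrow> face X 4 4 z = a \<and> face X 4 2 z = b"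
    if z: "z \<in> At X 4" for z
  proof
    assume L: "\<forall>i\<in>{1..<4}. Act X (verts [0, i, Suc i] 4) z = t i"
    have L1: "Act X (verts [0, 1, 2] 4) z = Act X (verts [0, 1, 2] 3) a"
      and L2: "Act X (verts [0, 2, 3] 4) z = Act X (verts [0, 2, 3] 3) a"
      and L3: "Act X (verts [0, 3, 4] 4) z = Act X (verts [0, 2, 3] 3) b"
      using bspec[OF L, of 1] bspec[OF L, of 2] bspec[OF L, of 3] by (simp_all add: t_def eval_nat_numeral)
    have 1: "Act X (verts [0, 1, 2, 3] 4) z = a"
      by (rule eq_3_by_fan_first) (use z a L1 L2 in \<open>simp_all add: act_simps\<close>)
    have L3': "Act X (verts [0, 1, 3] 4) z = Act X (verts [0, 1, 2] 3) b"
      using z ab' unfolding 1[symmetric] by (simp add: act_simps)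
    have "Act X (verts [0, 1, 3, 4] 4) z = b"
      by (rule eq_3_by_fan_first) (use z b L3 L3' in \<open>simp_all add: act_simps\<close>)
    with 1 show "face X 4 4 z = a \<and> face X 4 2 z = b" by (simp add: face_eqs)
  next
    assume "face X 4 4 z = a \<and> face X 4 2 z = b"
    then have R: "a = Act X (verts [0, 1, 2, 3] 4) z" "b = Act X (verts [0, 1, 3, 4] 4) z" by (auto simp: face_eqs)
    have "t 1 = Act X (verts [0, 1, 2] 4) z" "t 2 = Act X (verts [0, 2, 3] 4) z" "t 3 = Act X (verts [0, 3, 4] 4) z"
      using z by (simp_all add: t_def R act_simps)
    moreover have "{1..<4} = {1, 2, 3 :: nat}" by auto
    ultimately show "\<forall>i\<in>{1..<4}. Act X (verts [0, i, Suc i] 4) z = t i"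
      by (simp add: eval_nat_numeral)
  qed
  with ex1 show ?thesis by (simp cong: conj_cong)
qed

text \<open>The filler for vertical composition of squares. The faces \<open>a\<close> and \<open>b\<close> have the vertices \<open>0, 1, 3, 4\<close> and \<open>1, 2, 3, 4\<close>, which share the triangle \<open>134\<close>.
  This time the fan at the last vertex is subordinate to the two faces: \<open>124\<close> and \<open>234\<close> determine \<open>b\<close>,
  and \<open>014\<close> and \<open>134\<close> determine \<open>a\<close>.\<close>

lemma ex1_simplex_faces_4_2_0:
  assumes a: "a \<in> At X 3" and b: "b \<in> At X 3" and ab: "face X 3 0 a = face X 3 1 b"
  shows "\<exists>!z. z \<in> At X 4 \<and> face X 4 2 z = a \<and> face X 4 0 z = b"
proof -
  define t where "t i = (if i = 0 then Act X (verts [0, 1, 3] 3) a else if i = 1 then Act X (verts [0, 1, 3] 3) b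
    else Act X (verts [1, 2, 3] 3) b)" for i :: nat
  have ab': "Act X (verts [1, 2, 3] 3) a = Act X (verts [0, 2, 3] 3) b" using ab by (simp add: face_eqs)
  have "Act X (verts [0, 2] 2) (Act X (verts [1, 2, 3] 3) a) = Act X (verts [0, 2] 2) (Act X (verts [0, 2, 3] 3) b)"
    using ab' by simp
  then have ab'': "Act X (verts [1, 3] 3) a = Act X (verts [0, 3] 3) b"
    using a b by (simp add: act_simps)
  have t_mem: "t i \<in> At X 2" if "i \<in> {0..<4 - 1}" for i
    using a b by (simp add: t_def act_simps)
  have t_match: "Act X (verts [1, 2] 2) (t i) = Act X (verts [0, 2] 2) (t (Suc i))" if "Suc i < 4 - 1" for i
  proof -
    have "i = 0 \<or> i = 1" using that by auto
    then show ?thesis using a b ab'' by (auto simp: t_def act_simps)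
  qed
  have ex1: "\<exists>!z. z \<in> At X 4 \<and> (\<forall>i\<in>{0..<4 - 1}. Act X (verts [i, Suc i, 4] 4) z = t i)"
    by (rule two_segal_fan_last[where t = t, OF X seg _ t_mem t_match]) auto
  have "(\<forall>i\<in>{0..<4 - 1}. Act X (verts [i, Suc i, 4] 4) z = t i) \<longleftrightarrow> face X 4 2 z = a \<and> face X 4 0 z = b"
    if z: "z \<in> At X 4" for z
  proof
    assume L: "\<forall>i\<in>{0..<4 - 1}. Act X (verts [i, Suc i, 4] 4) z = t i"
    have L0: "Act X (verts [0, 1, 4] 4) z = Act X (verts [0, 1, 3] 3) a"
      and L1: "Act X (verts [1, 2, 4] 4) z = Act X (verts [0, 1, 3] 3) b"
      and L2: "Act X (verts [2, 3, 4] 4) z = Act X (verts [1, 2, 3] 3) b"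
      using bspec[OF L, of 0] bspec[OF L, of 1] bspec[OF L, of 2] by (simp_all add: t_def eval_nat_numeral)
    have 1: "Act X (verts [1, 2, 3, 4] 4) z = b"
      by (rule eq_3_by_fan_last) (use z b L1 L2 in \<open>simp_all add: act_simps\<close>)
    have L0': "Act X (verts [1, 3, 4] 4) z = Act X (verts [1, 2, 3] 3) a"
      using z ab' unfolding 1[symmetric] by (simp add: act_simps)
    have "Act X (verts [0, 1, 3, 4] 4) z = a"
      by (rule eq_3_by_fan_last) (use z a L0 L0' in \<open>simp_all add: act_simps\<close>)
    with 1 show "face X 4 2 z = a \<and> face X 4 0 z = b" by (simp add: face_eqs)
  next
    assume "face X 4 2 z = a \<and> face X 4 0 z = b"
    then have R: "a = Act X (verts [0, 1, 3, 4] 4) z" "b = Act X (verts [1, 2, 3, 4] 4) z" by (auto simp: face_eqs)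
    have "t 0 = Act X (verts [0, 1, 4] 4) z" "t 1 = Act X (verts [1, 2, 4] 4) z" "t 2 = Act X (verts [2, 3, 4] 4) z"
      using z by (simp_all add: t_def R act_simps)
    moreover have "{0..<4 - 1} = {0, 1, 2 :: nat}" by auto
    ultimately show "\<forall>i\<in>{0..<4 - 1}. Act X (verts [i, Suc i, 4] 4) z = t i"
      by (simp add: eval_nat_numeral)
  qed
  with ex1 show ?thesis by (simp cong: conj_cong)
qed

text \<open>The two stability conditions are the 2-Segal conditions for the two triangulations of a
  quadrilateral.\<close>

lemma stable_path_ob: "stable (path_ob X)"
proof -
  have "bij_betw (\<lambda>z. (face X 3 1 z, face X 3 3 z)) (At X 3)
      {(f, g). f \<in> At X 2 \<and> g \<in> At X 2 \<and> face X 2 2 f = face X 2 1 g}"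
  proof (rule bij_betw_if_ex1)
    fix p assume "p \<in> {(f, g). f \<in> At X 2 \<and> g \<in> At X 2 \<and> face X 2 2 f = face X 2 1 g}"
    then show "\<exists>!z. z \<in> At X 3 \<and> (face X 3 1 z, face X 3 3 z) = p"
      using ex1_simplex_faces_3_3_1[of "snd p" "fst p"] by (cases p) (simp add: conj_commute)
  qed (simp add: act_simps)
  moreover have "bij_betw (\<lambda>z. (face X 3 2 z, face X 3 0 z)) (At X 3)
      {(g, f). g \<in> At X 2 \<and> f \<in> At X 2 \<and> face X 2 0 g = face X 2 1 f}"
  proof (rule bij_betw_if_ex1)
    fix p assume "p \<in> {(g, f). g \<in> At X 2 \<and> f \<in> At X 2 \<and> face X 2 0 g = face X 2 1 f}"
    then show "\<exists>!z. z \<in> At X 3 \<and> (face X 3 2 z, face X 3 0 z) = p"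
      using ex1_simplex_faces_3_2_0[of "fst p" "snd p"] by (cases p) simp
  qed (simp add: act_simps)
  ultimately show ?thesis unfolding stable_def path_ob_def by simp
qed

end

text \<open>Unitality for triangles says that a 2-simplex with degenerate first (or last) edge is itself
  degenerate, hence determined by its middle face \<open>d\<^sub>1\<close>. In both cases a degeneracy map is the inverse.\<close>

lemma augmented_path_ob:
  assumes X: "presheaf Delta X" and un: "unital X"
  shows "augmented (path_ob X)"
proof -
  note simps = Act_verts_verts[OF X] Act_verts_mem[OF X] face_eqs degen_eqs vertex_edge_eqs
  have id1: "Act X (verts [0, Suc 0] (Suc 0)) x = x" if "x \<in> At X (Suc 0)" for x
    using that by (intro Act_verts_id[OF X]) auto
  have edges: "edge X 2 0 = face X 2 2" "edge X 2 1 = face X 2 0"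
    unfolding vertex_edge_eqs face_eqs by (simp_all add: eval_nat_numeral)
  have "bij_betw (\<lambda>x. (degen X (2 - 1) i x, vertex X (2 - 1) i x)) (At X (2 - 1))
      {(y, v). y \<in> At X 2 \<and> v \<in> At X 0 \<and> edge X 2 i y = degen X 0 0 v}" if "i \<le> 1" for i
    using un[unfolded unital_def, rule_format, of 2 i] that by simp
  then have un': "y \<in> degen X (Suc 0) i ` At X (Suc 0)"
    if "i \<le> 1" "y \<in> At X 2" "edge X 2 i y = degen X 0 0 v" "v \<in> At X 0" for i y v
  proof -
    have "(y, v) \<in> (\<lambda>x. (degen X (2 - 1) i x, vertex X (2 - 1) i x)) ` At X (2 - 1)"
      using bij_betw_imp_surj_on[OF \<open>\<And>i. i \<le> 1 \<Longrightarrow> bij_betw _ _ _\<close>, OF that(1)] that by auto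
    then show ?thesis by auto
  qed
  have hor: "bij_betw (face X 2 1) {f \<in> At X 2. face X 2 2 f \<in> degen X 0 0 ` At X 0} (At X 1)"
  proof (rule bij_betw_byWitness[where f' = "degen X 1 0"])
    show "\<forall>f\<in>{f \<in> At X 2. face X 2 2 f \<in> degen X 0 0 ` At X 0}. degen X 1 0 (face X 2 1 f) = f"
    proof
      fix f assume "f \<in> {f \<in> At X 2. face X 2 2 f \<in> degen X 0 0 ` At X 0}"
      then obtain v where "f \<in> At X 2" "edge X 2 0 f = degen X 0 0 v" "v \<in> At X 0"
        unfolding edges by blast
      then obtain x where "x \<in> At X (Suc 0)" "f = degen X (Suc 0) 0 x" using un'[of 0 f v] by auto
      then show "degen X 1 0 (face X 2 1 f) = f" by (simp add: simps)
    qed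
    show "\<forall>x\<in>At X 1. face X 2 1 (degen X 1 0 x) = x" by (simp add: simps id1)
    show "face X 2 1 ` {f \<in> At X 2. face X 2 2 f \<in> degen X 0 0 ` At X 0} \<subseteq> At X 1" by (auto simp: simps)
    have "face X 2 2 (degen X 1 0 x) = degen X 0 0 (Act X (verts [0] 1) x)" "Act X (verts [0] 1) x \<in> At X 0"
        "degen X 1 0 x \<in> At X 2" if "x \<in> At X 1" for x
      using that by (simp_all add: simps)
    then show "degen X 1 0 ` At X 1 \<subseteq> {f \<in> At X 2. face X 2 2 f \<in> degen X 0 0 ` At X 0}"
      by auto
  qed
  have ver: "bij_betw (face X 2 1) {f \<in> At X 2. face X 2 0 f \<in> degen X 0 0 ` At X 0} (At X 1)"
  proof (rule bij_betw_byWitness[where f' = "degen X 1 1"])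
    show "\<forall>f\<in>{f \<in> At X 2. face X 2 0 f \<in> degen X 0 0 ` At X 0}. degen X 1 1 (face X 2 1 f) = f"
    proof
      fix f assume "f \<in> {f \<in> At X 2. face X 2 0 f \<in> degen X 0 0 ` At X 0}"
      then obtain v where "f \<in> At X 2" "edge X 2 1 f = degen X 0 0 v" "v \<in> At X 0"
        unfolding edges by blast
      then obtain x where "x \<in> At X (Suc 0)" "f = degen X (Suc 0) 1 x" using un'[of 1 f v] by auto
      then show "degen X 1 1 (face X 2 1 f) = f" by (simp add: simps)
    qed
    show "\<forall>x\<in>At X 1. face X 2 1 (degen X 1 1 x) = x" by (simp add: simps id1)
    show "face X 2 1 ` {f \<in> At X 2. face X 2 0 f \<in> degen X 0 0 ` At X 0} \<subseteq> At X 1" by (auto simp: simps)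
    have "face X 2 0 (degen X 1 1 x) = degen X 0 0 (Act X (verts [1] 1) x)" "Act X (verts [1] 1) x \<in> At X 0"
        "degen X 1 1 x \<in> At X 2" if "x \<in> At X 1" for x
      using that by (simp_all add: simps)
    then show "degen X 1 1 ` At X 1 \<subseteq> {f \<in> At X 2. face X 2 0 f \<in> degen X 0 0 ` At X 0}"
      by auto
  qed
  have "degen X 0 0 ` At X 0 \<subseteq> At X 1" by (auto simp: simps)
  with hor ver show ?thesis by (simp add: augmented_def path_ob_def)
qed

section \<open>Simplices as double functors into the path construction\<close>

definition simplex_functor :: "'a sset \<Rightarrow> nat \<Rightarrow> 'a \<Rightarrow> ('a, 'a, 'a, 'a) wfun" where
  "simplex_functor X n x =
     \<lparr>DOb = (\<lambda>(i, j)\<in>Ob (W n). Act X (verts [i, j] n) x),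
      DHor = (\<lambda>(i, j, l)\<in>Hor (W n). Act X (verts [i, j, l] n) x),
      DVer = (\<lambda>(i, k, j)\<in>Ver (W n). Act X (verts [i, k, j] n) x),
      DSq = (\<lambda>(i, k, j, l)\<in>Sq (W n). Act X (verts [i, k, j, l] n) x)\<rparr>"

lemma simplex_functor_apply:
  "i \<le> j \<Longrightarrow> j \<le> n \<Longrightarrow> DOb (simplex_functor X n x) (i, j) = Act X (verts [i, j] n) x"
  "i \<le> j \<Longrightarrow> j \<le> l \<Longrightarrow> l \<le> n \<Longrightarrow> DHor (simplex_functor X n x) (i, j, l) = Act X (verts [i, j, l] n) x"
  "i \<le> k \<Longrightarrow> k \<le> j \<Longrightarrow> j \<le> n \<Longrightarrow> DVer (simplex_functor X n x) (i, k, j) = Act X (verts [i, k, j] n) x"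
  "i \<le> k \<Longrightarrow> k \<le> j \<Longrightarrow> j \<le> l \<Longrightarrow> l \<le> n \<Longrightarrow> DSq (simplex_functor X n x) (i, k, j, l) = Act X (verts [i, k, j, l] n) x"
  by (simp_all add: simplex_functor_def)

text \<open>Composites in \<open>path_ob X\<close> are faces of fillers; for restrictions of a simplex \<open>x\<close> the filler is the
  restriction of \<open>x\<close> to the union of the vertices.\<close>

lemma simplex_functor_DHom:
  assumes X: "presheaf Delta X" and seg: "two_segal X" and x: "x \<in> At X n"
  shows "simplex_functor X n x \<in> DHom (W n) (path_ob X)"
proof (rule DHom_W_I)
  fix i assume "i \<le> n"
  then have "Act X (verts [i, i] n) x = degen X 0 0 (Act X (verts [i] n) x)" "Act X (verts [i] n) x \<in> At X 0"
    using x by (simp_all add: Act_verts_verts[OF X] Act_verts_mem[OF X] face_eqs degen_eqs)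
  with \<open>i \<le> n\<close> show "DOb (simplex_functor X n x) (i, i) \<in> Aug (path_ob X)"
    by (simp add: path_ob_def simplex_functor_apply)
next
  fix i k j l assume ij: "i \<le> k" "k \<le> j" "j \<le> l" "l \<le> n"
  let ?z = "Act X (verts [i, k, j, l] n) x"
  have "fill X 3 3 1 (Act X (verts [i, k, j] n) x) (Act X (verts [i, j, l] n) x) = ?z"
    using x ij by (intro fill_eqI ex1_simplex_faces_3_3_1[OF X seg]) (simp_all add: Act_verts_verts[OF X] Act_verts_mem[OF X] face_eqs degen_eqs)
  moreover have "fill X 3 2 0 (Act X (verts [i, k, l] n) x) (Act X (verts [k, j, l] n) x) = ?z"
    using x ij by (intro fill_eqI ex1_simplex_faces_3_2_0[OF X seg]) (simp_all add: Act_verts_verts[OF X] Act_verts_mem[OF X] face_eqs degen_eqs)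
  ultimately show "DHor (simplex_functor X n x) (i, k, l) =
      hcomp (path_ob X) (DHor (simplex_functor X n x) (i, j, l)) (DHor (simplex_functor X n x) (i, k, j)) \<and>
    DVer (simplex_functor X n x) (i, j, l) =
      vcomp (path_ob X) (DVer (simplex_functor X n x) (k, j, l)) (DVer (simplex_functor X n x) (i, k, l))"
    using x ij by (simp add: path_ob_def simplex_functor_apply Act_verts_verts[OF X] Act_verts_mem[OF X] face_eqs degen_eqs)
next
  fix i k j l m assume ij: "i \<le> k" "k \<le> j" "j \<le> l" "l \<le> m" "m \<le> n"
  let ?z = "Act X (verts [i, k, j, l, m] n) x"
  have "fill X 4 4 2 (Act X (verts [i, k, j, l] n) x) (Act X (verts [i, k, l, m] n) x) = ?z"
    using x ij by (intro fill_eqI ex1_simplex_faces_4_4_2[OF X seg]) (simp_all add: Act_verts_verts[OF X] Act_verts_mem[OF X] face_eqs degen_eqs)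
  moreover have "fill X 4 2 0 (Act X (verts [i, k, l, m] n) x) (Act X (verts [k, j, l, m] n) x) = ?z"
    using x ij by (intro fill_eqI ex1_simplex_faces_4_2_0[OF X seg]) (simp_all add: Act_verts_verts[OF X] Act_verts_mem[OF X] face_eqs degen_eqs)
  ultimately show "DSq (simplex_functor X n x) (i, k, j, m) =
      sq_hcomp (path_ob X) (DSq (simplex_functor X n x) (i, k, l, m)) (DSq (simplex_functor X n x) (i, k, j, l)) \<and>
    DSq (simplex_functor X n x) (i, j, l, m) =
      sq_vcomp (path_ob X) (DSq (simplex_functor X n x) (k, j, l, m)) (DSq (simplex_functor X n x) (i, k, l, m))"
    using x ij by (simp add: path_ob_def simplex_functor_apply Act_verts_verts[OF X] Act_verts_mem[OF X] face_eqs degen_eqs)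
qed (use x in \<open>simp_all add: path_ob_def simplex_functor_apply Act_verts_verts[OF X] Act_verts_mem[OF X] face_eqs degen_eqs, simp_all add: simplex_functor_def\<close>)

text \<open>For \<open>n \<ge> 2\<close> the arrows \<open>(0, i, i + 1)\<close> of a double functor are matching data for the fan at \<open>0\<close>, as
  target and source of consecutive arrows are the common diagonal. The simplex they glue to induces
  the given functor by rigidity. For \<open>n = 1\<close> the simplex is the object \<open>(0, 1)\<close>, and for
  \<open>n = 0\<close> it is the vertex whose degeneracy is the object \<open>(0, 0)\<close> of the augmentation.\<close>

lemma simplex_functor_bij:
  assumes X: "presheaf Delta X" and seg: "two_segal X" and un: "unital X"
  shows "bij_betw (simplex_functor X n) (At X n) (DHom (W n) (path_ob X))"
proof -
  note simps = Act_verts_verts[OF X] Act_verts_mem[OF X] face_eqs degen_eqs simplex_functor_apply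
  note st = stable_path_ob[OF X seg] and au = augmented_path_ob[OF X un]
  note hom = simplex_functor_DHom[OF X seg]
  have id1: "Act X (verts [0, Suc 0] (Suc 0)) x = x" if "x \<in> At X (Suc 0)" for x
    using that by (intro Act_verts_id[OF X]) auto
  have id0: "Act X (verts [0] 0) x = x" if "x \<in> At X 0" for x
    using that by (intro Act_verts_id[OF X]) auto
  show ?thesis
    unfolding bij_betw_def
  proof (intro conjI inj_onI equalityI subsetI)
    fix x y assume x: "x \<in> At X n" and y: "y \<in> At X n" and eq: "simplex_functor X n x = simplex_functor X n y"
    have ob: "Act X (verts [0, n] n) x = Act X (verts [0, n] n) y"
      using arg_cong[OF eq, of "\<lambda>F. DOb F (0, n)"] by (simp add: simps)
    have hor: "Act X (verts [0, i, Suc i] n) x = Act X (verts [0, i, Suc i] n) y" if "i < n" for i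
      using arg_cong[OF eq, of "\<lambda>F. DHor F (0, i, Suc i)"] that by (simp add: simps)
    consider "n = 0" | "n = 1" | "n \<ge> 2" by linarith
    then show "x = y"
    proof cases
      case 1
      then have "Act X (verts [0] 1) (Act X (verts [0, 0] 0) x) = Act X (verts [0] 1) (Act X (verts [0, 0] 0) y)"
        using ob by simp
      then show ?thesis using x y 1 by (simp add: simps id0)
    next
      case 2
      then show ?thesis using ob x y by (simp add: id1)
    next
      case 3
      then show ?thesis using fan_first_inj[OF X seg _ x y] hor by blast
    qed
  next
    fix F assume "F \<in> simplex_functor X n ` At X n"
    then show "F \<in> DHom (W n) (path_ob X)" using hom by blast
  next
    fix F assume F: "F \<in> DHom (W n) (path_ob X)"
    have eqI: "F \<in> simplex_functor X n ` At X n"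
      if x: "x \<in> At X n" and ob: "Act X (verts [0, n] n) x = DOb F (0, n)"
        and fan: "\<And>j. 1 \<le> j \<Longrightarrow> j < n \<Longrightarrow> Act X (verts [0, j, Suc j] n) x = DHor F (0, j, Suc j)" for x
    proof -
      have "simplex_functor X n x = F"
        using ob fan by (intro W_functor_eq_if_fan_eq[OF st au hom[OF x] F]) (simp_all add: simps)
      with x show ?thesis by blast
    qed
    consider "n = 0" | "n = 1" | "n \<ge> 2" by linarith
    then show "F \<in> simplex_functor X n ` At X n"
    proof cases
      case 1
      have "DOb F (0, 0) \<in> Aug (path_ob X)" using F 1 unfolding DHom_W_iff by simp
      then obtain v where "v \<in> At X 0" "DOb F (0, 0) = Act X (verts [0, 0] 0) v"
        by (auto simp: path_ob_def degen_eqs)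
      then show ?thesis using 1 by (intro eqI[of v]) auto
    next
      case 2
      have "DOb F (0, 1) \<in> At X 1" using F 2 unfolding DHom_W_iff by (simp add: path_ob_def)
      then show ?thesis using 2 by (intro eqI[of "DOb F (0, 1)"]) (auto simp: id1)
    next
      case 3
      have hor: "DHor F (0, i, Suc i) \<in> At X 2"
          "face X 2 2 (DHor F (0, i, Suc i)) = DOb F (0, i)" "face X 2 1 (DHor F (0, i, Suc i)) = DOb F (0, Suc i)"
        if "i < n" for i
        using F that unfolding DHom_W_iff by (simp_all add: path_ob_def)
      have ex1: "\<exists>!x. x \<in> At X n \<and> (\<forall>i\<in>{1..<n}. Act X (verts [0, i, Suc i] n) x = DHor F (0, i, Suc i))"
        using 3 hor by (intro two_segal_fan_first[OF X seg]) (simp_all add: face_eqs)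
      obtain x where x: "x \<in> At X n"
        and fan': "\<forall>i\<in>{1..<n}. Act X (verts [0, i, Suc i] n) x = DHor F (0, i, Suc i)"
        using ex1_implies_ex[OF ex1] by blast
      have fan: "Act X (verts [0, i, Suc i] n) x = DHor F (0, i, Suc i)" if "1 \<le> i" "i < n" for i
        using fan' that by simp
      obtain m where m: "n = Suc m" "1 \<le> m" using 3 by (cases n) auto
      have "Act X (verts [0, n] n) x = face X 2 1 (Act X (verts [0, m, n] n) x)"
        using x m by (simp add: simps)
      also have "\<dots> = DOb F (0, n)" using fan[of m] hor(3)[of m] m by simp
      finally show ?thesis using x fan by (intro eqI)
    qed
  qed
qed

lemma simplex_functor_Act:
  assumes X: "presheaf Delta X" and seg: "two_segal X" and f: "f \<in> Arr Delta" and x: "x \<in> At X (Cod Delta f)"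
  shows "simplex_functor X (Dom Delta f) (Act X f x) = dcomp (W (Dom Delta f)) (simplex_functor X (Cod Delta f) x) (Wmap f)"
proof -
  obtain l where l: "f = verts l (Cod Delta f)" "length l = Suc (Dom Delta f)" "sorted l" "set l \<subseteq> {..Cod Delta f}"
    using f by (rule verts_exists)
  have le: "l ! i \<le> l ! j" if "i \<le> j" "j \<le> Dom Delta f" for i j
    using l(2,3) that by (intro sorted_nth_mono) auto
  have n: "l ! i \<le> Cod Delta f" if "i \<le> Dom Delta f" for i
    using subsetD[OF l(4) nth_mem, of i] l(2) that by simp
  have restr: "Act X (verts k (Dom Delta f)) (Act X f x) = Act X (verts (map ((!) l) k) (Cod Delta f)) x"
    if "k \<noteq> []" "sorted k" "set k \<subseteq> {..Dom Delta f}" for k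
    using Act_verts_verts[OF X x l(2-4) that] l(1) by simp
  have Wmap_f: "i \<le> j \<Longrightarrow> j \<le> Dom Delta f \<Longrightarrow> DOb (Wmap f) (i, j) = (l ! i, l ! j)"
    "i \<le> j \<Longrightarrow> j \<le> k \<Longrightarrow> k \<le> Dom Delta f \<Longrightarrow> DHor (Wmap f) (i, j, k) = (l ! i, l ! j, l ! k)"
    "i \<le> j \<Longrightarrow> j \<le> k \<Longrightarrow> k \<le> Dom Delta f \<Longrightarrow> DVer (Wmap f) (i, j, k) = (l ! i, l ! j, l ! k)"
    "i \<le> j \<Longrightarrow> j \<le> k \<Longrightarrow> k \<le> m \<Longrightarrow> m \<le> Dom Delta f \<Longrightarrow> DSq (Wmap f) (i, j, k, m) = (l ! i, l ! j, l ! k, l ! m)"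
    for i j k m
    by (subst l(1), simp add: Wmap_verts_apply l(2))+
  show ?thesis
    by (rule DHom_eqI[OF simplex_functor_DHom[OF X seg presheaf_simps(1)[OF X f x]]
          dcomp_DHom[OF aug_stable_dcat_W Wmap_DHom[OF f] simplex_functor_DHom[OF X seg x]]])
       (auto simp: dcomp_apply simplex_functor_apply Wmap_f restr le n)
qed

context
  fixes X :: "'a sset" and Y :: "'b sset" and \<theta>
  assumes X: "presheaf Delta X" and Y: "presheaf Delta Y" and \<theta>: "\<theta> \<in> NatTrans Delta X Y"
begin

lemma NatTrans_verts:
  assumes "x \<in> At X n" "length l = Suc m" "sorted l" "set l \<subseteq> {..n}"
  shows "\<theta> m (Act X (verts l n) x) = Act Y (verts l n) (\<theta> n x)"
  using NatTrans_natural[OF \<theta> verts_Arr[of l n], of x] assms by (cases l) auto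

lemma simplex_functor_nat:
  assumes "x \<in> At X n"
  shows "simplex_functor Y n (\<theta> n x) = dcomp (W n) (path_nat \<theta>) (simplex_functor X n x)"
  using assms
  by (auto simp: simplex_functor_def dcomp_def compose_def fun_eq_iff path_nat_def NatTrans_verts)

text \<open>A simplicial map preserves composites because it maps fillers to simplices with the correct faces,
  and these are unique.\<close>

lemma path_nat_DHom:
  assumes segX: "two_segal X" and segY: "two_segal Y"
  shows "path_nat \<theta> \<in> DHom (path_ob X) (path_ob Y)"
proof -
  note mem = NatTrans_mem[OF \<theta>, of n for n, simplified]
  note simps = Act_verts_verts[OF X] Act_verts_mem[OF X] Act_verts_verts[OF Y] Act_verts_mem[OF Y] face_eqs degen_eqs NatTrans_verts mem
  have ext: "\<theta> n \<in> extensional (At X n)" for n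
    using \<theta> unfolding NatTrans_def by (auto simp: PiE_iff)
  have hcomp: "\<theta> 2 (face X 3 2 (fill X 3 3 1 f g)) = face Y 3 2 (fill Y 3 3 1 (\<theta> 2 f) (\<theta> 2 g))"
    if fg: "f \<in> At X 2" "g \<in> At X 2" "face X 2 1 f = face X 2 2 g" for f g
  proof -
    obtain z where z: "z \<in> At X 3" "face X 3 3 z = f" "face X 3 1 z = g"
      using ex1_simplex_faces_3_3_1[OF X segX fg] by blast
    have "fill X 3 3 1 f g = z" by (rule fill_eqI[OF ex1_simplex_faces_3_3_1[OF X segX fg] z])
    moreover have "fill Y 3 3 1 (\<theta> 2 f) (\<theta> 2 g) = \<theta> 3 z"
      using z by (intro fill_eqI ex1_simplex_faces_3_3_1[OF Y segY]) (auto simp: simps)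
    ultimately show ?thesis using z(1) by (simp add: simps)
  qed
  have vcomp: "\<theta> 2 (face X 3 1 (fill X 3 2 0 f g)) = face Y 3 1 (fill Y 3 2 0 (\<theta> 2 f) (\<theta> 2 g))"
    if fg: "f \<in> At X 2" "g \<in> At X 2" "face X 2 0 f = face X 2 1 g" for f g
  proof -
    obtain z where z: "z \<in> At X 3" "face X 3 2 z = f" "face X 3 0 z = g"
      using ex1_simplex_faces_3_2_0[OF X segX fg] by blast
    have "fill X 3 2 0 f g = z" by (rule fill_eqI[OF ex1_simplex_faces_3_2_0[OF X segX fg] z])
    moreover have "fill Y 3 2 0 (\<theta> 2 f) (\<theta> 2 g) = \<theta> 3 z"
      using z by (intro fill_eqI ex1_simplex_faces_3_2_0[OF Y segY]) (auto simp: simps)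
    ultimately show ?thesis using z(1) by (simp add: simps)
  qed
  have sq_hcomp: "\<theta> 3 (face X 4 3 (fill X 4 4 2 a b)) = face Y 4 3 (fill Y 4 4 2 (\<theta> 3 a) (\<theta> 3 b))"
    if ab: "a \<in> At X 3" "b \<in> At X 3" "face X 3 2 a = face X 3 3 b" for a b
  proof -
    obtain z where z: "z \<in> At X 4" "face X 4 4 z = a" "face X 4 2 z = b"
      using ex1_simplex_faces_4_4_2[OF X segX ab] by blast
    have "fill X 4 4 2 a b = z" by (rule fill_eqI[OF ex1_simplex_faces_4_4_2[OF X segX ab] z])
    moreover have "fill Y 4 4 2 (\<theta> 3 a) (\<theta> 3 b) = \<theta> 4 z"
      using z by (intro fill_eqI ex1_simplex_faces_4_4_2[OF Y segY]) (auto simp: simps)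
    ultimately show ?thesis using z(1) by (simp add: simps)
  qed
  have sq_vcomp: "\<theta> 3 (face X 4 1 (fill X 4 2 0 a b)) = face Y 4 1 (fill Y 4 2 0 (\<theta> 3 a) (\<theta> 3 b))"
    if ab: "a \<in> At X 3" "b \<in> At X 3" "face X 3 0 a = face X 3 1 b" for a b
  proof -
    obtain z where z: "z \<in> At X 4" "face X 4 2 z = a" "face X 4 0 z = b"
      using ex1_simplex_faces_4_2_0[OF X segX ab] by blast
    have "fill X 4 2 0 a b = z" by (rule fill_eqI[OF ex1_simplex_faces_4_2_0[OF X segX ab] z])
    moreover have "fill Y 4 2 0 (\<theta> 3 a) (\<theta> 3 b) = \<theta> 4 z"
      using z by (intro fill_eqI ex1_simplex_faces_4_2_0[OF Y segY]) (auto simp: simps)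
    ultimately show ?thesis using z(1) by (simp add: simps)
  qed
  have aug: "\<theta> 1 (degen X 0 0 v) \<in> degen Y 0 0 ` At Y 0" if "v \<in> At X 0" for v
    using that by (simp add: simps)
  show ?thesis
    unfolding DHom_def is_functor_def hcat_def vcat_def sq_hcat_def sq_vcat_def path_ob_def path_nat_def
    using ext aug hcomp vcomp sq_hcomp sq_vcomp
    by (auto simp: simps)
qed

end

lemma path_nat_nid: "path_nat (nid Delta X) = did (path_ob X)"
  by (simp add: path_nat_def nid_def did_def path_ob_def)

lemma path_nat_ncomp: "path_nat (ncomp Delta X \<psi> \<theta>) = dcomp (path_ob X) (path_nat \<psi>) (path_nat \<theta>)"
  by (simp add: path_nat_def ncomp_def dcomp_def path_ob_def compose_def)

lemma U2Seg_simps: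
  "X \<in> Obj U2Seg \<longleftrightarrow> presheaf Delta X \<and> two_segal X \<and> unital X"
  "(X, \<theta>, Y) \<in> Arr U2Seg \<longleftrightarrow> X \<in> Obj U2Seg \<and> Y \<in> Obj U2Seg \<and> \<theta> \<in> NatTrans Delta X Y"
  "Dom U2Seg (X, \<theta>, Y) = X" "Cod U2Seg (X, \<theta>, Y) = Y"
  "Ide U2Seg X = (X, nid Delta X, X)"
  "Comp U2Seg (Y, \<psi>, Z) (X, \<theta>, Y') = (X, ncomp Delta X \<psi> \<theta>, Z)"
  by (auto simp: U2Seg_def full_subcat_def PSh_def)

lemma is_functor_J: "is_functor U2Seg (PSh Delta) J"
  unfolding is_functor_def by (auto simp: U2Seg_simps J_def PSh_def)

lemma is_functor_wald_path: "is_functor U2Seg (PSh Delta) (J \<circ>\<^sub>F \<sigma> \<circ>\<^sub>F \<pi>)"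
proof -
  have hom: "path_nat \<theta> \<in> DHom (path_ob X) (path_ob Y)" if "(X, \<theta>, Y) \<in> Arr U2Seg" for X Y :: "'a sset" and \<theta>
    using that path_nat_DHom by (auto simp: U2Seg_simps)
  have comp: "wald_nat (path_ob X) (path_nat (ncomp Delta X \<psi> \<theta>)) =
      ncomp Delta (wald_ob (path_ob X)) (wald_nat (path_ob Y) (path_nat \<psi>)) (wald_nat (path_ob X) (path_nat \<theta>))"
    if "(X, \<theta>, Y) \<in> Arr U2Seg" "(Y, \<psi>, Z) \<in> Arr U2Seg" for X Y Z :: "'a sset" and \<theta> \<psi>
    unfolding path_nat_ncomp by (rule wald_nat_dcomp[OF hom[OF that(1)] hom[OF that(2)]])
  show ?thesis
    unfolding is_functor_def
    using hom comp
    by (auto simp: U2Seg_simps(3-6) PSh_def presheaf_wald_ob wald_nat_NatTrans path_nat_nid wald_nat_did)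
qed

text \<open>One half of the equivalence between unital 2-Segal sets and augmented stable double categories.\<close>

lemma J_iso_wald_path: "naturally_isomorphic U2Seg Delta J (J \<circ>\<^sub>F \<sigma> \<circ>\<^sub>F \<pi>)"
proof (rule naturally_isomorphicI[OF category_Delta is_functor_J is_functor_wald_path,
      where \<eta> = "\<lambda>X. \<lambda>n\<in>Obj Delta. \<lambda>x\<in>At X n. simplex_functor X n x"])
  fix X :: "'a sset" assume "X \<in> Obj U2Seg"
  then have X: "presheaf Delta X" "two_segal X" "unital X" by (auto simp: U2Seg_simps)
  have bij: "bij_betw (simplex_functor X n) (At X n) (DHom (W n) (path_ob X))" for n
    by (rule simplex_functor_bij[OF X])
  show "(\<lambda>n\<in>Obj Delta. \<lambda>x\<in>At X n. simplex_functor X n x) \<in> NatTrans Delta (FOb J X) (FOb (J \<circ>\<^sub>F \<sigma> \<circ>\<^sub>F \<pi>) X)"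
  proof (rule NatTransI)
    fix n :: nat
    show "(\<lambda>n\<in>Obj Delta. \<lambda>x\<in>At X n. simplex_functor X n x) n \<in> At (FOb J X) n \<rightarrow>\<^sub>E At (FOb (J \<circ>\<^sub>F \<sigma> \<circ>\<^sub>F \<pi>) X) n"
      using simplex_functor_DHom[OF X(1,2)] by (auto simp: wald_ob_def)
  next
    fix f x assume f: "f \<in> Arr Delta" and x: "x \<in> At (FOb J X) (Cod Delta f)"
    then show "(\<lambda>n\<in>Obj Delta. \<lambda>x\<in>At X n. simplex_functor X n x) (Dom Delta f) (Act (FOb J X) f x) =
        Act (FOb (J \<circ>\<^sub>F \<sigma> \<circ>\<^sub>F \<pi>) X) f ((\<lambda>n\<in>Obj Delta. \<lambda>x\<in>At X n. simplex_functor X n x) (Cod Delta f) x)"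
      using simplex_functor_Act[OF X(1,2) f] presheaf_simps(1)[OF X(1) f] by (simp add: wald_ob_def)
  qed simp
  show "bij_betw ((\<lambda>n\<in>Obj Delta. \<lambda>x\<in>At X n. simplex_functor X n x) n) (At (FOb J X) n) (At (FOb (J \<circ>\<^sub>F \<sigma> \<circ>\<^sub>F \<pi>) X) n)" for n
  proof -
    have "bij_betw (\<lambda>x\<in>At X n. simplex_functor X n x) (At X n) (DHom (W n) (path_ob X))"
      using bij[of n] by (rule bij_betw_cong[THEN iffD1, rotated]) simp
    then show ?thesis by (simp add: wald_ob_def)
  qed
next
  fix f :: "'a smap" and n x
  assume f: "f \<in> Arr U2Seg" and x: "x \<in> At (FOb J (Dom U2Seg f)) n"
  obtain X \<theta> Y where fX: "f = (X, \<theta>, Y)" by (cases f)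
  have X: "presheaf Delta X" "two_segal X" and Y: "presheaf Delta Y" and \<theta>: "\<theta> \<in> NatTrans Delta X Y"
    using f by (auto simp: fX U2Seg_simps)
  have x': "x \<in> At X n" using x by (simp add: fX U2Seg_simps)
  show "(\<lambda>n\<in>Obj Delta. \<lambda>x\<in>At (Cod U2Seg f) n. simplex_functor (Cod U2Seg f) n x) n (under (FAr J f) n x) =
      under (FAr (J \<circ>\<^sub>F \<sigma> \<circ>\<^sub>F \<pi>) f) n ((\<lambda>n\<in>Obj Delta. \<lambda>x\<in>At (Dom U2Seg f) n. simplex_functor (Dom U2Seg f) n x) n x)"
    using x' NatTrans_mem[OF \<theta> _ x'] simplex_functor_nat[OF X(1) Y \<theta> x'] simplex_functor_DHom[OF X x']
    by (simp add: fX U2Seg_simps under_def wald_nat_def)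
qed

section \<open>The two natural isomorphisms\<close>

theorem proposition3p7:
  shows "naturally_isomorphic (U2Seg :: ('a sset, 'a smap) cat) Sigma_cat
           (N\<^sup>a \<circ>\<^sub>F \<pi>) (p\<^sup>* \<circ>\<^sub>F J) \<and>
         naturally_isomorphic (DCat :: (('o, 'h, 'v, 's) dcat, ('o, 'h, 'v, 's) dmor) cat) Delta
           (J \<circ>\<^sub>F \<sigma>) (p\<^sub>* \<circ>\<^sub>F N\<^sup>a)"
proof
  have "N\<^sup>a \<circ>\<^sub>F \<pi> = p\<^sup>* \<circ>\<^sub>F (J \<circ>\<^sub>F \<sigma> \<circ>\<^sub>F (\<pi> :: ('a sset, 'a smap, _, _) fctr))"
    unfolding nerve_eq_p_upper_wald by (simp add: fcomp_def comp_assoc)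
  then show "naturally_isomorphic (U2Seg :: ('a sset, 'a smap) cat) Sigma_cat (N\<^sup>a \<circ>\<^sub>F \<pi>) (p\<^sup>* \<circ>\<^sub>F J)"
    using p_upper_naturally_isomorphic[OF naturally_isomorphic_sym[OF category_U2Seg category_Delta J_iso_wald_path]]
    by simp
qed (rule wald_iso_p_lower_nerve)

end
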